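(* Let $(X,\lambda)$ be a standard $\sigma$-finite space and let $\mathbb{G}=[\mathcal{R}_G]\leqslant\mathrm{Aut}(X,\lambda)$ be an ergodic orbit full group (associated with a Borel action of a Polish group $G$ on $(X,\lambda)$) such that the topology $\tau_m^o$ of orbital convergence in measure is Polish on $\mathbb{G}$. Then $(\mathbb{G},\tau_m^o)$ is contractible.
   Context: A standard $\sigma$-finite space $(X,\lambda)$ is a standard Borel space $X$ with an atomless $\sigma$-finite Borel measure $\lambda$ such that $\lambda(X)=+\infty$. $\mathrm{Aut}(X,\lambda)$ is the group of Borel bijections $T$ of $X$ with $\lambda(T(A))=\lambda(T^{-1}(A))=\lambda(A)$ for every Borel $A$, where two bijections are identified when they coincide on a conull set. A subgroup $\mathbb{G}\leqslant\mathrm{Aut}(X,\lambda)$ is ergodic if every Borel $A\subseteq X$ with $\lambda(T(A)\Delta A)=0$ for all $T\in\mathbb{G}$ is null or conull. For a Borel action of a Polish group $(G,\tau_G)$ on $(X,\lambda)$, the orbit full group is $[\mathcal{R}_G]=\{T\in\mathrm{Aut}(X,\lambda) : T(x)\in G\cdot x \text{ for almost all } x\in X\}$. $\mathrm{L}^0(X,\lambda,G)$ is the space of Lebesgue-measurable maps $X\to G$ modulo a.e. equality, with the topology of convergence in measure, induced by the metric $\tilde d(f,g)=\int_X d(f(x),g(x))\,d\mu(x)$, where $d$ is any compatible bounded metric on $G$ and $\mu$ any probability measure equivalent to $\lambda$ (the topology does not depend on these choices). For $f\in \mathrm{L}^0(X,\lambda,G)$ put $\Phi(f)(x)=f(x)\cdot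 x$, and let $\widetilde{[\mathcal{R}_G]}$ be the set of $f$ with $\Phi(f)\in\mathrm{Aut}(X,\lambda)$. Then $\Phi$ maps $\widetilde{[\mathcal{R}_G]}$ onto $[\mathcal{R}_G]$, and the topology of orbital convergence in measure $\tau_m^o$ on $[\mathcal{R}_G]$ is the quotient topology, via $\Phi$, of the topology of convergence in measure on $\widetilde{[\mathcal{R}_G]}$. "$\tau_m^o$ is Polish on $\mathbb{G}$" means that $(\mathbb{G},\tau_m^o)$ is a Polish group. *)

theory Defs
  imports "HOL-Probability.Probability_Measure" "HOL-Algebra.Group_Action"
begin

section \<open>Polish groups and standard Borel spaces\<close>

definition polish_topology :: "'a topology \<Rightarrow> bool" where
  "polish_topology T \<longleftrightarrow> completely_metrizable_space T \<and> separable_space T"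

definition borel_of :: "'a topology \<Rightarrow> 'a measure" where
  "borel_of T = sigma (topspace T) {U. openin T U}"

definition topological_group_on :: "('g, 'c) monoid_scheme \<Rightarrow> 'g topology \<Rightarrow> bool" where
  "topological_group_on G T \<longleftrightarrow>
     group G \<and> topspace T = carrier G \<and>
     continuous_map (prod_topology T T) T (\<lambda>(g, h). g \<otimes>\<^bsub>G\<^esub> h) \<and>
     continuous_map T T (\<lambda>g. inv\<^bsub>G\<^esub> g)"

definition polish_group :: "('g, 'c) monoid_scheme \<Rightarrow> 'g topology \<Rightarrow> bool" where
  "polish_group G T \<longleftrightarrow> topological_group_on G T \<and> polish_topology T"

definition standard_borel :: "'a measure \<Rightarrow> bool" where
  "standard_borel M \<longleftrightarrow>
     (\<exists>T. polish_topology T \<and> space M = topspace T \<and> sets M = sets (borel_of T))"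

definition atomless :: "'a measure \<Rightarrow> bool" where
  "atomless M \<longleftrightarrow>
     (\<forall>A\<in>sets M. 0 < emeasure M A \<longrightarrow>
        (\<exists>B\<in>sets M. B \<subseteq> A \<and> 0 < emeasure M B \<and> emeasure M B < emeasure M A))"

definition standard_sigma_finite_space :: "'a measure \<Rightarrow> bool" where
  "standard_sigma_finite_space M \<longleftrightarrow>
     standard_borel M \<and> atomless M \<and> sigma_finite_measure M \<and> emeasure M (space M) = \<infinity>"


section \<open>The group of measure-preserving automorphisms\<close>

text \<open>Images of Borel sets under a Borel bijection of a standard Borel space are Borel
  (Lusin--Souslin); the requirement is spelled out because \<^const>\<open>emeasure\<close> is \<open>0\<close> on
  non-measurable sets. Values of \<open>T\<close> outside \<^term>\<open>space M\<close> are irrelevant; they are identified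
  in \<open>aut_class\<close>.\<close>

definition mp_bijections :: "'a measure \<Rightarrow> ('a \<Rightarrow> 'a) set" where
  "mp_bijections M =
     {T. bij_betw T (space M) (space M) \<and>
         (\<forall>A\<in>sets M. T ` A \<in> sets M \<and> T -` A \<inter> space M \<in> sets M \<and>
            emeasure M (T ` A) = emeasure M A \<and>
            emeasure M (T -` A \<inter> space M) = emeasure M A)}"

text \<open>Elements of \<open>Aut(X, \<lambda>)\<close> are classes of bijections modulo almost everywhere equality.
  The map \<open>T\<close> in \<open>aut_class M T\<close> may be arbitrary: the class is nonempty if and only if \<open>T\<close>
  agrees almost everywhere with a measure-preserving bijection.\<close>

definition aut_class :: "'a measure \<Rightarrow> ('a \<Rightarrow> 'a) \<Rightarrow> ('a \<Rightarrow> 'a) set" where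
  "aut_class M T = {S \<in> mp_bijections M. AE x in M. S x = T x}"

definition Aut :: "'a measure \<Rightarrow> ('a \<Rightarrow> 'a) set monoid" where
  "Aut M =
     \<lparr>carrier = aut_class M ` mp_bijections M,
      monoid.mult = (\<lambda>C D. \<Union>T\<in>C. \<Union>S\<in>D. aut_class M (T \<circ> S)),
      one = aut_class M id\<rparr>"

definition ergodic :: "'a measure \<Rightarrow> ('a \<Rightarrow> 'a) set set \<Rightarrow> bool" where
  "ergodic M \<G> \<longleftrightarrow>
     (\<forall>A\<in>sets M. (\<forall>C\<in>\<G>. \<forall>T\<in>C. emeasure M (sym_diff (T ` A) A) = 0) \<longrightarrow>
        A \<in> null_sets M \<or> space M - A \<in> null_sets M)"


section \<open>Borel actions and orbit full groups\<close>

definition borel_action ::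
  "('g, 'c) monoid_scheme \<Rightarrow> 'g topology \<Rightarrow> 'a measure \<Rightarrow> ('g \<Rightarrow> 'a \<Rightarrow> 'a) \<Rightarrow> bool" where
  "borel_action G \<tau> M \<phi> \<longleftrightarrow>
     group_action G (space M) \<phi> \<and>
     (\<lambda>(g, x). \<phi> g x) \<in> measurable (borel_of \<tau> \<Otimes>\<^sub>M M) M"

definition orbit_full_set ::
  "('g, 'c) monoid_scheme \<Rightarrow> 'a measure \<Rightarrow> ('g \<Rightarrow> 'a \<Rightarrow> 'a) \<Rightarrow> ('a \<Rightarrow> 'a) set set" where
  "orbit_full_set G M \<phi> =
     {C \<in> carrier (Aut M). \<forall>T\<in>C. AE x in M. T x \<in> orbit G \<phi> x}"

definition orbit_full_group ::
  "('g, 'c) monoid_scheme \<Rightarrow> 'a measure \<Rightarrow> ('g \<Rightarrow> 'a \<Rightarrow> 'a) \<Rightarrow> ('a \<Rightarrow> 'a) set monoid" where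
  "orbit_full_group G M \<phi> = (Aut M)\<lparr>carrier := orbit_full_set G M \<phi>\<rparr>"


section \<open>Convergence in measure\<close>

text \<open>Lebesgue-measurable maps modulo almost everywhere equality, for the completed measure.\<close>

definition L0_class :: "'a measure \<Rightarrow> 'g topology \<Rightarrow> ('a \<Rightarrow> 'g) \<Rightarrow> ('a \<Rightarrow> 'g) set" where
  "L0_class M \<tau> f = {h \<in> measurable (completion M) (borel_of \<tau>). AE x in M. h x = f x}"

definition L0 :: "'a measure \<Rightarrow> 'g topology \<Rightarrow> ('a \<Rightarrow> 'g) set set" where
  "L0 M \<tau> = L0_class M \<tau> ` measurable (completion M) (borel_of \<tau>)"

definition equivalent_prob :: "'a measure \<Rightarrow> 'a measure \<Rightarrow> bool" where
  "equivalent_prob M \<mu> \<longleftrightarrow>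
     prob_space \<mu> \<and> sets \<mu> = sets M \<and> null_sets \<mu> = null_sets M"

definition compatible_bounded_metric :: "'g topology \<Rightarrow> ('g \<Rightarrow> 'g \<Rightarrow> real) \<Rightarrow> bool" where
  "compatible_bounded_metric \<tau> d \<longleftrightarrow>
     Metric_space (topspace \<tau>) d \<and> Metric_space.mtopology (topspace \<tau>) d = \<tau> \<and>
     Metric_space.mbounded (topspace \<tau>) d (topspace \<tau>)"

text \<open>The value does not depend on the chosen representatives. The integrand is only
  Lebesgue measurable, hence the completion of \<open>\<mu>\<close>.\<close>

definition L0_dist ::
  "'a measure \<Rightarrow> ('g \<Rightarrow> 'g \<Rightarrow> real) \<Rightarrow> ('a \<Rightarrow> 'g) set \<Rightarrow> ('a \<Rightarrow> 'g) set \<Rightarrow> real" where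
  "L0_dist \<mu> d F H =
     (LINT x|completion \<mu>. d ((SOME f. f \<in> F) x) ((SOME h. h \<in> H) x))"

definition L0_topology ::
  "'a measure \<Rightarrow> 'g topology \<Rightarrow> 'a measure \<Rightarrow> ('g \<Rightarrow> 'g \<Rightarrow> real) \<Rightarrow> ('a \<Rightarrow> 'g) set topology" where
  "L0_topology M \<tau> \<mu> d = Metric_space.mtopology (L0 M \<tau>) (L0_dist \<mu> d)"


section \<open>Orbital convergence in measure\<close>

text \<open>\<open>orbital_map M \<phi>\<close> is the map \<open>\<Phi>\<close>. All members of a class \<open>F\<close> give the same
  automorphism class, so the union is a choice-free way of passing to the quotient; it is empty,
  hence not in \<open>Aut(X, \<lambda>)\<close>, if \<open>x \<mapsto> f(x) \<cdot> x\<close> is not almost everywhere equal to a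
  measure-preserving bijection.\<close>

definition orbital_map ::
  "'a measure \<Rightarrow> ('g \<Rightarrow> 'a \<Rightarrow> 'a) \<Rightarrow> ('a \<Rightarrow> 'g) set \<Rightarrow> ('a \<Rightarrow> 'a) set" where
  "orbital_map M \<phi> F = (\<Union>f\<in>F. aut_class M (\<lambda>x. \<phi> (f x) x))"

definition orbital_lifts ::
  "'a measure \<Rightarrow> 'g topology \<Rightarrow> ('g \<Rightarrow> 'a \<Rightarrow> 'a) \<Rightarrow> ('a \<Rightarrow> 'g) set set" where
  "orbital_lifts M \<tau> \<phi> = {F \<in> L0 M \<tau>. orbital_map M \<phi> F \<in> carrier (Aut M)}"

definition quotient_topology :: "'a topology \<Rightarrow> 'b set \<Rightarrow> ('a \<Rightarrow> 'b) \<Rightarrow> 'b topology" where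
  "quotient_topology X Y f =
     topology (\<lambda>U. U \<subseteq> Y \<and> openin X {x \<in> topspace X. f x \<in> U})"

lemma openin_quotient_topology:
  "openin (quotient_topology X Y f) U \<longleftrightarrow> U \<subseteq> Y \<and> openin X {x \<in> topspace X. f x \<in> U}"
proof -
  have "istopology (\<lambda>U. U \<subseteq> Y \<and> openin X {x \<in> topspace X. f x \<in> U})"
    unfolding istopology_def
  proof (intro conjI allI impI)
    fix S T
    assume S: "S \<subseteq> Y \<and> openin X {x \<in> topspace X. f x \<in> S}"
      and T: "T \<subseteq> Y \<and> openin X {x \<in> topspace X. f x \<in> T}"
    have "{x \<in> topspace X. f x \<in> S \<inter> T} =
        {x \<in> topspace X. f x \<in> S} \<inter> {x \<in> topspace X. f x \<in> T}"
      by blast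
    then show "openin X {x \<in> topspace X. f x \<in> S \<inter> T}"
      using S T by (simp only: openin_Int)
    show "S \<inter> T \<subseteq> Y" using S by auto
  next
    fix \<K>
    assume K: "\<forall>K\<in>\<K>. K \<subseteq> Y \<and> openin X {x \<in> topspace X. f x \<in> K}"
    have "{x \<in> topspace X. f x \<in> \<Union>\<K>} = (\<Union>K\<in>\<K>. {x \<in> topspace X. f x \<in> K})"
      by auto
    moreover have "openin X (\<Union>K\<in>\<K>. {x \<in> topspace X. f x \<in> K})"
      using K by (intro openin_Union) auto
    ultimately show "openin X {x \<in> topspace X. f x \<in> \<Union>\<K>}" by simp
    show "\<Union>\<K> \<subseteq> Y" using K by auto
  qed
  then show ?thesis
    unfolding quotient_topology_def by (simp add: topology_inverse')
qed

lemma quotient_map_quotient_topology: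
  assumes "f ` topspace X = Y"
  shows "quotient_map X (quotient_topology X Y f) f"
proof -
  have "{x \<in> topspace X. f x \<in> Y} = topspace X"
    using assms by blast
  then have "openin (quotient_topology X Y f) Y"
    by (simp add: openin_quotient_topology)
  moreover have "topspace (quotient_topology X Y f) \<subseteq> Y"
    using openin_topspace[of "quotient_topology X Y f"]
    unfolding openin_quotient_topology by blast
  ultimately have "topspace (quotient_topology X Y f) = Y"
    by (simp add: openin_subset subset_antisym)
  then show ?thesis
    unfolding quotient_map_def openin_quotient_topology using assms by simp
qed

definition orbital_topology ::
  "('g, 'c) monoid_scheme \<Rightarrow> 'g topology \<Rightarrow> 'a measure \<Rightarrow> ('g \<Rightarrow> 'a \<Rightarrow> 'a) \<Rightarrow>
   'a measure \<Rightarrow> ('g \<Rightarrow> 'g \<Rightarrow> real) \<Rightarrow> ('a \<Rightarrow> 'a) set topology" where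
  "orbital_topology G \<tau> M \<phi> \<mu> d =
     quotient_topology (subtopology (L0_topology M \<tau> \<mu> d) (orbital_lifts M \<tau> \<phi>))
       (orbit_full_set G M \<phi>) (orbital_map M \<phi>)"

end

theory Submission
  imports Defs "HOL-Analysis.Analysis" "HOL-Probability.Distribution_Functions"
begin

text \<open>
  Write \<open>X\<close> as a disjoint union of sets \<open>Y\<^sub>n\<close> of equal measure and choose elements \<open>J\<^sub>n\<close> of the full
  group mapping \<open>Y\<^sub>0\<close> onto \<open>Y\<^sub>n\<close> (possible by ergodicity). They give injective measure-preserving shifts
  \<open>V\<^sub>t : X \<rightarrow> X\<close> inside the orbits with \<open>V\<^sub>0 = id\<close>: a point of \<open>Y\<^sub>n\<close> over \<open>y \<in> Y\<^sub>0\<close> moves to \<open>Y\<^sub>n\<^sub>+\<^sub>k\<close>,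
  where \<open>k = \<lceil>t / (1 - t) - w(y)\<rceil>\<close> and \<open>w : X \<rightarrow> (0, 1)\<close> has null level sets, so that \<open>V\<^sub>t\<close> depends
  continuously on \<open>t\<close> and the images of \<open>V\<^sub>t\<close> shrink to the empty set for \<open>t \<rightarrow> 1\<close>. The contraction sends
  \<open>T\<close> to \<open>V\<^sub>t T V\<^sub>t\<^sup>-\<^sup>1\<close> on the image of \<open>V\<^sub>t\<close>, extended by the identity.

  Its joint continuity requires that orbital convergence in measure implies weak convergence. Here
  the topological group structure enters: stabilizers of a Borel action of a Polish group are closed
  (Miller), so supports are lower semicontinuous, and applying this to the conjugates
  \<open>T\<^sup>-\<^sup>1 J T\<close>, whose supports are the sets \<open>T\<^sup>-\<^sup>1(supp J)\<close>, gives weak continuity.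
\<close>

section \<open>Metrizable and Polish topologies\<close>

text \<open>Infinite measure leaves room for injections \<open>V t\<close> that are not onto;
  conjugation by them squeezes an automorphism into an ever smaller part of the space. The homotopy
  is built on lifts rather than on classes: lifts carry a metric, so continuity can be tested along
  almost everywhere convergent subsequences, and since the unit interval is locally compact
  Hausdorff, its product with the quotient map \<Phi> is again a quotient map, so continuity
  descends.

  The obstacle sits in the lift of the conjugate. With z the preimage of x under the shift, it
  multiplies the lift of T at z by a group element that depends on T z. This dependence is only
  Borel, so convergence of the lifts does not control it. Weak convergence does: almost everywhere
  along a subsequence it forces the values of the approximating maps at z into each of countably
  many prescribed Borel sets that contain the value of the limit map.

  The function t / (1 - t) starts at 0 and is unbounded at the end. Subtracting w spreads the
  integer jumps of the shift over the space, so that for each single t only a null set of points is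
  at a jump.\<close>

lemma openin_by_sequences:
  assumes X: "metrizable_space X" and U: "U \<subseteq> topspace X"
    and seq: "\<And>\<sigma> l. (\<And>n. \<sigma> n \<in> topspace X) \<Longrightarrow> limitin X \<sigma> l sequentially \<Longrightarrow> l \<in> U \<Longrightarrow>
      \<exists>n::nat. \<sigma> n \<in> U"
  shows "openin X U"
proof -
  obtain S m where m: "Metric_space S m" and X: "X = Metric_space.mtopology S m"
    using X unfolding metrizable_space_def by blast
  interpret Metric_space S m by fact
  have "\<exists>r>0. mball l r \<subseteq> U" if l: "l \<in> U" for l
  proof (rule ccontr)
    assume "\<not> ?thesis"
    then have "\<exists>y. y \<in> mball l (inverse (real (Suc n))) \<and> y \<notin> U" for n
      by (meson inverse_positive_iff_positive of_nat_0_less_iff subsetI zero_less_Suc)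
    then obtain \<sigma> where \<sigma>: "\<And>n. \<sigma> n \<in> mball l (inverse (real (Suc n)))" "\<And>n. \<sigma> n \<notin> U"
      by metis
    have "(\<lambda>n. m (\<sigma> n) l) \<longlonglongrightarrow> 0"
    proof (rule real_tendsto_sandwich[OF _ _ tendsto_const LIMSEQ_inverse_real_of_nat])
      show "\<forall>\<^sub>F n in sequentially. m (\<sigma> n) l \<le> inverse (real (Suc n))"
        using \<sigma>(1) by (metis (no_types, lifting) commute eventually_sequentiallyI in_mball less_eq_real_def)
    qed auto
    then have "limitin X \<sigma> l sequentially"
      unfolding X limitin_metric_dist_null using \<sigma>(1) by (auto simp: in_mball)
    moreover have "\<sigma> n \<in> topspace X" for n
      unfolding X using \<sigma>(1)[of n] by (simp add: in_mball)
    ultimately show False using seq[of \<sigma> l] l \<sigma>(2) by metis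
  qed
  then show ?thesis
    using U by (auto simp: X openin_mtopology)
qed

text \<open>A single index with \<open>f (\<sigma> (r n))\<close> in a given neighbourhood settles
  each test of openness, so \<open>r\<close> may be any index map. The criterion fits convergence in
  measure, which yields pointwise limits only after passing to a subsequence.\<close>

lemma continuous_map_by_subsequences:
  assumes X: "metrizable_space X" and f: "f \<in> topspace X \<rightarrow> topspace Y"
    and seq: "\<And>\<sigma> l. (\<And>n. \<sigma> n \<in> topspace X) \<Longrightarrow> limitin X \<sigma> l sequentially \<Longrightarrow>
      \<exists>r::nat \<Rightarrow> nat. limitin Y (\<lambda>n. f (\<sigma> (r n))) (f l) sequentially"
  shows "continuous_map X Y f"
  unfolding continuous_map_def
proof (intro conjI allI impI)
  fix U assume U: "openin Y U"
  show "openin X {x \<in> topspace X. f x \<in> U}"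
  proof (rule openin_by_sequences[OF X])
    fix \<sigma> l assume \<sigma>: "\<And>n. \<sigma> n \<in> topspace X" "limitin X \<sigma> l sequentially"
      and l: "l \<in> {x \<in> topspace X. f x \<in> U}"
    from seq[OF \<sigma>] obtain r :: "nat \<Rightarrow> nat" where
      "limitin Y (\<lambda>n. f (\<sigma> (r n))) (f l) sequentially" by auto
    from limitinD[OF this U] l have "\<forall>\<^sub>F n in sequentially. f (\<sigma> (r n)) \<in> U" by simp
    then obtain n where "f (\<sigma> (r n)) \<in> U"
      by (auto simp: eventually_sequentially)
    then show "\<exists>n. \<sigma> n \<in> {x \<in> topspace X. f x \<in> U}"
      using \<sigma>(1) by auto
  qed auto
qed (fact f)

lemma polish_imp_second_countable:
  assumes "polish_topology T"
  shows "second_countable T"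
proof -
  obtain S m where m: "Metric_space S m" and T: "T = Metric_space.mtopology S m"
    using assms completely_metrizable_imp_metrizable_space
    unfolding polish_topology_def metrizable_space_def by blast
  interpret Metric_space S m by fact
  obtain C where C: "countable C" "C \<subseteq> S" "mtopology closure_of C = S"
    using assms unfolding polish_topology_def separable_space_def T by auto
  show ?thesis
    unfolding second_countable_def T
  proof (intro exI conjI allI impI ballI)
    show "countable ((\<lambda>(c, n). mball c (inverse (real (Suc n)))) ` (C \<times> UNIV))"
      using C(1) by auto
    show "openin mtopology V" if "V \<in> (\<lambda>(c, n). mball c (inverse (real (Suc n)))) ` (C \<times> UNIV)" for V
      using that by auto
    fix U x assume Ux: "openin mtopology U \<and> x \<in> U"
    then obtain r where r: "r > 0" "mball x r \<subseteq> U" and x: "x \<in> S"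
      by (meson openin_mtopology subsetD)
    \<comment> \<open>Half the radius: the ball of radius 1/(n+1) around a dense point that is
      1/(n+1)-close to \<open>x\<close> then stays in the ball of radius \<open>r\<close> around
      \<open>x\<close>.\<close>
    obtain n where n: "inverse (real (Suc n)) < r / 2"
      using r(1) reals_Archimedean half_gt_zero by blast
    obtain c where c: "c \<in> C" "c \<in> mball x (inverse (real (Suc n)))"
      using x C(3) unfolding metric_closure_of
      by (smt (verit, best) mem_Collect_eq inverse_positive_iff_positive of_nat_0_less_iff zero_less_Suc)
    have cx: "x \<in> mball c (inverse (real (Suc n)))"
      using c C(2) x by (auto simp: in_mball commute)
    have "mball c (inverse (real (Suc n))) \<subseteq> mball x r"
    proof
      fix y assume "y \<in> mball c (inverse (real (Suc n)))"
      then show "y \<in> mball x r"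
        using c(2) n triangle[of x c y] by (auto simp: in_mball)
    qed
    then show "\<exists>V\<in>(\<lambda>(c, n). mball c (inverse (real (Suc n)))) ` (C \<times> UNIV). x \<in> V \<and> V \<subseteq> U"
      using c(1) cx r(2) by (intro bexI[of _ "mball c (inverse (real (Suc n)))"]) auto
  qed
qed

definition base_sequence :: "'a topology \<Rightarrow> (nat \<Rightarrow> 'a set) \<Rightarrow> bool" where
  "base_sequence T B \<longleftrightarrow>
     (\<forall>i. openin T (B i)) \<and> (\<forall>U x. openin T U \<longrightarrow> x \<in> U \<longrightarrow> (\<exists>i. x \<in> B i \<and> B i \<subseteq> U))"

lemma base_sequenceD:
  assumes "base_sequence T B"
  shows "openin T (B i)" "openin T U \<Longrightarrow> x \<in> U \<Longrightarrow> \<exists>i. x \<in> B i \<and> B i \<subseteq> U"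
  using assms unfolding base_sequence_def by simp_all

lemma second_countable_base_sequence:
  assumes "second_countable T"
  obtains B where "base_sequence T B"
proof -
  from assms obtain \<B> where "countable \<B> \<and> (\<forall>V \<in> \<B>. openin T V) \<and>
      (\<forall>U x. openin T U \<and> x \<in> U \<longrightarrow> (\<exists>V \<in> \<B>. x \<in> V \<and> V \<subseteq> U))"
    unfolding second_countable_def by (elim exE)
  then have \<B>: "countable \<B>" "\<And>V. V \<in> \<B> \<Longrightarrow> openin T V"
    "\<And>U x. openin T U \<Longrightarrow> x \<in> U \<Longrightarrow> \<exists>V \<in> \<B>. x \<in> V \<and> V \<subseteq> U"
    by simp_all
  \<comment> \<open>The empty set is inserted because an enumeration by the natural numbers needs a
    nonempty family; being open, it does no harm.\<close>
  define B where "B = from_nat_into (insert {} \<B>)"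
  have r: "range B = insert {} \<B>"
    unfolding B_def using \<B>(1) by (intro range_from_nat_into) auto
  have "base_sequence T B"
    unfolding base_sequence_def
  proof (intro conjI allI impI)
    show "openin T (B i)" for i
      using r \<B>(2) by (metis insertE openin_empty rangeI)
    fix U x assume U: "openin T U" "x \<in> U"
    obtain V where V: "V \<in> \<B>" "x \<in> V" "V \<subseteq> U" using \<B>(3)[OF U] by blast
    then obtain i where "V = B i" using r by (metis imageE insertI2)
    then show "\<exists>i. x \<in> B i \<and> B i \<subseteq> U" using V by blast
  qed
  then show ?thesis by (rule that)
qed

lemma space_borel_of [simp]: "space (borel_of T) = topspace T"
  unfolding borel_of_def by (rule space_measure_of) (auto dest: openin_subset)

lemma sets_borel_of: "sets (borel_of T) = sigma_sets (topspace T) {U. openin T U}"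
  unfolding borel_of_def by (rule sets_measure_of) (auto dest: openin_subset)

lemma borel_of_open: "openin T U \<Longrightarrow> U \<in> sets (borel_of T)"
  by (auto simp: sets_borel_of)

lemma borel_of_euclidean: "borel_of euclidean = borel"
  by (simp add: borel_of_def borel_def)

lemma measurable_borel_ofI:
  assumes "f \<in> space N \<rightarrow> topspace T"
    and "\<And>U. openin T U \<Longrightarrow> f -` U \<inter> space N \<in> sets N"
  shows "f \<in> measurable N (borel_of T)"
  unfolding borel_of_def
  by (rule measurable_measure_of[OF _ assms(1)]) (auto intro: assms(2) dest: openin_subset)

lemma measurable_borel_of_base:
  assumes B: "base_sequence T B"
    and f: "f \<in> space N \<rightarrow> topspace T" "\<And>i. f -` B i \<inter> space N \<in> sets N"
  shows "f \<in> measurable N (borel_of T)"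
proof (rule measurable_borel_ofI[OF f(1)])
  fix U assume U: "openin T U"
  have eq: "f -` U \<inter> space N = (\<Union>i\<in>{i. B i \<subseteq> U}. f -` B i \<inter> space N)"
    using base_sequenceD(2)[OF B U] by blast
  show "f -` U \<inter> space N \<in> sets N"
    unfolding eq by (intro sets.countable_UN'' f(2)) auto
qed

text \<open>The preimage of an open set under \<open>m\<close> is a countable union of rectangles of
  basic open sets, so no comparison of the Borel sets of the product space with the product
  sigma-algebra has to be made.\<close>

lemma measurable_continuous_pair:
  assumes T: "second_countable T" "second_countable T'"
    and m: "continuous_map (prod_topology T T') S (\<lambda>(x, y). m x y)"
    and f: "f \<in> measurable N (borel_of T)" and g: "g \<in> measurable N (borel_of T')"
  shows "(\<lambda>x. m (f x) (g x)) \<in> measurable N (borel_of S)"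
proof (rule measurable_borel_ofI)
  have fg: "f x \<in> topspace T" "g x \<in> topspace T'" if "x \<in> space N" for x
    using measurable_space[OF f that] measurable_space[OF g that] by auto
  show "(\<lambda>x. m (f x) (g x)) \<in> space N \<rightarrow> topspace S"
  proof
    fix x assume "x \<in> space N"
    then have "(f x, g x) \<in> topspace (prod_topology T T')" using fg by simp
    then show "m (f x) (g x) \<in> topspace S"
      using funcset_mem[OF continuous_map_funspace[OF m]] by fastforce
  qed
  fix U assume U: "openin S U"
  obtain B B' where B0: "base_sequence T B" and B0': "base_sequence T' B'"
    using T second_countable_base_sequence by metis
  note B = base_sequenceD[OF B0] and B' = base_sequenceD[OF B0']
  define W where "W = {p \<in> topspace (prod_topology T T'). (\<lambda>(x, y). m x y) p \<in> U}"
  have W: "openin (prod_topology T T') W"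
    unfolding W_def by (rule openin_continuous_map_preimage[OF m U])
  have "(\<lambda>x. m (f x) (g x)) -` U \<inter> space N =
      (\<Union>(i, j)\<in>{(i, j). B i \<times> B' j \<subseteq> W}. (f -` B i \<inter> space N) \<inter> (g -` B' j \<inter> space N))"
    (is "?L = ?R")
  proof
    show "?R \<subseteq> ?L" by (auto simp: W_def)
    show "?L \<subseteq> ?R"
    proof
      fix x assume x: "x \<in> ?L"
      then have "(f x, g x) \<in> W" using fg by (auto simp: W_def)
      then obtain V V' where V: "openin T V" "openin T' V'" "f x \<in> V" "g x \<in> V'" "V \<times> V' \<subseteq> W"
        using W unfolding openin_prod_topology_alt by meson
      obtain i j where "f x \<in> B i" "B i \<subseteq> V" "g x \<in> B' j" "B' j \<subseteq> V'"
        using B(2)[OF V(1,3)] B'(2)[OF V(2,4)] by blast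
      then have "(i, j) \<in> {(i, j). B i \<times> B' j \<subseteq> W}" "x \<in> (f -` B i \<inter> space N) \<inter> (g -` B' j \<inter> space N)"
        using V(5) x by auto
      then show "x \<in> ?R" by blast
    qed
  qed
  moreover have "?R \<in> sets N"
    using B(1) B'(1) by (intro sets.countable_UN'')
      (auto intro!: sets.Int measurable_sets[OF f] measurable_sets[OF g] borel_of_open)
  ultimately show "(\<lambda>x. m (f x) (g x)) -` U \<inter> space N \<in> sets N" by simp
qed

section \<open>Baire category and closed stabilizers\<close>

definition thin_cover :: "'a topology \<Rightarrow> 'a set \<Rightarrow> (nat \<Rightarrow> 'a set) \<Rightarrow> bool" where
  "thin_cover T A C \<longleftrightarrow>
     (\<forall>i. closedin T (C i) \<and> T interior_of C i = {}) \<and> A \<subseteq> (\<Union>i. C i)"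

text \<open>Covering by closed sets with empty interior is the form that the Baire category theorem
  consumes, and it makes heredity to subsets immediate.\<close>

definition meager_in :: "'a topology \<Rightarrow> 'a set \<Rightarrow> bool" where
  "meager_in T A \<longleftrightarrow> (\<exists>C. thin_cover T A C)"

lemma meager_in_subset:
  assumes "meager_in T B" "A \<subseteq> B"
  shows "meager_in T A"
proof -
  obtain C where "thin_cover T B C" using assms(1) unfolding meager_in_def by blast
  then have "thin_cover T A C"
    using assms(2) unfolding thin_cover_def by (simp add: subset_trans)
  then show ?thesis unfolding meager_in_def by blast
qed

lemma meager_in_UN:
  fixes A :: "nat \<Rightarrow> 'a set"
  assumes "\<And>i. meager_in T (A i)"
  shows "meager_in T (\<Union>i. A i)"
proof -
  have "\<forall>i. \<exists>C. thin_cover T (A i) C" using assms unfolding meager_in_def by simp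
  then obtain C where C: "\<And>i. thin_cover T (A i) (C i)"
    by metis
  have "A i \<subseteq> (\<Union>n. case prod_decode n of (i, j) \<Rightarrow> C i j)" for i
  proof
    fix x assume "x \<in> A i"
    then obtain j where "x \<in> C i j" using C[of i] unfolding thin_cover_def by auto
    then show "x \<in> (\<Union>n. case prod_decode n of (i, j) \<Rightarrow> C i j)"
      by (intro UN_I[of "prod_encode (i, j)"]) simp_all
  qed
  then have "thin_cover T (\<Union>i. A i) (\<lambda>n. case prod_decode n of (i, j) \<Rightarrow> C i j)"
    using C unfolding thin_cover_def by (simp add: UN_subset_iff split: prod.split)
  then show ?thesis unfolding meager_in_def by blast
qed

lemma meager_in_Un:
  assumes "meager_in T A" "meager_in T B"
  shows "meager_in T (A \<union> B)"
proof -
  have "meager_in T (\<Union>i::nat. if i = 0 then A else B)"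
    using assms by (intro meager_in_UN) simp
  moreover have "A \<union> B \<subseteq> (\<Union>i::nat. if i = 0 then A else B)"
    by auto
  ultimately show ?thesis by (rule meager_in_subset)
qed

lemma meager_in_closed:
  assumes "closedin T C" "T interior_of C = {}"
  shows "meager_in T C"
proof -
  have "thin_cover T C (\<lambda>_. C)" using assms unfolding thin_cover_def by simp
  then show ?thesis unfolding meager_in_def by blast
qed

text \<open>An open subset of the frontier misses the open set \<open>U\<close>, hence also the
  closure of \<open>U\<close>, in which the frontier lies.\<close>

lemma meager_in_frontier_of_open: 
  assumes "openin T U" shows "meager_in T (T closure_of U - U)"
proof -
  have eq: "T frontier_of U = T closure_of U - U"
    using assms by (simp add: frontier_of_def interior_of_openin)
  have "T interior_of (T frontier_of U) = {}"
  proof -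
    have "T interior_of (T frontier_of U) \<inter> U = {}"
      using interior_of_subset[of T "T frontier_of U"] eq by blast
    then have "T interior_of (T frontier_of U) \<inter> T closure_of U = {}"
      by (simp add: openin_Int_closure_of_eq_empty)
    then show ?thesis
      using interior_of_subset[of T "T frontier_of U"] eq by blast
  qed
  then show ?thesis
    unfolding eq[symmetric] by (intro meager_in_closed closedin_frontier_of)
qed

lemma meager_in_homeomorphic_image:
  assumes h: "homeomorphic_map T T h" and A: "meager_in T A"
  shows "meager_in T (h ` A)"
proof -
  obtain C where C: "thin_cover T A C"
    using A unfolding meager_in_def by blast
  have "closedin T (h ` C i) \<and> T interior_of (h ` C i) = {}" for i
  proof -
    have Ci: "closedin T (C i)" "T interior_of (C i) = {}"
      using C unfolding thin_cover_def by simp_all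
    have "C i \<subseteq> topspace T" using Ci(1) by (rule closedin_subset)
    then show ?thesis
      using Ci homeomorphic_map_closedness[OF h, of "C i"] homeomorphic_map_interior_of[OF h, of "C i"]
      by simp
  qed
  moreover have "h ` A \<subseteq> (\<Union>i. h ` C i)"
    using C unfolding thin_cover_def by (metis image_UN image_mono)
  ultimately have "thin_cover T (h ` A) (\<lambda>i. h ` C i)"
    unfolding thin_cover_def by simp
  then show ?thesis unfolding meager_in_def by blast
qed

lemma open_not_meager:
  assumes "completely_metrizable_space T" "openin T U" "U \<noteq> {}"
  shows "\<not> meager_in T U"
proof
  assume "meager_in T U"
  then obtain C where C: "thin_cover T U C" unfolding meager_in_def by blast
  have "T interior_of \<Union>(range C) = {}"
    using C assms(1) by (intro Baire_category_alt) (auto simp: thin_cover_def)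
  moreover have "U \<subseteq> T interior_of \<Union>(range C)"
    using C assms(2) unfolding thin_cover_def by (intro interior_of_maximal) simp_all
  ultimately show False using assms(3) by simp
qed

text \<open>Sets that agree with an open set modulo a meager set form a sigma-algebra. Only
  complements need care: the complement of \<open>U\<close> is merely closed and is replaced by the
  complement of the closure, at the price of the meager frontier.\<close>

lemma borel_of_Baire_property:
  assumes "E \<in> sets (borel_of T)"
  shows "\<exists>U. openin T U \<and> meager_in T (sym_diff E U)"
  using assms unfolding sets_borel_of
proof (induction rule: sigma_sets.induct)
  case (Basic a)
  have "meager_in T {}" by (rule meager_in_closed) auto
  with Basic show ?case by (intro exI[of _ a]) auto
next
  case Empty
  have "meager_in T {}" by (rule meager_in_closed) auto
  then show ?case by (intro exI[of _ "{}"]) auto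
next
  case (Compl a)
  then obtain U where U: "openin T U" "meager_in T (sym_diff a U)" by blast
  have a: "a \<subseteq> topspace T"
    using Compl(1) sigma_sets_into_sp[of "{U. openin T U}" "topspace T"] openin_subset by blast
  let ?V = "topspace T - T closure_of U"
  have "sym_diff (topspace T - a) ?V \<subseteq> sym_diff a U \<union> (T closure_of U - U)"
    using a openin_subset[OF U(1)] closure_of_subset[of U T] by blast
  then have "meager_in T (sym_diff (topspace T - a) ?V)"
    by (rule meager_in_subset[OF meager_in_Un[OF U(2) meager_in_frontier_of_open[OF U(1)]]])
  moreover have "openin T ?V" by (simp add: openin_diff)
  ultimately show ?case by (intro exI[of _ ?V] conjI)
next
  case (Union a)
  then have "\<forall>i. \<exists>U. openin T U \<and> meager_in T (sym_diff (a i) U)" by simp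
  then obtain U where U: "\<And>i. openin T (U i)" "\<And>i. meager_in T (sym_diff (a i) (U i))"
    by metis
  have "sym_diff (\<Union>i. a i) (\<Union>i. U i) \<subseteq> (\<Union>i. sym_diff (a i) (U i))"
    by auto
  then have "meager_in T (sym_diff (\<Union>i. a i) (\<Union>i. U i))"
    by (rule meager_in_subset[OF meager_in_UN[OF U(2)]])
  moreover have "openin T (\<Union>i. U i)" using U(1) by auto
  ultimately show ?case by (intro exI[of _ "\<Union>i. U i"] conjI)
qed

text \<open>The form in which the standard Borel structure enters: in the closedness of stabilizers,
  in the measurability of fixed point sets, and in the injective real coordinate.\<close>

definition separating_sets :: "'a measure \<Rightarrow> (nat \<Rightarrow> 'a set) \<Rightarrow> bool" where
  "separating_sets M A \<longleftrightarrow> (\<forall>i. A i \<in> sets M) \<and>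
     (\<forall>x\<in>space M. \<forall>y\<in>space M. x \<noteq> y \<longrightarrow> (\<exists>i. x \<in> A i \<and> y \<notin> A i))"

lemma standard_borel_separating_sets:
  assumes "standard_borel M"
  obtains A where "separating_sets M A"
proof -
  obtain T where T: "polish_topology T" "space M = topspace T" "sets M = sets (borel_of T)"
    using assms unfolding standard_borel_def by blast
  obtain B where "base_sequence T B"
    using polish_imp_second_countable[OF T(1)] by (rule second_countable_base_sequence)
  note B = base_sequenceD[OF this]
  have "Hausdorff_space T"
    using T(1) unfolding polish_topology_def
    by (simp add: completely_metrizable_imp_metrizable_space metrizable_imp_Hausdorff_space)
  have sep: "\<exists>i. x \<in> B i \<and> y \<notin> B i" if xy: "x \<in> topspace T" "y \<in> topspace T" "x \<noteq> y" for x y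
  proof -
    obtain U V where U: "openin T U" "x \<in> U" "y \<in> V" "disjnt U V"
      using \<open>Hausdorff_space T\<close> xy unfolding Hausdorff_space_def by metis
    obtain i where "x \<in> B i" "B i \<subseteq> U" using B(2)[OF U(1,2)] by auto
    then show ?thesis using U(3,4) unfolding disjnt_iff by auto
  qed
  have "separating_sets M B"
    unfolding separating_sets_def T(2,3) using sep B(1) by (auto intro: borel_of_open)
  then show ?thesis by (rule that)
qed

lemma topological_group_right_translation:
  assumes T: "topological_group_on G T" and g: "g \<in> carrier G"
  shows "homeomorphic_map T T (\<lambda>h. h \<otimes>\<^bsub>G\<^esub> g)"
proof -
  interpret group G using T unfolding topological_group_on_def by simp
  have top: "topspace T = carrier G"
    and mult: "continuous_map (prod_topology T T) T (\<lambda>(g, h). g \<otimes>\<^bsub>G\<^esub> h)"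
    using T unfolding topological_group_on_def by auto
  have cont: "continuous_map T T (\<lambda>h. h \<otimes>\<^bsub>G\<^esub> s)" if "s \<in> carrier G" for s
    using continuous_map_compose[OF _ mult, of T "\<lambda>h. (h, s)"] that
    by (simp add: o_def continuous_map_paired top)
  have "homeomorphic_maps T T (\<lambda>h. h \<otimes>\<^bsub>G\<^esub> g) (\<lambda>h. h \<otimes>\<^bsub>G\<^esub> inv\<^bsub>G\<^esub> g)"
    unfolding homeomorphic_maps_def using cont g by (auto simp: top m_assoc)
  then show ?thesis
    using homeomorphic_map_maps by blast
qed

text \<open>Miller's theorem. If \<open>g\<close> is a limit of the stabilizer \<open>H\<close> of \<open>x\<close> but \<open>g x \<noteq> x\<close>, then a
  separating set \<open>A\<close> gives a right \<open>H\<close>-invariant Borel set \<open>E = {h. h x \<in> A}\<close> that is comeager in some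
  nonempty open set \<open>O\<close> and meager in \<open>O g\<close>. By \<open>H\<close>-invariance \<open>E\<close> is comeager in \<open>O s\<close> for \<open>s \<in> H\<close>,
  and \<open>O s\<close> meets \<open>O g\<close> for \<open>s\<close> close to \<open>g\<close>, against the Baire category theorem.\<close>

lemma closedin_stabilizer:
  fixes G (structure)
  assumes G: "polish_group G T" and act: "group_action G (space M) \<phi>"
    and meas: "\<And>A x. A \<in> sets M \<Longrightarrow> x \<in> space M \<Longrightarrow> {h \<in> carrier G. \<phi> h x \<in> A} \<in> sets (borel_of T)"
    and sep: "separating_sets M A" and x: "x \<in> space M"
  shows "closedin T {g \<in> carrier G. \<phi> g x = x}"
proof -
  have tg: "topological_group_on G T" and cm: "completely_metrizable_space T"
    using G unfolding polish_group_def polish_topology_def by auto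
  interpret group_action G "space M" \<phi> by fact
  interpret group G using tg unfolding topological_group_on_def by simp
  have top: "topspace T = carrier G"
    and mult: "continuous_map (prod_topology T T) T (\<lambda>(g, h). g \<otimes> h)"
    and inver: "continuous_map T T (\<lambda>g. inv g)"
    using tg unfolding topological_group_on_def by auto
  define H where "H = {g \<in> carrier G. \<phi> g x = x}"
  have "g \<in> H" if g: "g \<in> T closure_of H" for g
  proof (rule ccontr)
    assume "g \<notin> H"
    have gc: "g \<in> carrier G" using g top by (metis closure_of_subset_topspace subsetD)
    define E where "E i = {h \<in> carrier G. \<phi> h x \<in> A i}" for i
    \<comment> \<open>\<open>D i\<close> collects the \<open>h\<close> for which \<open>A i\<close>
      separates h x from h g x. These two points differ for every \<open>h\<close>, so the countably
      many \<open>D i\<close> cover the group and one of them is not meager.\<close>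
    define D where "D i = {h \<in> carrier G. h \<in> E i \<and> h \<otimes> g \<notin> E i}" for i
    have gx: "\<phi> g x \<in> space M" using gc x element_image by blast
    have "\<phi> h x \<noteq> \<phi> h (\<phi> g x)" if "h \<in> carrier G" for h
      using inj_onD[OF inj_prop[OF that] _ x gx] \<open>g \<notin> H\<close> gc unfolding H_def by auto
    then have "\<exists>i. \<phi> h x \<in> A i \<and> \<phi> h (\<phi> g x) \<notin> A i" if "h \<in> carrier G" for h
      using that sep element_image[OF that x] element_image[OF that gx]
      unfolding separating_sets_def by simp
    then have "\<exists>i. h \<in> D i" if "h \<in> carrier G" for h
      using that composition_rule[OF x that gc] gc unfolding D_def E_def by simp
    then have "carrier G \<subseteq> (\<Union>i. D i)" by blast
    moreover have "\<not> meager_in T (carrier G)"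
      using open_not_meager[OF cm openin_topspace] unfolding top using one_closed by auto
    ultimately obtain i where i: "\<not> meager_in T (D i)"
      using meager_in_UN[of T D] meager_in_subset[of T "\<Union>i. D i" "carrier G"] by auto
    have "E i \<in> sets (borel_of T)"
      using meas sep x unfolding E_def separating_sets_def by blast
    then obtain U where U: "openin T U" "meager_in T (sym_diff (E i) U)"
      using borel_of_Baire_property by blast
    have Uc: "U \<subseteq> carrier G" and Ec: "E i \<subseteq> carrier G"
      using openin_subset[OF U(1)] top by (auto simp: E_def)
    define U' where "U' = (\<lambda>h. h \<otimes> inv g) ` U"
    have U': "openin T U'"
      unfolding U'_def
      using homeomorphic_map_openness[OF topological_group_right_translation[OF tg inv_closed[OF gc]], of U] U(1) Uc top
      by simp
    have U'_iff: "h \<in> U' \<longleftrightarrow> h \<otimes> g \<in> U" if "h \<in> carrier G" for h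
    proof
      assume "h \<in> U'"
      then obtain u where "u \<in> U" "h = u \<otimes> inv g" unfolding U'_def by blast
      then show "h \<otimes> g \<in> U"
        using Uc gc by (simp add: m_assoc subset_iff)
    next
      assume "h \<otimes> g \<in> U"
      moreover have "h = (h \<otimes> g) \<otimes> inv g" using that gc by (simp add: m_assoc)
      ultimately show "h \<in> U'" unfolding U'_def by blast
    qed
    \<comment> \<open>The open set O of the sketch. It lies in \<open>U\<close>, where
      \<open>E i\<close> is comeager, while its right translate by \<open>g\<close> misses
      \<open>U\<close>, so \<open>E i\<close> is meager there. Removing the closure of
      \<open>U'\<close> keeps \<open>V\<close> open and costs only the meager frontier.\<close>
    define V where "V = U - T closure_of U'"
    have V: "openin T V" unfolding V_def using U(1) by (simp add: openin_diff)
    have Di: "D i \<subseteq> V \<union> (sym_diff (E i) U \<union> (\<lambda>h. h \<otimes> inv g) ` sym_diff (E i) U \<union> (T closure_of U' - U'))"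
    proof
      fix h assume h: "h \<in> D i"
      then have hc: "h \<in> carrier G" "h \<in> E i" "h \<otimes> g \<notin> E i" by (auto simp: D_def)
      have "(h \<otimes> g) \<otimes> inv g = h" using hc gc by (simp add: m_assoc)
      moreover have "h \<otimes> g \<in> sym_diff (E i) U" if "h \<in> U'"
        using U'_iff[OF hc(1)] that hc by simp
      ultimately have "h \<in> (\<lambda>h. h \<otimes> inv g) ` sym_diff (E i) U" if "h \<in> U'"
        using that by (metis imageI)
      then show "h \<in> V \<union> (sym_diff (E i) U \<union> (\<lambda>h. h \<otimes> inv g) ` sym_diff (E i) U \<union> (T closure_of U' - U'))"
        using hc unfolding V_def by blast
    qed
    have mg: "meager_in T (sym_diff (E i) U \<union> (\<lambda>h. h \<otimes> inv g) ` sym_diff (E i) U \<union> (T closure_of U' - U'))"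
      by (rule meager_in_Un[OF meager_in_Un[OF U(2) meager_in_homeomorphic_image[OF
              topological_group_right_translation[OF tg inv_closed[OF gc]] U(2)]]
            meager_in_frontier_of_open[OF U']])
    have "V \<noteq> {}"
    proof
      assume "V = {}"
      have "meager_in T (D i)"
        by (rule meager_in_subset[OF mg Di[unfolded \<open>V = {}\<close> Un_empty_left]])
      with i show False ..
    qed
    then obtain v where v: "v \<in> V" by blast
    have vc: "v \<in> carrier G" using v Uc unfolding V_def by blast
    \<comment> \<open>An open condition on \<open>s\<close> that holds at \<open>g\<close>. For
      \<open>s\<close> in both \<open>W\<close> and \<open>H\<close>, the element v g lies in the
      translates of \<open>V\<close> by \<open>s\<close> and by \<open>g\<close> at once.\<close>
    define W where "W = {s \<in> carrier G. v \<otimes> g \<otimes> inv s \<in> V}"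
    have "continuous_map T T (\<lambda>s. v \<otimes> g \<otimes> inv s)"
      using continuous_map_compose[OF _ mult, of T "\<lambda>s. (v \<otimes> g, inv s)"] vc gc inver
      by (simp add: o_def continuous_map_paired top)
    then have "openin T W"
      unfolding W_def using V unfolding continuous_map_def top by blast
    moreover have "g \<in> W" using v vc gc by (auto simp: W_def m_assoc)
    ultimately obtain s where s: "s \<in> H" "s \<in> W"
      using g unfolding in_closure_of by blast
    have sc: "s \<in> carrier G" using s(1) unfolding H_def by blast
    define P where "P = (\<lambda>h. h \<otimes> s) ` V \<inter> (\<lambda>h. h \<otimes> g) ` V"
    have Vc: "V \<subseteq> carrier G" using Uc unfolding V_def by blast
    have "openin T P"
      unfolding P_def
      using homeomorphic_map_openness[OF topological_group_right_translation[OF tg sc], of V]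
        homeomorphic_map_openness[OF topological_group_right_translation[OF tg gc], of V] V Vc top
      by (simp add: openin_Int)
    moreover have "v \<otimes> g \<in> P"
    proof -
      have "v \<otimes> g = (v \<otimes> g \<otimes> inv s) \<otimes> s" using vc gc sc by (simp add: m_assoc)
      then show ?thesis using s(2) v unfolding P_def W_def by blast
    qed
    moreover have "meager_in T P"
    proof (rule meager_in_subset)
      show "meager_in T (sym_diff (E i) U \<union> (\<lambda>h. h \<otimes> s) ` sym_diff (E i) U)"
        by (rule meager_in_Un[OF U(2) meager_in_homeomorphic_image[OF
              topological_group_right_translation[OF tg sc] U(2)]])
      show "P \<subseteq> sym_diff (E i) U \<union> (\<lambda>h. h \<otimes> s) ` sym_diff (E i) U"
      proof
        fix p assume "p \<in> P"
        then obtain a b where a: "a \<in> V" "p = a \<otimes> s" and b: "b \<in> V" "p = b \<otimes> g"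
          unfolding P_def by blast
        have "b \<notin> U'" using b(1) closure_of_subset[OF openin_subset[OF U']] unfolding V_def by auto
        then have pU: "p \<notin> U" using b Vc U'_iff[of b] by auto
        have aU: "a \<in> U" "a \<in> carrier G" using a Vc unfolding V_def by auto
        have "\<phi> (a \<otimes> s) x = \<phi> a x"
          using s(1) aU(2) x composition_rule unfolding H_def by simp
        \<comment> \<open>Right \<open>H\<close>-invariance of \<open>E i\<close>. If both elements
          lie in \<open>E i\<close>, then \<open>p\<close> is in \<open>E i\<close> but not in
          \<open>U\<close>; otherwise \<open>a\<close> is in \<open>U\<close> but not in
          \<open>E i\<close>, and \<open>p\<close> is its translate by \<open>s\<close>.\<close>
        then have "a \<in> E i \<longleftrightarrow> p \<in> E i"
          unfolding a(2) E_def using aU sc by auto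
        then show "p \<in> sym_diff (E i) U \<union> (\<lambda>h. h \<otimes> s) ` sym_diff (E i) U"
          using pU aU(1) unfolding a(2) by (cases "a \<in> E i") auto
      qed
    qed
    ultimately show False
      using open_not_meager[OF cm] by blast
  qed
  moreover have "H \<subseteq> topspace T" unfolding H_def top by blast
  ultimately show ?thesis
    unfolding H_def[symmetric] using closure_of_subset_eq by blast
qed

section \<open>Convergence in measure\<close>

text \<open>Borel-Cantelli for countably many conditions at once: at stage \<open>k\<close> only the
  first k + 1 bad sets are controlled, by a total of 2^(-k). The measure may be infinite; the lemma
  serves both \<mu> and \<open>M\<close>.\<close>

lemma AE_eventually_subsequence:
  fixes Bad :: "nat \<Rightarrow> nat \<Rightarrow> 'a set"
  assumes meas: "\<And>i n. Bad i n \<in> sets M" and lim: "\<And>i. (\<lambda>n. emeasure M (Bad i n)) \<longlonglongrightarrow> 0"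
  obtains r where "strict_mono r" "AE x in M. \<forall>i. \<forall>\<^sub>F n in sequentially. x \<notin> Bad i (r n)"
proof -
  have "\<exists>N. \<forall>n\<ge>N. emeasure M (\<Union>i\<le>k. Bad i n) \<le> ennreal ((1/2) ^ k)" for k
  proof -
    have "(\<lambda>n. \<Sum>i\<le>k. emeasure M (Bad i n)) \<longlonglongrightarrow> (\<Sum>i\<le>k. 0)"
      by (intro tendsto_sum lim)
    then have "(\<lambda>n. \<Sum>i\<le>k. emeasure M (Bad i n)) \<longlonglongrightarrow> 0" by simp
    then have "\<forall>\<^sub>F n in sequentially. (\<Sum>i\<le>k. emeasure M (Bad i n)) < ennreal ((1/2) ^ k)"
      by (rule order_tendstoD) simp
    then obtain N where N: "\<And>n. n \<ge> N \<Longrightarrow> (\<Sum>i\<le>k. emeasure M (Bad i n)) < ennreal ((1/2) ^ k)"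
      unfolding eventually_sequentially by auto
    have "emeasure M (\<Union>i\<le>k. Bad i n) \<le> (\<Sum>i\<le>k. emeasure M (Bad i n))" for n
      by (rule emeasure_subadditive_finite) (auto intro: meas)
    then show ?thesis using N by (meson less_imp_le order_trans)
  qed
  then obtain N where N: "\<And>k n. n \<ge> N k \<Longrightarrow> emeasure M (\<Union>i\<le>k. Bad i n) \<le> ennreal ((1/2) ^ k)"
    by metis
  \<comment> \<open>Summing the successors makes \<open>r\<close> strictly increasing and keeps
    \<open>r k\<close> above \<open>N k\<close>.\<close>
  define r where "r k = (\<Sum>j\<le>k. Suc (N j))" for k
  have r: "strict_mono r"
    unfolding strict_mono_Suc_iff r_def by simp
  have rN: "N k \<le> r k" for k
    unfolding r_def using member_le_sum[of k "{..k}" "\<lambda>j. Suc (N j)"] by simp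
  define C where "C k = (\<Union>i\<le>k. Bad i (r k))" for k
  have C: "emeasure M (C k) \<le> ennreal ((1/2) ^ k)" for k
    unfolding C_def by (rule N[OF rN])
  have "AE x in M. \<forall>\<^sub>F n in sequentially. x \<in> space M - C n"
  proof (rule borel_cantelli_AE1)
    show "C n \<in> sets M" for n unfolding C_def using meas by auto
    show "emeasure M (C n) < \<infinity>" for n using C[of n] by (rule le_less_trans) simp
    show "summable (\<lambda>n. measure M (C n))"
    proof (rule summable_comparison_test)
      have "measure M (C n) \<le> (1/2) ^ n" for n
        unfolding measure_def using C[of n] by (intro enn2real_leI) simp_all
      then show "\<exists>N'. \<forall>n\<ge>N'. norm (measure M (C n)) \<le> (1/2) ^ n" by simp
      show "summable (\<lambda>n. (1/2) ^ n :: real)"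
        by (rule summable_geometric) simp
    qed
  qed
  then have "AE x in M. \<forall>i. \<forall>\<^sub>F n in sequentially. x \<notin> Bad i (r n)"
  proof (rule AE_mp, intro AE_I2 impI allI)
    fix x i
    assume "\<forall>\<^sub>F n in sequentially. x \<in> space M - C n"
    with eventually_ge_at_top[of i] show "\<forall>\<^sub>F n in sequentially. x \<notin> Bad i (r n)"
      by eventually_elim (auto simp: C_def)
  qed
  with r show ?thesis by (rule that)
qed

locale L0_space =
  fixes M \<mu> :: "'a measure" and \<tau> :: "'g topology" and d :: "'g \<Rightarrow> 'g \<Rightarrow> real"
  assumes equiv: "equivalent_prob M \<mu>" and compat: "compatible_bounded_metric \<tau> d"
    and polish: "polish_topology \<tau>"
begin

sublocale prob_space \<mu>
  using equiv unfolding equivalent_prob_def by simp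

sublocale target: Metric_space "topspace \<tau>" d
  using compat unfolding compatible_bounded_metric_def by simp

lemma mtopology_target [simp]: "target.mtopology = \<tau>"
  using compat unfolding compatible_bounded_metric_def by simp

lemma sets_mu [measurable_cong]: "sets \<mu> = sets M"
  using equiv unfolding equivalent_prob_def by simp

lemma space_mu: "space \<mu> = space M"
  by (rule sets_eq_imp_space_eq[OF sets_mu])

lemma null_sets_mu: "null_sets \<mu> = null_sets M"
  using equiv unfolding equivalent_prob_def by simp

lemma AE_mu: "(AE x in \<mu>. P x) \<longleftrightarrow> (AE x in M. P x)"
  by (simp add: eventually_ae_filter null_sets_mu space_mu)

lemma measurable_mu: "measurable \<mu> N = measurable M N"
  by (rule measurable_cong_sets[OF sets_mu refl])

lemma sets_completion_mu: "sets (completion \<mu>) = sets (completion M)"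
  by (simp add: sets_completion sets_mu null_sets_mu)

lemma measurable_completion_mu: "measurable (completion \<mu>) N = measurable (completion M) N"
  by (rule measurable_cong_sets[OF sets_completion_mu refl])

lemma d_bounded: obtains B where "B > 0" "\<And>x y. x \<in> topspace \<tau> \<Longrightarrow> y \<in> topspace \<tau> \<Longrightarrow> d x y \<le> B"
  using compat unfolding compatible_bounded_metric_def target.mbounded_alt_pos by metis

lemma second_countable: "second_countable \<tau>"
  by (rule polish_imp_second_countable[OF polish])

lemma d_continuous: "continuous_map (prod_topology \<tau> \<tau>) euclidean (\<lambda>(x, y). d x y)"
  using continuous_map_metric[of "metric (topspace \<tau>, d)"]
  by (simp add: mtopology_of_def target.mspace_metric target.mdist_metric)

lemma d_measurable:
  assumes "f \<in> measurable N (borel_of \<tau>)" "g \<in> measurable N (borel_of \<tau>)"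
  shows "(\<lambda>x. d (f x) (g x)) \<in> borel_measurable N"
  using measurable_continuous_pair[OF second_countable second_countable d_continuous assms]
  by (simp add: borel_of_euclidean)

text \<open>The preimage of each basic open set is Borel up to a null set. Off the union
  \<open>N0\<close> of these countably many null sets \<open>f\<close> is Borel; on
  \<open>N0\<close> it is replaced by a constant, whose existence uses that a probability space is
  not empty.\<close>

lemma borel_representative:
  assumes f: "f \<in> measurable (completion M) (borel_of \<tau>)"
  obtains g where "g \<in> measurable M (borel_of \<tau>)" "AE x in M. g x = f x"
proof -
  obtain B where B0: "base_sequence \<tau> B"
    using second_countable by (rule second_countable_base_sequence)
  have "\<exists>S N. S \<in> sets M \<and> N \<in> null_sets M \<and> sym_diff (f -` B i \<inter> space M) S \<subseteq> N" for i
  proof -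
    have "f -` B i \<inter> space M \<in> sets (completion M)"
      using measurable_sets[OF f borel_of_open[OF base_sequenceD(1)[OF B0]]] by simp
    then obtain S N N' where "f -` B i \<inter> space M = S \<union> N" "N \<subseteq> N'" "N' \<in> null_sets M" "S \<in> sets M"
      by (rule sets_completionE)
    then show ?thesis by (intro exI[of _ S] exI[of _ N']) auto
  qed
  then obtain S N where S: "\<And>i. S i \<in> sets M" and N: "\<And>i. N i \<in> null_sets M"
    and SN: "\<And>i. sym_diff (f -` B i \<inter> space M) (S i) \<subseteq> N i"
    by metis
  define N0 where "N0 = (\<Union>i. N i)"
  have N0: "N0 \<in> null_sets M" unfolding N0_def using N by auto
  have "space M \<noteq> {}" using not_empty space_mu by simp
  then obtain e where e: "e \<in> topspace \<tau>"
    using measurable_space[OF f] by fastforce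
  define g where "g x = (if x \<in> N0 then e else f x)" for x
  have "g \<in> measurable M (borel_of \<tau>)"
  proof (rule measurable_borel_of_base[OF B0])
    show "g \<in> space M \<rightarrow> topspace \<tau>"
      using e measurable_space[OF f] by (auto simp: g_def)
    fix i
    have "x \<in> g -` B i \<inter> space M \<longleftrightarrow> x \<in> (S i - N0) \<union> (if e \<in> B i then N0 else {})" for x
    proof (cases "x \<in> N0")
      case True
      then have "x \<in> space M" using N0 sets.sets_into_space[of N0 M] by auto
      then show ?thesis using True by (simp add: g_def)
    next
      case False
      then have "x \<notin> N i" unfolding N0_def by simp
      then have "x \<in> f -` B i \<inter> space M \<longleftrightarrow> x \<in> S i" using SN[of i] by blast
      then show ?thesis using False by (simp add: g_def)
    qed
    then have "g -` B i \<inter> space M = (S i - N0) \<union> (if e \<in> B i then N0 else {})"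
      by blast
    then show "g -` B i \<inter> space M \<in> sets M"
      using S N0 by auto
  qed
  moreover have "AE x in M. g x = f x"
    by (rule AE_I'[OF N0]) (auto simp: g_def)
  ultimately show ?thesis by (rule that)
qed

lemma mem_L0_class:
  assumes "f \<in> measurable M (borel_of \<tau>)"
  shows "f \<in> L0_class M \<tau> f"
  using assms unfolding L0_class_def by (simp add: measurable_completion)

lemma L0_class_in_L0:
  assumes "f \<in> measurable M (borel_of \<tau>)"
  shows "L0_class M \<tau> f \<in> L0 M \<tau>"
  using assms unfolding L0_def by (simp add: measurable_completion)

lemma L0_class_eq:
  assumes "AE x in M. f x = h x"
  shows "L0_class M \<tau> f = L0_class M \<tau> h"
proof -
  have "(AE x in M. k x = f x) \<longleftrightarrow> (AE x in M. k x = h x)" for k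
    using assms by (auto elim: AE_mp)
  then show ?thesis unfolding L0_class_def by simp
qed

lemma L0_borel_representative:
  assumes "F \<in> L0 M \<tau>"
  obtains f where "f \<in> measurable M (borel_of \<tau>)" "F = L0_class M \<tau> f"
proof -
  obtain f where f: "F = L0_class M \<tau> f" "f \<in> measurable (completion M) (borel_of \<tau>)"
    using assms unfolding L0_def by (rule imageE)
  obtain g where g: "g \<in> measurable M (borel_of \<tau>)" "AE x in M. g x = f x"
    by (rule borel_representative[OF f(2)])
  show ?thesis by (rule that[OF g(1)]) (simp add: f(1) L0_class_eq[OF g(2)])
qed

text \<open>Rids the distance of the chosen representatives and of the completion, so that from here
  on all computations are with Borel maps and \<mu>.\<close>

lemma L0_dist_class:
  assumes f: "f \<in> measurable M (borel_of \<tau>)" and h: "h \<in> measurable M (borel_of \<tau>)"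
  shows "L0_dist \<mu> d (L0_class M \<tau> f) (L0_class M \<tau> h) = (LINT x|\<mu>. d (f x) (h x))"
proof -
  define f' where "f' = (SOME k. k \<in> L0_class M \<tau> f)"
  define h' where "h' = (SOME k. k \<in> L0_class M \<tau> h)"
  have f': "f' \<in> L0_class M \<tau> f"
    unfolding f'_def by (rule someI[of "\<lambda>k. k \<in> L0_class M \<tau> f", OF mem_L0_class[OF f]])
  have h': "h' \<in> L0_class M \<tau> h"
    unfolding h'_def by (rule someI[of "\<lambda>k. k \<in> L0_class M \<tau> h", OF mem_L0_class[OF h]])
  have "L0_dist \<mu> d (L0_class M \<tau> f) (L0_class M \<tau> h) = (LINT x|completion \<mu>. d (f' x) (h' x))"
    unfolding L0_dist_def f'_def h'_def ..
  also have "\<dots> = (LINT x|completion \<mu>. d (f x) (h x))"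
  proof (rule integral_cong_AE)
    have "AE x in \<mu>. f' x = f x" "AE x in \<mu>. h' x = h x"
      using f' h' unfolding L0_class_def AE_mu by auto
    then have "AE x in \<mu>. d (f' x) (h' x) = d (f x) (h x)"
      by eventually_elim simp
    then show "AE x in completion \<mu>. d (f' x) (h' x) = d (f x) (h x)"
      by (rule AE_completion)
    show "(\<lambda>x. d (f' x) (h' x)) \<in> borel_measurable (completion \<mu>)"
      using f' h' unfolding L0_class_def by (intro d_measurable) (simp_all add: measurable_completion_mu)
    show "(\<lambda>x. d (f x) (h x)) \<in> borel_measurable (completion \<mu>)"
      using f h by (intro d_measurable) (simp_all add: measurable_completion_mu measurable_completion)
  qed
  also have "\<dots> = (LINT x|\<mu>. d (f x) (h x))"
    using f h by (intro integral_completion d_measurable) (simp_all add: measurable_mu)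
  finally show ?thesis .
qed

lemma d_integrable:
  assumes f: "f \<in> measurable M (borel_of \<tau>)" and h: "h \<in> measurable M (borel_of \<tau>)"
  shows "integrable \<mu> (\<lambda>x. d (f x) (h x))"
proof -
  obtain B where B: "\<And>x y. x \<in> topspace \<tau> \<Longrightarrow> y \<in> topspace \<tau> \<Longrightarrow> d x y \<le> B"
    using d_bounded by metis
  show ?thesis
  proof (rule integrable_const_bound[of _ B])
    show "AE x in \<mu>. norm (d (f x) (h x)) \<le> B"
      using B measurable_space[OF f] measurable_space[OF h] by (intro AE_I2) (simp add: space_mu)
    show "(\<lambda>x. d (f x) (h x)) \<in> borel_measurable \<mu>"
      using f h by (intro d_measurable) (simp_all add: measurable_mu)
  qed
qed

lemma AE_eq_if_L0_dist_0:
  assumes f: "f \<in> measurable M (borel_of \<tau>)" and h: "h \<in> measurable M (borel_of \<tau>)"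
    and "(LINT x|\<mu>. d (f x) (h x)) = 0"
  shows "AE x in M. f x = h x"
proof -
  have "AE x in \<mu>. d (f x) (h x) = 0"
    using integral_nonneg_eq_0_iff_AE[OF d_integrable[OF f h]] assms(3) by simp
  then have "AE x in \<mu>. f x = h x"
  proof (rule AE_mp, intro AE_I2 impI)
    fix x assume "x \<in> space \<mu>" "d (f x) (h x) = 0"
    then show "f x = h x"
      using measurable_space[OF f] measurable_space[OF h] by (simp add: space_mu)
  qed
  then show ?thesis unfolding AE_mu .
qed

text \<open>\<open>L0_topology\<close> is defined through \<open>Metric_space.mtopology\<close>,
  about which nothing can be said before the metric axioms are established.\<close>

sublocale L0: Metric_space "L0 M \<tau>" "L0_dist \<mu> d"
proof
  have nn: "0 \<le> L0_dist \<mu> d F H" for F H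
    unfolding L0_dist_def by (rule Bochner_Integration.integral_nonneg) simp
  show "0 \<le> L0_dist \<mu> d F H" for F H by (rule nn)
  show "L0_dist \<mu> d F H = L0_dist \<mu> d H F" for F H
    unfolding L0_dist_def by (simp add: target.commute)
  show "L0_dist \<mu> d F H = 0 \<longleftrightarrow> F = H" if FHK: "F \<in> L0 M \<tau>" "H \<in> L0 M \<tau>" for F H
  proof -
    obtain f where f: "f \<in> measurable M (borel_of \<tau>)" "F = L0_class M \<tau> f"
      by (rule L0_borel_representative[OF FHK(1)])
    obtain h where h: "h \<in> measurable M (borel_of \<tau>)" "H = L0_class M \<tau> h"
      by (rule L0_borel_representative[OF FHK(2)])
    show ?thesis
    proof
      assume "L0_dist \<mu> d F H = 0"
      then have "(LINT x|\<mu>. d (f x) (h x)) = 0"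
        unfolding f(2) h(2) L0_dist_class[OF f(1) h(1)] .
      then show "F = H"
        unfolding f(2) h(2) by (intro L0_class_eq AE_eq_if_L0_dist_0 f(1) h(1))
    next
      assume "F = H"
      have "(LINT x|\<mu>. d (f x) (f x)) = (LINT x|\<mu>. 0)"
        using measurable_space[OF f(1)] by (intro Bochner_Integration.integral_cong) (simp_all add: space_mu)
      then show "L0_dist \<mu> d F H = 0"
        unfolding \<open>F = H\<close>[symmetric] f(2) L0_dist_class[OF f(1) f(1)] by simp
    qed
  qed
  show "L0_dist \<mu> d F K \<le> L0_dist \<mu> d F H + L0_dist \<mu> d H K"
    if FHK: "F \<in> L0 M \<tau>" "H \<in> L0 M \<tau>" "K \<in> L0 M \<tau>" for F H K
  proof -
    obtain f where f: "f \<in> measurable M (borel_of \<tau>)" "F = L0_class M \<tau> f"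
      by (rule L0_borel_representative[OF FHK(1)])
    obtain h where h: "h \<in> measurable M (borel_of \<tau>)" "H = L0_class M \<tau> h"
      by (rule L0_borel_representative[OF FHK(2)])
    obtain k where k: "k \<in> measurable M (borel_of \<tau>)" "K = L0_class M \<tau> k"
      by (rule L0_borel_representative[OF FHK(3)])
    have "(LINT x|\<mu>. d (f x) (k x)) \<le> (LINT x|\<mu>. d (f x) (h x) + d (h x) (k x))"
      using measurable_space[OF f(1)] measurable_space[OF h(1)] measurable_space[OF k(1)]
      by (intro integral_mono Bochner_Integration.integrable_add d_integrable f h k)
        (simp add: space_mu target.triangle)
    also have "\<dots> = (LINT x|\<mu>. d (f x) (h x)) + (LINT x|\<mu>. d (h x) (k x))"
      by (intro Bochner_Integration.integral_add d_integrable f h k)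
    finally show ?thesis
      unfolding f(2) h(2) k(2) by (simp add: L0_dist_class f h k)
  qed
qed

lemma L0_topology_eq: "L0_topology M \<tau> \<mu> d = L0.mtopology"
  unfolding L0_topology_def ..

text \<open>Markov's inequality.\<close>

lemma limitin_L0_imp_measure:
  assumes f: "\<And>n. f n \<in> measurable M (borel_of \<tau>)" "f0 \<in> measurable M (borel_of \<tau>)"
    and lim: "limitin (L0_topology M \<tau> \<mu> d) (\<lambda>n::nat. L0_class M \<tau> (f n)) (L0_class M \<tau> f0) sequentially"
    and e: "e > 0"
  shows "(\<lambda>n. prob {x \<in> space M. e \<le> d (f n x) (f0 x)}) \<longlonglongrightarrow> 0"
proof -
  have "(\<lambda>n. L0_dist \<mu> d (L0_class M \<tau> (f n)) (L0_class M \<tau> f0)) \<longlonglongrightarrow> 0"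
    using lim unfolding L0_topology_eq L0.limitin_metric_dist_null by simp
  then have "(\<lambda>n. LINT x|\<mu>. d (f n x) (f0 x)) \<longlonglongrightarrow> 0"
    by (simp add: L0_dist_class f)
  then have lim0: "(\<lambda>n. (LINT x|\<mu>. d (f n x) (f0 x)) / e) \<longlonglongrightarrow> 0"
    using tendsto_divide_zero by blast
  show ?thesis
  proof (rule real_tendsto_sandwich[OF _ _ tendsto_const lim0])
    have "prob {x \<in> space \<mu>. e \<le> d (f n x) (f0 x)} \<le> (LINT x|\<mu>. d (f n x) (f0 x)) / e" for n
      by (rule integral_Markov_inequality_measure[where A = "{}"])
        (use d_integrable[OF f(1)[of n] f(2)] e in \<open>auto\<close>)
    then show "\<forall>\<^sub>F n in sequentially. prob {x \<in> space M. e \<le> d (f n x) (f0 x)} \<le> (LINT x|\<mu>. d (f n x) (f0 x)) / e"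
      by (simp add: space_mu)
  qed simp
qed

text \<open>Dominated convergence: the bounded metric provides a constant majorant, integrable for
  the probability \<mu>.\<close>

lemma limitin_L0_if_AE:
  assumes f: "\<And>n. f n \<in> measurable M (borel_of \<tau>)" "f0 \<in> measurable M (borel_of \<tau>)"
    and lim: "AE x in M. limitin \<tau> (\<lambda>n::nat. f n x) (f0 x) sequentially"
  shows "limitin (L0_topology M \<tau> \<mu> d) (\<lambda>n. L0_class M \<tau> (f n)) (L0_class M \<tau> f0) sequentially"
proof -
  obtain B where B: "\<And>x y. x \<in> topspace \<tau> \<Longrightarrow> y \<in> topspace \<tau> \<Longrightarrow> d x y \<le> B"
    using d_bounded by metis
  have "(\<lambda>n. LINT x|\<mu>. d (f n x) (f0 x)) \<longlonglongrightarrow> (LINT x|\<mu>. 0)"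
  proof (rule integral_dominated_convergence[where w = "\<lambda>_. B"])
    have "AE x in \<mu>. limitin \<tau> (\<lambda>n. f n x) (f0 x) sequentially"
      using lim unfolding AE_mu .
    then show "AE x in \<mu>. (\<lambda>n. d (f n x) (f0 x)) \<longlonglongrightarrow> 0"
      by eventually_elim (metis mtopology_target target.limitin_metric_dist_null)
    show "AE x in \<mu>. norm (d (f n x) (f0 x)) \<le> B" for n
      using B measurable_space[OF f(1)[of n]] measurable_space[OF f(2)]
      by (intro AE_I2) (simp add: space_mu)
    show "(\<lambda>x. d (f n x) (f0 x)) \<in> borel_measurable \<mu>" for n
      using f by (intro d_measurable) (simp_all add: measurable_mu)
  qed auto
  then have "(\<lambda>n. L0_dist \<mu> d (L0_class M \<tau> (f n)) (L0_class M \<tau> f0)) \<longlonglongrightarrow> 0"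
    by (simp add: L0_dist_class f)
  then show ?thesis
    unfolding L0_topology_eq L0.limitin_metric_dist_null using f L0_class_in_L0 by simp
qed

lemma L0_limit_AE_subsequence:
  assumes f: "\<And>n. f n \<in> measurable M (borel_of \<tau>)" "f0 \<in> measurable M (borel_of \<tau>)"
    and lim: "limitin (L0_topology M \<tau> \<mu> d) (\<lambda>n::nat. L0_class M \<tau> (f n)) (L0_class M \<tau> f0) sequentially"
  obtains r where "strict_mono r" "AE x in M. limitin \<tau> (\<lambda>n. f (r n) x) (f0 x) sequentially"
proof -
  \<comment> \<open>Countably many thresholds 1/(i+1) suffice to express pointwise convergence, as
    Borel-Cantelli requires.\<close>
  define Bad where "Bad i n = {x \<in> space M. inverse (real (Suc i)) \<le> d (f n x) (f0 x)}" for i n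
  have Bm: "Bad i n \<in> events" for i n
    unfolding Bad_def sets_mu using d_measurable[OF f(1)[of n] f(2)] by measurable
  have Bl: "(\<lambda>n. emeasure \<mu> (Bad i n)) \<longlonglongrightarrow> 0" for i
    using tendsto_ennrealI[OF limitin_L0_imp_measure[OF f lim, of "inverse (real (Suc i))"]]
    unfolding Bad_def emeasure_eq_measure by simp
  obtain r where r: "strict_mono r" "AE x in \<mu>. \<forall>i. \<forall>\<^sub>F n in sequentially. x \<notin> Bad i (r n)"
    by (rule AE_eventually_subsequence[of Bad \<mu>, OF Bm Bl])
  have "AE x in M. limitin \<tau> (\<lambda>n. f (r n) x) (f0 x) sequentially"
    using r(2) AE_space unfolding AE_mu
  proof eventually_elim
    case (elim x)
    have sp: "f n x \<in> topspace \<tau>" "f0 x \<in> topspace \<tau>" for n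
      using measurable_space[OF f(1)] measurable_space[OF f(2)] elim(2) by simp_all
    have "(\<lambda>n. d (f (r n) x) (f0 x)) \<longlonglongrightarrow> 0"
    proof (rule LIMSEQ_I)
      fix e :: real assume "0 < e"
      then obtain i where i: "inverse (real (Suc i)) < e" using reals_Archimedean by blast
      have "\<forall>\<^sub>F n in sequentially. x \<notin> Bad i (r n)" using elim(1) by simp
      then obtain N where N: "\<And>n. n \<ge> N \<Longrightarrow> x \<notin> Bad i (r n)"
        unfolding eventually_sequentially by auto
      have "norm (d (f (r n) x) (f0 x) - 0) < e" if "n \<ge> N" for n
        using N[OF that] elim(2) i unfolding Bad_def by simp
      then show "\<exists>N. \<forall>n\<ge>N. norm (d (f (r n) x) (f0 x) - 0) < e" by auto
    qed
    then have "limitin target.mtopology (\<lambda>n. f (r n) x) (f0 x) sequentially"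
      unfolding target.limitin_metric_dist_null using sp by simp
    then show ?case unfolding mtopology_target .
  qed
  with r(1) show ?thesis by (rule that)
qed

end

section \<open>Measure-preserving bijections\<close>

lemma mp_bijectionsD:
  assumes "T \<in> mp_bijections M"
  shows "bij_betw T (space M) (space M)" "inj_on T (space M)" "T ` space M = space M"
    and "A \<in> sets M \<Longrightarrow> T ` A \<in> sets M" "A \<in> sets M \<Longrightarrow> T -` A \<inter> space M \<in> sets M"
    and "A \<in> sets M \<Longrightarrow> emeasure M (T ` A) = emeasure M A"
    and "A \<in> sets M \<Longrightarrow> emeasure M (T -` A \<inter> space M) = emeasure M A"
    and "x \<in> space M \<Longrightarrow> T x \<in> space M"
  using assms unfolding mp_bijections_def by (auto simp: bij_betw_def)

lemma mp_bijections_measurable: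
  assumes "T \<in> mp_bijections M"
  shows "T \<in> measurable M M"
  using mp_bijectionsD(5,8)[OF assms] by (intro measurableI) auto

text \<open>Preimages under \<open>T\<close> are images under its inverse \<open>S\<close>, so
  conditions on images under both maps cover all that the definition asks.\<close>

lemma mp_bijectionsI:
  assumes T: "\<And>x. x \<in> space M \<Longrightarrow> T x \<in> space M \<and> S (T x) = x"
    and S: "\<And>x. x \<in> space M \<Longrightarrow> S x \<in> space M \<and> T (S x) = x"
    and mT: "\<And>A. A \<in> sets M \<Longrightarrow> T ` A \<in> sets M \<and> emeasure M (T ` A) = emeasure M A"
    and mS: "\<And>A. A \<in> sets M \<Longrightarrow> S ` A \<in> sets M \<and> emeasure M (S ` A) = emeasure M A"
  shows "T \<in> mp_bijections M"
proof -
  have "bij_betw T (space M) (space M)"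
    by (rule bij_betw_byWitness[where f' = S]) (use T S in auto)
  moreover have "T -` A \<inter> space M = S ` A" if "A \<in> sets M" for A
  proof
    show "T -` A \<inter> space M \<subseteq> S ` A"
      using T by (metis IntE imageI subsetI vimageE)
    show "S ` A \<subseteq> T -` A \<inter> space M"
      using S sets.sets_into_space[OF that] by auto
  qed
  ultimately show ?thesis
    unfolding mp_bijections_def using mT mS by simp
qed

lemma mp_bijections_id: "id \<in> mp_bijections M"
  by (rule mp_bijectionsI[where S = id]) auto

lemma mp_bijections_comp:
  assumes T: "T \<in> mp_bijections M" and S: "S \<in> mp_bijections M"
  shows "T \<circ> S \<in> mp_bijections M"
proof -
  have 1: "(T \<circ> S) -` A \<inter> space M = S -` (T -` A \<inter> space M) \<inter> space M" for A
    using mp_bijectionsD(8)[OF S] by auto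
  have 2: "(T \<circ> S) ` A = T ` (S ` A)" for A by (rule image_comp[symmetric])
  show ?thesis
    unfolding mp_bijections_def
  proof (intro CollectI conjI ballI)
    show "bij_betw (T \<circ> S) (space M) (space M)"
      by (rule bij_betw_trans[OF mp_bijectionsD(1)[OF S] mp_bijectionsD(1)[OF T]])
    fix A assume A: "A \<in> sets M"
    show "(T \<circ> S) ` A \<in> sets M" "emeasure M ((T \<circ> S) ` A) = emeasure M A"
      unfolding 2 using mp_bijectionsD(4,6)[OF S A] mp_bijectionsD(4,6)[OF T] by simp_all
    show "(T \<circ> S) -` A \<inter> space M \<in> sets M" "emeasure M ((T \<circ> S) -` A \<inter> space M) = emeasure M A"
      unfolding 1 using mp_bijectionsD(5)[OF S mp_bijectionsD(5)[OF T A]]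
        mp_bijectionsD(7)[OF S mp_bijectionsD(5)[OF T A]] mp_bijectionsD(7)[OF T A] by (simp_all only:)
  qed
qed

lemma mp_bijections_inv_into_cancel:
  assumes "T \<in> mp_bijections M" "x \<in> space M"
  shows "inv_into (space M) T (T x) = x" "T (inv_into (space M) T x) = x"
    "inv_into (space M) T x \<in> space M"
  using mp_bijectionsD(2,3)[OF assms(1)] assms(2)
  by (auto intro: inv_into_f_f f_inv_into_f inv_into_into)

lemma inv_into_image_eq_vimage:
  assumes T: "T \<in> mp_bijections M" and A: "A \<subseteq> space M"
  shows "inv_into (space M) T ` A = T -` A \<inter> space M"
proof
  show "inv_into (space M) T ` A \<subseteq> T -` A \<inter> space M"
    using mp_bijections_inv_into_cancel[OF T] A by auto
  show "T -` A \<inter> space M \<subseteq> inv_into (space M) T ` A"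
    using mp_bijections_inv_into_cancel(1)[OF T] by (metis IntE image_eqI subsetI vimageE)
qed

lemma mp_bijections_inv_into:
  assumes T: "T \<in> mp_bijections M"
  shows "inv_into (space M) T \<in> mp_bijections M"
proof (rule mp_bijectionsI[where S = T])
  fix A assume A: "A \<in> sets M"
  show "T ` A \<in> sets M \<and> emeasure M (T ` A) = emeasure M A"
    using mp_bijectionsD(4,6)[OF T A] by simp
  show "inv_into (space M) T ` A \<in> sets M \<and> emeasure M (inv_into (space M) T ` A) = emeasure M A"
    unfolding inv_into_image_eq_vimage[OF T sets.sets_into_space[OF A]]
    using mp_bijectionsD(5,7)[OF T A] by simp
qed (use mp_bijections_inv_into_cancel[OF T] mp_bijectionsD(8)[OF T] in auto)

lemma AE_mp_bijection:
  assumes T: "T \<in> mp_bijections M" and P: "AE x in M. P x"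
  shows "AE x in M. P (T x)"
proof -
  obtain N where N: "{x \<in> space M. \<not> P x} \<subseteq> N" "N \<in> null_sets M"
    using P unfolding eventually_ae_filter by auto
  have "T -` N \<inter> space M \<in> null_sets M"
    using N(2) mp_bijectionsD(5,7)[OF T] by (auto simp: null_sets_def)
  then show ?thesis
    by (rule AE_I') (use N(1) mp_bijectionsD(8)[OF T] in auto)
qed

text \<open>The one-sided analogue of \<open>mp_bijections\<close>: on a space of infinite measure
  such a map can miss a set of positive measure, and the shifts of the contraction do.\<close>

definition mp_injection :: "'a measure \<Rightarrow> ('a \<Rightarrow> 'a) \<Rightarrow> bool" where
  "mp_injection M V \<longleftrightarrow> V \<in> measurable M M \<and> inj_on V (space M) \<and>
     (\<forall>A\<in>sets M. V ` A \<in> sets M \<and> emeasure M (V ` A) = emeasure M A)"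

text \<open>After the pieces are made disjoint, injectivity of \<open>V\<close> keeps their images
  disjoint, so the measures of the images add up to the measure of the set.\<close>

lemma mp_injection_piecewise:
  fixes P :: "nat \<Rightarrow> 'a set"
  assumes V: "inj_on V (space M)"
    and Q: "\<And>i. Q i \<in> mp_bijections M"
    and P: "\<And>i. P i \<in> sets M" "space M \<subseteq> (\<Union>i. P i)"
    and VQ: "\<And>i x. x \<in> P i \<Longrightarrow> x \<in> space M \<Longrightarrow> V x = Q i x"
  shows "mp_injection M V"
proof -
  define P' where "P' = disjointed P"
  have P': "P' i \<in> sets M" for i
    using P(1) unfolding P'_def by (metis sets.range_disjointed_sets image_subset_iff rangeI UNIV_I)
  have P'P: "P' i \<subseteq> P i" for i unfolding P'_def by (rule disjointed_subset)
  have UN: "(\<Union>i. P' i) = (\<Union>i. P i)" unfolding P'_def by (rule UN_disjointed_eq)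
  have disj: "disjoint_family P'" unfolding P'_def by (rule disjoint_family_disjointed)
  have VQ': "V x = Q i x" if "x \<in> P' i" "x \<in> space M" for i x
    using VQ P'P that by blast
  have cover: "\<exists>i. x \<in> P' i" if "x \<in> space M" for x
    using that P(2) UN by blast
  have "V \<in> measurable M M"
  proof (rule measurableI)
    show "V x \<in> space M" if "x \<in> space M" for x
      using cover[OF that] VQ'[OF _ that] mp_bijectionsD(8)[OF Q that] by metis
    fix A assume A: "A \<in> sets M"
    have "V -` A \<inter> space M = (\<Union>i. P' i \<inter> (Q i -` A \<inter> space M))"
    proof (intro Set.set_eqI iffI)
      fix x assume x: "x \<in> V -` A \<inter> space M"
      then obtain i where i: "x \<in> P' i" using cover by auto
      then show "x \<in> (\<Union>i. P' i \<inter> (Q i -` A \<inter> space M))" using x VQ'[OF i] by auto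
    next
      fix x assume "x \<in> (\<Union>i. P' i \<inter> (Q i -` A \<inter> space M))"
      then obtain i where i: "x \<in> P' i" "Q i x \<in> A" "x \<in> space M" by auto
      then show "x \<in> V -` A \<inter> space M" using VQ'[OF i(1,3)] by simp
    qed
    then show "V -` A \<inter> space M \<in> sets M"
      using P' mp_bijectionsD(5)[OF Q A] by auto
  qed
  moreover have "V ` A \<in> sets M \<and> emeasure M (V ` A) = emeasure M A" if A: "A \<in> sets M" for A
  proof -
    define W where "W i = Q i ` (A \<inter> P' i)" for i
    have AP: "A \<inter> P' i \<in> sets M" for i using A P' by auto
    have As: "A \<subseteq> space M" using sets.sets_into_space[OF A] .
    have W: "W i = V ` (A \<inter> P' i)" for i
      unfolding W_def by (rule image_cong[OF refl]) (use VQ' As in auto)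
    have Wm: "W i \<in> sets M" "emeasure M (W i) = emeasure M (A \<inter> P' i)" for i
      unfolding W_def using mp_bijectionsD(4,6)[OF Q AP] by auto
    have Aeq: "A = (\<Union>i. A \<inter> P' i)" using cover As by auto
    have VA: "V ` A = (\<Union>i. W i)" unfolding W by (subst Aeq) (rule image_UN)
    have "disjoint_family W"
      unfolding disjoint_family_on_def
    proof (intro ballI impI)
      fix i j :: nat assume "i \<noteq> j"
      then have "(A \<inter> P' i) \<inter> (A \<inter> P' j) = {}"
        using disj unfolding disjoint_family_on_def by blast
      moreover have "W i \<inter> W j = V ` ((A \<inter> P' i) \<inter> (A \<inter> P' j))"
        unfolding W by (rule inj_on_image_Int[OF V, symmetric]) (use As in auto)
      ultimately show "W i \<inter> W j = {}" by simp
    qed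
    then have "emeasure M (V ` A) = (\<Sum>i. emeasure M (W i))"
      unfolding VA using Wm(1) by (intro suminf_emeasure[symmetric]) auto
    also have "\<dots> = (\<Sum>i. emeasure M (A \<inter> P' i))" unfolding Wm(2) ..
    also have "\<dots> = emeasure M (\<Union>i. A \<inter> P' i)"
    proof (rule suminf_emeasure)
      show "disjoint_family (\<lambda>i. A \<inter> P' i)"
        using disj unfolding disjoint_family_on_def by blast
    qed (use AP in auto)
    finally show ?thesis
      unfolding Aeq[symmetric] using Wm(1) by (auto simp: VA)
  qed
  ultimately show ?thesis
    using V unfolding mp_injection_def by simp
qed

lemma mp_injection_surj:
  assumes V: "mp_injection M V" and surj: "V ` space M = space M"
  shows "V \<in> mp_bijections M"
proof -
  have inj: "inj_on V (space M)" and mV: "V \<in> measurable M M"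
    and img: "\<And>A. A \<in> sets M \<Longrightarrow> V ` A \<in> sets M \<and> emeasure M (V ` A) = emeasure M A"
    using V unfolding mp_injection_def by auto
  have "V ` (V -` A \<inter> space M) = A" if "A \<in> sets M" for A
  proof (intro Set.set_eqI iffI)
    fix y assume y: "y \<in> A"
    then have "y \<in> V ` space M" using sets.sets_into_space[OF that] surj by auto
    then obtain x where "x \<in> space M" "y = V x" by auto
    then show "y \<in> V ` (V -` A \<inter> space M)" using y by auto
  qed auto
  then have "emeasure M (V -` A \<inter> space M) = emeasure M A" if "A \<in> sets M" for A
    using img[OF measurable_sets[OF mV that]] that by simp
  then show ?thesis
    unfolding mp_bijections_def using measurable_sets[OF mV] img inj surj
    by (simp add: bij_betw_def)
qed

definition transfer :: "'a measure \<Rightarrow> ('a \<Rightarrow> 'a) \<Rightarrow> ('a \<Rightarrow> 'a) \<Rightarrow> 'a \<Rightarrow> 'a" where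
  "transfer M V T x = (if x \<in> V ` space M then V (T (inv_into (space M) V x)) else x)"

lemma transfer_image:
  assumes "inj_on V (space M)" "x \<in> space M"
  shows "transfer M V T (V x) = V (T x)"
  using assms unfolding transfer_def by (simp add: inv_into_f_f)

text \<open>The inverse of a transfer is the transfer of the inverse. A Borel set splits into its
  part in the image of \<open>V\<close>, which is moved with preservation of measure, and the rest,
  which is fixed.\<close>

lemma transfer_mp_bijections:
  assumes V: "mp_injection M V" and T: "T \<in> mp_bijections M"
  shows "transfer M V T \<in> mp_bijections M"
proof -
  have inj: "inj_on V (space M)" and mV: "V \<in> measurable M M"
    and img: "\<And>A. A \<in> sets M \<Longrightarrow> V ` A \<in> sets M \<and> emeasure M (V ` A) = emeasure M A"
    using V unfolding mp_injection_def by auto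
  have Vs: "V ` space M \<subseteq> space M" using measurable_space[OF mV] by auto
  have 1: "transfer M V T x \<in> space M \<and> transfer M V (inv_into (space M) T) (transfer M V T x) = x"
    \<comment> \<open>\<open>1\<close> and \<open>2\<close> quantify over their own \<open>T\<close>
      because \<open>2\<close> is applied to the given map and to its inverse.\<close>
    if T: "T \<in> mp_bijections M" and x: "x \<in> space M" for T x
  proof (cases "x \<in> V ` space M")
    case True
    then obtain y where y: "y \<in> space M" "x = V y" by auto
    have "transfer M V T x = V (T y)" unfolding y(2) by (rule transfer_image[OF inj y(1)])
    then show ?thesis
      using y mp_bijectionsD(8)[OF T y(1)] Vs
      by (auto simp: transfer_image[OF inj] mp_bijections_inv_into_cancel[OF T])
  qed (use x in \<open>simp add: transfer_def\<close>)
  have 2: "transfer M V T ` A \<in> sets M \<and> emeasure M (transfer M V T ` A) = emeasure M A"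
    if T: "T \<in> mp_bijections M" and A: "A \<in> sets M" for T A
  proof -
    have As: "A \<subseteq> space M" using sets.sets_into_space[OF A] .
    define B where "B = V -` A \<inter> space M"
    have B: "B \<in> sets M" unfolding B_def by (rule measurable_sets[OF mV A])
    have VS: "V ` space M \<in> sets M" using img[of "space M"] by simp
    have VB: "V ` B = A \<inter> V ` space M" unfolding B_def by auto
    have TB: "T ` B \<in> sets M" "emeasure M (T ` B) = emeasure M B" "T ` B \<subseteq> space M"
      using mp_bijectionsD(4,6)[OF T B] sets.sets_into_space by auto
    have "transfer M V T ` A = V ` (T ` B) \<union> (A - V ` space M)"
    proof -
      have "A = V ` B \<union> (A - V ` space M)" unfolding VB by auto
      then have "transfer M V T ` A = transfer M V T ` (V ` B) \<union> transfer M V T ` (A - V ` space M)"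
        by (metis image_Un)
      moreover have "transfer M V T ` (V ` B) = V ` (T ` B)"
        unfolding image_image by (rule image_cong[OF refl]) (simp add: transfer_image[OF inj] B_def)
      moreover have "transfer M V T ` (A - V ` space M) = A - V ` space M"
        by (auto simp: transfer_def image_iff)
      ultimately show ?thesis by simp
    qed
    moreover have "emeasure M (V ` (T ` B) \<union> (A - V ` space M)) = emeasure M (V ` (T ` B)) + emeasure M (A - V ` space M)"
      using img[OF TB(1)] A VS TB(3) by (intro plus_emeasure[symmetric]) auto
    moreover have "emeasure M (V ` (T ` B)) = emeasure M (A \<inter> V ` space M)"
      using img[OF TB(1)] img[OF B] TB(2) VB by simp
    moreover have "emeasure M (A \<inter> V ` space M) + emeasure M (A - V ` space M) = emeasure M A"
      using A VS by (subst plus_emeasure) (auto intro: arg_cong[where f = "emeasure M"])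
    ultimately show ?thesis
      using img[OF TB(1)] A VS by auto
  qed
  have inv: "inv_into (space M) T \<in> mp_bijections M" by (rule mp_bijections_inv_into[OF T])
  show ?thesis
  proof (rule mp_bijectionsI[where S = "transfer M V (inv_into (space M) T)"])
    fix x assume x: "x \<in> space M"
    show "transfer M V T x \<in> space M \<and> transfer M V (inv_into (space M) T) (transfer M V T x) = x"
      by (rule 1[OF T x])
    show "transfer M V (inv_into (space M) T) x \<in> space M \<and> transfer M V T (transfer M V (inv_into (space M) T) x) = x"
    proof (cases "x \<in> V ` space M")
      case True
      then obtain y where y: "y \<in> space M" "x = V y" by auto
      show ?thesis
        using y mp_bijections_inv_into_cancel[OF T y(1)] Vs by (auto simp: transfer_image[OF inj])
    qed (use x in \<open>simp add: transfer_def\<close>)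
  qed (use 2[OF T] 2[OF inv] in auto)
qed

section \<open>Automorphism classes\<close>

lemma mem_aut_class: "T \<in> mp_bijections M \<Longrightarrow> T \<in> aut_class M T"
  unfolding aut_class_def by simp

lemma aut_classD: "S \<in> aut_class M T \<Longrightarrow> S \<in> mp_bijections M" "S \<in> aut_class M T \<Longrightarrow> AE x in M. S x = T x"
  unfolding aut_class_def by auto

lemma aut_class_eqI:
  assumes "AE x in M. S x = T x"
  shows "aut_class M S = aut_class M T"
proof -
  have "(AE x in M. R x = S x) \<longleftrightarrow> (AE x in M. R x = T x)" for R
    using assms by (auto elim: AE_mp)
  then show ?thesis unfolding aut_class_def by simp
qed

lemma aut_class_eqD:
  assumes "aut_class M S = aut_class M T" "S \<in> mp_bijections M"
  shows "AE x in M. S x = T x"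
  using mem_aut_class[OF assms(2)] unfolding assms(1) by (rule aut_classD(2))

lemma Aut_carrierD:
  assumes "C \<in> carrier (Aut M)" "T \<in> C"
  shows "T \<in> mp_bijections M" "C = aut_class M T"
proof -
  obtain S where S: "C = aut_class M S" using assms(1) unfolding Aut_def by auto
  then show "T \<in> mp_bijections M" using assms(2) aut_classD(1) by blast
  show "C = aut_class M T"
    unfolding S by (rule aut_class_eqI[symmetric]) (use assms(2) S in \<open>blast intro: aut_classD(2)\<close>)
qed

lemma aut_class_in_Aut: "T \<in> mp_bijections M \<Longrightarrow> aut_class M T \<in> carrier (Aut M)"
  unfolding Aut_def by simp

text \<open>The union over all representatives collapses because measure-preserving maps pull null
  sets back to null sets, so changing either factor on a null set changes the composition on a null
  set.\<close>

lemma Aut_mult: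
  assumes T: "T \<in> mp_bijections M" and S: "S \<in> mp_bijections M"
  shows "aut_class M T \<otimes>\<^bsub>Aut M\<^esub> aut_class M S = aut_class M (T \<circ> S)"
proof -
  have "aut_class M (T' \<circ> S') = aut_class M (T \<circ> S)"
    if "T' \<in> aut_class M T" "S' \<in> aut_class M S" for T' S'
  proof (rule aut_class_eqI)
    have "AE x in M. T' (S' x) = T (S' x)"
      by (rule AE_mp_bijection[OF aut_classD(1)[OF that(2)] aut_classD(2)[OF that(1)]])
    with aut_classD(2)[OF that(2)] show "AE x in M. (T' \<circ> S') x = (T \<circ> S) x"
      by eventually_elim simp
  qed
  then have "(\<Union>T'\<in>aut_class M T. \<Union>S'\<in>aut_class M S. aut_class M (T' \<circ> S')) =
      (\<Union>T'\<in>aut_class M T. \<Union>S'\<in>aut_class M S. aut_class M (T \<circ> S))"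
    by (simp cong: SUP_cong)
  moreover have "aut_class M T \<noteq> {}" "aut_class M S \<noteq> {}"
    using mem_aut_class[OF T] mem_aut_class[OF S] by blast+
  ultimately show ?thesis unfolding Aut_def by simp
qed

lemma mp_injection_piecewise_countable:
  fixes P :: "'i::countable \<Rightarrow> 'a set"
  assumes V: "inj_on V (space M)"
    and Q: "\<And>i. Q i \<in> mp_bijections M"
    and P: "\<And>i. P i \<in> sets M" "\<And>x. x \<in> space M \<Longrightarrow> \<exists>i. x \<in> P i"
    and VQ: "\<And>i x. x \<in> P i \<Longrightarrow> x \<in> space M \<Longrightarrow> V x = Q i x"
  shows "mp_injection M V"
proof (rule mp_injection_piecewise[OF V, where Q = "\<lambda>n. Q (from_nat n)" and P = "\<lambda>n. P (from_nat n)"])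
  show "space M \<subseteq> (\<Union>n. P (from_nat n))"
  proof
    fix x assume "x \<in> space M"
    then obtain i where "x \<in> P i" using P(2) by auto
    then show "x \<in> (\<Union>n. P (from_nat n))" by (intro UN_I[of "to_nat i"]) auto
  qed
qed (use Q P(1) VQ in auto)

text \<open>Exhaustion: the supremum of the probabilities of countable unions from the family is
  attained, and a member not almost contained in a maximal union would push it above the supremum.
  This is the essential supremum of a possibly uncountable family.\<close>

lemma (in prob_space) essential_union:
  fixes \<U> :: "'a set set"
  assumes U: "\<U> \<subseteq> events" "\<U> \<noteq> {}"
  obtains W :: "nat \<Rightarrow> 'a set" where "\<And>n. W n \<in> \<U>" "\<And>U. U \<in> \<U> \<Longrightarrow> prob (U - (\<Union>n. W n)) = 0"
proof -
  define \<S> where "\<S> = {S :: nat \<Rightarrow> 'a set. \<forall>n. S n \<in> \<U>}"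
  define m where "m S = prob (\<Union>n. S n)" for S :: "nat \<Rightarrow> 'a set"
  have bdd: "bdd_above (m ` \<S>)"
    unfolding m_def by (rule bdd_aboveI[of _ 1]) auto
  obtain U0 where "U0 \<in> \<U>" using U(2) by auto
  then have "\<S> \<noteq> {}" unfolding \<S>_def by auto
  then have ne: "m ` \<S> \<noteq> {}" by simp
  define s where "s = Sup (m ` \<S>)"
  have "\<exists>S\<in>\<S>. s - inverse (real (Suc k)) < m S" for k
    using less_cSup_iff[OF ne bdd, of "s - inverse (real (Suc k))"] unfolding s_def[symmetric] by auto
  then obtain S where S: "\<And>k. S k \<in> \<S>" "\<And>k. s - inverse (real (Suc k)) < m (S k)"
    by metis
  \<comment> \<open>Pair coding merges countably many nearly optimal sequences into one
    sequence.\<close>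
  define W where "W n = S (fst (prod_decode n)) (snd (prod_decode n))" for n
  have WU: "W n \<in> \<U>" for n using S(1) unfolding W_def \<S>_def by simp
  have Wm: "W n \<in> events" for n using WU U(1) by auto
  have le: "prob (\<Union>n. T n) \<le> s" if "\<And>n. T n \<in> \<U>" for T :: "nat \<Rightarrow> 'a set"
  proof -
    have "T \<in> \<S>" using that unfolding \<S>_def by simp
    then have "m T \<le> s" unfolding s_def by (intro cSup_upper bdd imageI)
    then show ?thesis unfolding m_def .
  qed
  have "s - inverse (real (Suc k)) \<le> prob (\<Union>n. W n)" for k
  proof -
    have "(\<Union>n. S k n) \<subseteq> (\<Union>n. W n)"
    proof (rule UN_least)
      fix n show "S k n \<subseteq> (\<Union>n. W n)"
        using UN_upper[of "prod_encode (k, n)" UNIV W] by (simp add: W_def)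
    qed
    then have "m (S k) \<le> prob (\<Union>n. W n)"
      unfolding m_def using Wm by (intro finite_measure_mono) auto
    then show ?thesis using S(2)[of k] by simp
  qed
  then have "s - prob (\<Union>n. W n) \<le> inverse (real (Suc k))" for k
    by (simp add: algebra_simps)
  then have sW: "s \<le> prob (\<Union>n. W n)"
    using LIMSEQ_le_const[OF LIMSEQ_inverse_real_of_nat, of "s - prob (\<Union>n. W n)"] by simp
  have "prob (U - (\<Union>n. W n)) = 0" if "U \<in> \<U>" for U
  proof -
    \<comment> \<open>\<open>U\<close> is put in front of the sequence \<open>W\<close>, which gives
      a competitor for the supremum.\<close>
    define T where "T n = (case n :: nat of 0 \<Rightarrow> U | Suc k \<Rightarrow> W k)" for n
    have "T n \<in> \<U>" for n unfolding T_def using that WU by (cases n) auto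
    then have "prob (\<Union>n. T n) \<le> s" by (rule le)
    moreover have "(U - (\<Union>n. W n)) \<union> (\<Union>n. W n) \<subseteq> (\<Union>n. T n)"
    proof
      fix x assume "x \<in> (U - (\<Union>n. W n)) \<union> (\<Union>n. W n)"
      then consider "x \<in> U" | k where "x \<in> W k" by auto
      then show "x \<in> (\<Union>n. T n)"
      proof cases
        case 1 then show ?thesis by (intro UN_I[of 0]) (simp_all add: T_def)
      next
        case 2 then show ?thesis by (intro UN_I[of "Suc k"]) (simp_all add: T_def)
      qed
    qed
    then have "prob ((U - (\<Union>n. W n)) \<union> (\<Union>n. W n)) \<le> prob (\<Union>n. T n)"
      using \<open>\<And>n. T n \<in> \<U>\<close> U(1) by (intro finite_measure_mono) auto
    moreover have "prob ((U - (\<Union>n. W n)) \<union> (\<Union>n. W n)) = prob (U - (\<Union>n. W n)) + prob (\<Union>n. W n)"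
      using that U(1) Wm by (intro finite_measure_Union) auto
    ultimately have "prob (U - (\<Union>n. W n)) \<le> 0" using sW by simp
    then show ?thesis by (simp add: measure_le_0_iff)
  qed
  with WU show ?thesis by (rule that)
qed

section \<open>Coordinates on atomless standard spaces\<close>

text \<open>With digits 0 and 1 in base 3 the tail behind position \<open>i\<close> is at most half
  of the term at \<open>i\<close>, so the first differing digit decides. In base 2 the tail could
  make up for it.\<close>

lemma ternary_series_less:
  fixes a b :: "nat \<Rightarrow> bool"
  assumes eq: "\<And>j. j < i \<Longrightarrow> a j = b j" and i: "\<not> a i" "b i"
  shows "(\<Sum>j. of_bool (a j) * (1/3) ^ Suc j) < (\<Sum>j. of_bool (b j) * (1/3::real) ^ Suc j)"
proof -
  have geo: "summable (\<lambda>j. (1/3::real) ^ Suc j)" by (simp add: summable_geometric)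
  have sm: "summable (\<lambda>j. of_bool (c j) * (1/3::real) ^ Suc j)" for c
    by (rule summable_comparison_test[OF _ geo]) auto
  let ?f = "\<lambda>c j. of_bool (c j) * (1/3::real) ^ Suc j"
  have split: "(\<Sum>j. ?f c j) = (\<Sum>j. ?f c (j + Suc i)) + (\<Sum>j<Suc i. ?f c j)" for c
    by (rule suminf_split_initial_segment[OF sm])
  have "(\<Sum>j. ?f a (j + Suc i)) \<le> (\<Sum>j. (1/3::real) ^ Suc (Suc i) * (1/3) ^ j)"
  proof (rule suminf_le)
    show "?f a (j + Suc i) \<le> (1/3) ^ Suc (Suc i) * (1/3) ^ j" for j
      by (simp add: power_add)
    show "summable (\<lambda>j. ?f a (j + Suc i))" by (rule summable_ignore_initial_segment[OF sm])
    show "summable (\<lambda>j. (1/3::real) ^ Suc (Suc i) * (1/3) ^ j)"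
      by (intro summable_mult summable_geometric) simp
  qed
  also have "\<dots> = (1/3) ^ Suc (Suc i) * (3/2)"
    by (subst suminf_mult) (simp_all add: suminf_geometric summable_geometric)
  also have "\<dots> < (1/3) ^ Suc i" by simp
  finally have "(\<Sum>j. ?f a (j + Suc i)) < (1/3) ^ Suc i" .
  moreover have "(\<Sum>j<Suc i. ?f b j) = (\<Sum>j<Suc i. ?f a j) + (1/3) ^ Suc i"
    using eq i by simp
  moreover have "0 \<le> (\<Sum>j. ?f b (j + Suc i))"
    by (rule suminf_nonneg[OF summable_ignore_initial_segment[OF sm]]) simp
  ultimately show ?thesis unfolding split by simp
qed

lemma ternary_series_bounds:
  "0 \<le> (\<Sum>j. of_bool (a j) * (1/3::real) ^ Suc j)" "(\<Sum>j. of_bool (a j) * (1/3::real) ^ Suc j) \<le> 1/2"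
proof -
  have geo: "summable (\<lambda>j. (1/3::real) ^ Suc j)" by (simp add: summable_geometric)
  have sm: "summable (\<lambda>j. of_bool (a j) * (1/3::real) ^ Suc j)"
    by (rule summable_comparison_test[OF _ geo]) auto
  show "0 \<le> (\<Sum>j. of_bool (a j) * (1/3::real) ^ Suc j)" using sm by (rule suminf_nonneg) simp
  have "(\<Sum>j. of_bool (a j) * (1/3::real) ^ Suc j) \<le> (\<Sum>j. (1/3::real) ^ Suc j)"
    by (rule suminf_le[OF _ sm geo]) simp
  also have "\<dots> = (\<Sum>j. (1/3) * (1/3::real) ^ j)" by simp
  also have "\<dots> = 1/2"
    by (subst suminf_mult) (simp_all add: suminf_geometric summable_geometric)
  finally show "(\<Sum>j. of_bool (a j) * (1/3::real) ^ Suc j) \<le> 1/2" .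
qed

text \<open>\<open>u\<close> encodes membership in the separating sets as ternary digits and
  determines the point. The integer \<open>k\<close>, the index of the first finite measure set that
  contains the point, makes all sublevel sets finite in measure.\<close>

lemma injective_coordinate:
  assumes "standard_sigma_finite_space M"
  obtains v :: "'a \<Rightarrow> real" where "v \<in> borel_measurable M" "inj_on v (space M)" "\<And>x. 0 \<le> v x"
    "\<And>r. emeasure M {x \<in> space M. v x \<le> r} < \<infinity>"
proof -
  have sb: "standard_borel M" and "sigma_finite_measure M"
    using assms unfolding standard_sigma_finite_space_def by auto
  interpret sigma_finite_measure M by fact
  obtain A where A: "separating_sets M A" by (rule standard_borel_separating_sets[OF sb])
  have Am[measurable]: "A i \<in> sets M" for i using A unfolding separating_sets_def by simp
  obtain W :: "nat \<Rightarrow> 'a set" where W: "range W \<subseteq> sets M" "(\<Union>i. W i) = space M"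
    "\<And>i. emeasure M (W i) \<noteq> \<infinity>" using sigma_finite by metis
  have Wm[measurable]: "W i \<in> sets M" for i using W(1) by auto
  define u where "u x = (\<Sum>j. of_bool (x \<in> A j) * (1/3::real) ^ Suc j)" for x
  define k where "k x = (LEAST i. x \<in> W i)" for x
  define v where "v x = real (k x) + u x" for x
  have u01: "0 \<le> u x" "u x \<le> 1/2" for x
    unfolding u_def by (rule ternary_series_bounds)+
  have um: "u \<in> borel_measurable M"
    unfolding u_def of_bool_def by measurable
  have km: "k \<in> measurable M (count_space UNIV)"
    unfolding k_def by measurable
  have u_neq: "u x \<noteq> u y" if xy: "x \<in> space M" "y \<in> space M" "x \<noteq> y" for x y
  proof -
    have "\<exists>i. (x \<in> A i) \<noteq> (y \<in> A i)"
      using A xy unfolding separating_sets_def by metis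
    define i where "i = (LEAST i. (x \<in> A i) \<noteq> (y \<in> A i))"
    have i: "(x \<in> A i) \<noteq> (y \<in> A i)"
      unfolding i_def by (rule LeastI_ex) fact
    have lt: "(x \<in> A j) = (y \<in> A j)" if "j < i" for j
      using not_less_Least[of j "\<lambda>i. (x \<in> A i) \<noteq> (y \<in> A i)"] that unfolding i_def by simp
    show ?thesis
    proof (cases "x \<in> A i")
      case True
      have "u y < u x" unfolding u_def
        by (rule ternary_series_less[of i "\<lambda>j. y \<in> A j" "\<lambda>j. x \<in> A j"]) (use i True lt in auto)
      then show ?thesis by simp
    next
      case False
      have "u x < u y" unfolding u_def
        by (rule ternary_series_less[of i "\<lambda>j. x \<in> A j" "\<lambda>j. y \<in> A j"]) (use i False lt in auto)
      then show ?thesis by simp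
    qed
  qed
  show ?thesis
  proof
    show "v \<in> borel_measurable M" unfolding v_def using um km by measurable
    show "0 \<le> v x" for x unfolding v_def using u01 by (simp add: add_nonneg_nonneg)
    show "inj_on v (space M)"
    proof (rule inj_onI, rule ccontr)
      fix x y assume xy: "x \<in> space M" "y \<in> space M" "v x = v y" "x \<noteq> y"
      \<comment> \<open>\<open>u\<close> takes values between 0 and 1/2, so equal sums force equal
        integer parts.\<close>
      have "\<bar>real (k x) - real (k y)\<bar> < 1"
        using xy(3) u01[of x] u01[of y] unfolding v_def by arith
      then have "k x = k y" by arith
      then have "u x = u y" using xy(3) unfolding v_def by simp
      then show False using u_neq[OF xy(1,2,4)] by simp
    qed
    fix r
    have "{x \<in> space M. v x \<le> r} \<subseteq> (\<Union>i\<le>nat \<lceil>r\<rceil>. W i)"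
    proof
      fix x assume x: "x \<in> {x \<in> space M. v x \<le> r}"
      then have "real (k x) \<le> r" using u01(1)[of x] unfolding v_def by simp
      then have "k x \<le> nat \<lceil>r\<rceil>" by linarith
      moreover have "\<exists>i. x \<in> W i" using x W(2) by auto
      then have "x \<in> W (k x)" unfolding k_def by (rule LeastI_ex)
      ultimately show "x \<in> (\<Union>i\<le>nat \<lceil>r\<rceil>. W i)" by auto
    qed
    then have "emeasure M {x \<in> space M. v x \<le> r} \<le> emeasure M (\<Union>i\<le>nat \<lceil>r\<rceil>. W i)"
      by (intro emeasure_mono) auto
    also have "\<dots> \<le> (\<Sum>i\<le>nat \<lceil>r\<rceil>. emeasure M (W i))"
      by (rule emeasure_subadditive_finite) auto
    also have "\<dots> < \<infinity>" using W(3) by (simp add: less_top)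
    finally show "emeasure M {x \<in> space M. v x \<le> r} < \<infinity>" .
  qed
qed

lemma atomless_singleton_null:
  assumes "atomless M" "{x} \<in> sets M"
  shows "emeasure M {x} = 0"
proof (rule ccontr)
  assume "emeasure M {x} \<noteq> 0"
  then have "0 < emeasure M {x}" by (simp add: zero_less_iff_neq_zero)
  then obtain B where B: "B \<subseteq> {x}" "0 < emeasure M B" "emeasure M B < emeasure M {x}"
    using assms unfolding atomless_def by metis
  then have "B = {} \<or> B = {x}" by auto
  then show False using B by auto
qed

lemma atomless_level_null:
  fixes v :: "'a \<Rightarrow> real"
  assumes M: "atomless M" and v: "v \<in> borel_measurable M" "inj_on v (space M)"
  shows "{x \<in> space M. v x = r} \<in> null_sets M"
proof -
  have meas: "{x \<in> space M. v x = r} \<in> sets M" using v(1) by measurable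
  show ?thesis
  proof (cases "{x \<in> space M. v x = r} = {}")
    case False
    then obtain x where x: "x \<in> space M" "v x = r" by auto
    have "y = x" if "y \<in> space M" "v y = r" for y
      using inj_onD[OF v(2) _ that(1) x(1)] x(2) that(2) by simp
    then have "{x \<in> space M. v x = r} \<subseteq> {x}" by (simp add: subset_iff)
    moreover have "{x} \<subseteq> {x \<in> space M. v x = r}" using x by simp
    ultimately have eq: "{x \<in> space M. v x = r} = {x}" by (rule equalityI)
    show ?thesis
      using atomless_singleton_null[OF M, of x] meas unfolding eq by (simp add: null_sets_def)
  qed (simp only: null_sets.empty_sets)
qed

text \<open>Since single levels of \<open>v\<close> are null, the distribution function of
  \<open>v\<close> on \<open>D\<close> is continuous, and the intermediate value theorem finds the
  cut.\<close>

lemma exists_cut: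
  fixes v :: "'a \<Rightarrow> real"
  assumes M: "atomless M" and v[measurable]: "v \<in> borel_measurable M" and inj: "inj_on v (space M)" and v0: "\<And>x. 0 \<le> v x"
    and fin: "\<And>r. emeasure M {x \<in> space M. v x \<le> r} < \<infinity>"
    and D[measurable]: "D \<in> sets M" and a: "0 \<le> a" "ennreal a < emeasure M D"
  obtains r where "emeasure M {x \<in> D. v x \<le> r} = ennreal a"
proof -
  have Ds: "D \<subseteq> space M" using sets.sets_into_space[OF D] .
  have meas: "{x \<in> D. v x \<le> r} \<in> sets M" for r
  proof -
    have "{x \<in> D. v x \<le> r} = D \<inter> {x \<in> space M. v x \<le> r}" using Ds by auto
    then show ?thesis by simp
  qed
  have fin': "emeasure M {x \<in> D. v x \<le> r} < \<infinity>" for r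
  proof -
    have "emeasure M {x \<in> D. v x \<le> r} \<le> emeasure M {x \<in> space M. v x \<le> r}"
      using Ds by (intro emeasure_mono) auto
    then show ?thesis using fin[of r] by (rule le_less_trans)
  qed
  have "(\<lambda>n::nat. emeasure M {x \<in> D. v x \<le> real n}) \<longlonglongrightarrow> emeasure M (\<Union>n::nat. {x \<in> D. v x \<le> real n})"
    by (rule Lim_emeasure_incseq) (use meas in \<open>auto simp: incseq_def\<close>)
  moreover have "(\<Union>n::nat. {x \<in> D. v x \<le> real n}) = D"
    using real_arch_simple by blast
  ultimately have "(\<lambda>n::nat. emeasure M {x \<in> D. v x \<le> real n}) \<longlonglongrightarrow> emeasure M D" by simp
  from order_tendstoD(1)[OF this a(2)]
  obtain n :: nat where n: "ennreal a < emeasure M {x \<in> D. v x \<le> real n}"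
    by (auto simp: eventually_sequentially)
  \<comment> \<open>\<open>D\<close> may have infinite measure; truncation at a high level of
    \<open>v\<close> leaves a finite measure that still exceeds \<open>a\<close>, so that the theory
    of distribution functions applies.\<close>
  define E where "E = {x \<in> D. v x \<le> real n}"
  have E[measurable]: "E \<in> sets M" unfolding E_def by (rule meas)
  define N where "N = distr (restrict_space M E) borel v"
  have vE: "v \<in> borel_measurable (restrict_space M E)" by (rule measurable_restrict_space1[OF v])
  have N: "emeasure N B = emeasure M {x \<in> E. v x \<in> B}" if "B \<in> sets borel" for B
  proof -
    have "v -` B \<inter> space (restrict_space M E) = {x \<in> E. v x \<in> B}"
      using sets.sets_into_space[OF E] by (auto simp: space_restrict_space)
    then have "emeasure N B = emeasure (restrict_space M E) {x \<in> E. v x \<in> B}"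
      unfolding N_def by (simp add: emeasure_distr[OF vE that])
    also have "\<dots> = emeasure M {x \<in> E. v x \<in> B}"
      by (rule emeasure_restrict_space) (use E in \<open>auto simp: sets.Int_space_eq2\<close>)
    finally show ?thesis .
  qed
  have NE: "emeasure N (space N) = emeasure M E" using N[of UNIV] by (simp add: N_def)
  have "emeasure N (space N) \<noteq> \<infinity>"
    unfolding NE using fin'[of "real n"] unfolding E_def by simp
  then interpret N0: finite_measure N by (rule finite_measureI)
  interpret N: finite_borel_measure N
    by unfold_locales (simp add: N_def)
  have cont: "isCont (cdf N) x" for x
  proof -
    have "emeasure N {x} = emeasure M {y \<in> E. v y = x}" using N[of "{x}"] by simp
    also have "\<dots> \<le> emeasure M {y \<in> space M. v y = x}"
      using sets.sets_into_space[OF E] by (intro emeasure_mono) auto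
    also have "\<dots> = 0" using atomless_level_null[OF M v inj] by auto
    finally show ?thesis by (simp add: N.isCont_cdf measure_def)
  qed
  have cdf: "cdf N r = measure M {x \<in> E. v x \<le> r}" for r
    unfolding cdf_def measure_def using N[of "{..r}"] by simp
  \<comment> \<open>As \<open>v\<close> is nonnegative, the level -1 is a starting point at which
    the distribution function vanishes.\<close>
  have e0: "{x \<in> E. v x \<le> -1} = {}" using v0 by (auto simp: not_le intro: less_le_trans[of _ 0])
  have c0: "cdf N (-1) = 0" unfolding cdf e0 by simp
  have "{x \<in> E. v x \<le> real n} = E" unfolding E_def by auto
  then have "cdf N (real n) = measure M E" unfolding cdf by simp
  moreover have "a \<le> measure M E"
    using n a(1) fin'[of "real n"] unfolding E_def[symmetric] measure_def
    by (metis enn2real_ennreal enn2real_mono infinity_ennreal_def less_imp_le)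
  ultimately have cn: "a \<le> cdf N (real n)" by simp
  obtain r where r: "r \<le> real n" "cdf N r = a"
    using IVT[of "cdf N" "-1" a "real n"] c0 a(1) cn cont by auto
  have "{x \<in> E. v x \<le> r} = {x \<in> D. v x \<le> r}" using r(1) unfolding E_def by auto
  then have "measure M {x \<in> D. v x \<le> r} = a" using r(2) unfolding cdf by simp
  then have "emeasure M {x \<in> D. v x \<le> r} = ennreal a"
    using fin'[of r] by (metis emeasure_eq_ennreal_measure infinity_ennreal_def less_irrefl)
  then show ?thesis by (rule that)
qed

section \<open>Ergodic orbit full groups\<close>

locale ergodic_full_group = L0_space M \<mu> \<tau> d
  for M \<mu> :: "'a measure" and \<tau> :: "'g topology" and d :: "'g \<Rightarrow> 'g \<Rightarrow> real" +
  fixes G :: "'g monoid" and \<phi> :: "'g \<Rightarrow> 'a \<Rightarrow> 'a"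
  assumes std: "standard_sigma_finite_space M"
    and polish_G: "polish_group G \<tau>"
    and action: "borel_action G \<tau> M \<phi>"
    and erg: "ergodic M (carrier (orbit_full_group G M \<phi>))"
begin

sublocale act: group_action G "space M" \<phi>
  using action unfolding borel_action_def by simp

sublocale Gr: group G
  using polish_G unfolding polish_group_def topological_group_on_def by simp

sublocale sf: sigma_finite_measure M
  using std unfolding standard_sigma_finite_space_def by simp

lemma topspace_tau: "topspace \<tau> = carrier G"
  using polish_G unfolding polish_group_def topological_group_on_def by simp

lemma mult_continuous: "continuous_map (prod_topology \<tau> \<tau>) \<tau> (\<lambda>(g, h). g \<otimes>\<^bsub>G\<^esub> h)"
  using polish_G unfolding polish_group_def topological_group_on_def by simp

lemma mult_measurable:
  assumes "f \<in> measurable N (borel_of \<tau>)" "g \<in> measurable N (borel_of \<tau>)"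
  shows "(\<lambda>x. f x \<otimes>\<^bsub>G\<^esub> g x) \<in> measurable N (borel_of \<tau>)"
  by (rule measurable_continuous_pair[OF second_countable second_countable mult_continuous assms])

lemma act_measurable:
  assumes "f \<in> measurable N (borel_of \<tau>)" "T \<in> measurable N M"
  shows "(\<lambda>x. \<phi> (f x) (T x)) \<in> measurable N M"
proof -
  have "(\<lambda>(g, x). \<phi> g x) \<in> measurable (borel_of \<tau> \<Otimes>\<^sub>M M) M"
    using action unfolding borel_action_def by simp
  from measurable_compose[OF measurable_Pair[OF assms] this] show ?thesis by simp
qed

text \<open>Pointwise representatives of the orbit full group. Constructions are carried out with
  these, and classes are taken at the end.\<close>

definition full_maps :: "('a \<Rightarrow> 'a) set" where
  "full_maps = {T \<in> mp_bijections M. AE x in M. T x \<in> orbit G \<phi> x}"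

lemma full_mapsD: "T \<in> full_maps \<Longrightarrow> T \<in> mp_bijections M" "T \<in> full_maps \<Longrightarrow> AE x in M. T x \<in> orbit G \<phi> x"
  unfolding full_maps_def by auto

lemma full_maps_id: "id \<in> full_maps"
  unfolding full_maps_def using mp_bijections_id act.orbit_refl by (auto intro: AE_I2)

lemma full_maps_comp:
  assumes T: "T \<in> full_maps" and S: "S \<in> full_maps"
  shows "T \<circ> S \<in> full_maps"
proof -
  note mT = full_mapsD(1)[OF T] and mS = full_mapsD(1)[OF S]
  have "AE x in M. T (S x) \<in> orbit G \<phi> (S x)"
    by (rule AE_mp_bijection[OF mS full_mapsD(2)[OF T]])
  with full_mapsD(2)[OF S] AE_space have "AE x in M. (T \<circ> S) x \<in> orbit G \<phi> x"
  proof eventually_elim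
    case (elim x)
    then show ?case
      using act.orbit_trans[of x "S x" "T (S x)"] mp_bijectionsD(8)[OF mS] mp_bijectionsD(8)[OF mT] by simp
  qed
  then show ?thesis unfolding full_maps_def using mp_bijections_comp[OF mT mS] by simp
qed

lemma full_maps_inv_into:
  assumes T: "T \<in> full_maps"
  shows "inv_into (space M) T \<in> full_maps"
proof -
  note mT = full_mapsD(1)[OF T]
  have "AE x in M. T (inv_into (space M) T x) \<in> orbit G \<phi> (inv_into (space M) T x)"
    by (rule AE_mp_bijection[OF mp_bijections_inv_into[OF mT] full_mapsD(2)[OF T]])
  with AE_space have "AE x in M. inv_into (space M) T x \<in> orbit G \<phi> x"
  proof eventually_elim
    case (elim x)
    then show ?case
      using act.orbit_sym[of "inv_into (space M) T x" x] mp_bijections_inv_into_cancel[OF mT] by simp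
  qed
  then show ?thesis unfolding full_maps_def using mp_bijections_inv_into[OF mT] by simp
qed

text \<open>The defining flexibility of full groups: a bijection glued from countably many of their
  elements is again an element.\<close>

lemma full_maps_piecewise:
  fixes P :: "'i::countable \<Rightarrow> 'a set"
  assumes V: "bij_betw V (space M) (space M)"
    and Q: "\<And>i. Q i \<in> full_maps"
    and P: "\<And>i. P i \<in> sets M" "\<And>x. x \<in> space M \<Longrightarrow> \<exists>i. x \<in> P i"
    and VQ: "\<And>i x. x \<in> P i \<Longrightarrow> x \<in> space M \<Longrightarrow> V x = Q i x"
  shows "V \<in> full_maps"
proof -
  have "mp_injection M V"
    by (rule mp_injection_piecewise_countable[OF _ _ P VQ])
      (use V Q in \<open>auto simp: bij_betw_def dest: full_mapsD\<close>)
  then have "V \<in> mp_bijections M"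
    using V by (intro mp_injection_surj) (auto simp: bij_betw_def)
  moreover have "AE x in M. \<forall>i. Q i x \<in> orbit G \<phi> x"
    unfolding AE_all_countable using full_mapsD(2)[OF Q] by simp
  with AE_space have "AE x in M. V x \<in> orbit G \<phi> x"
  proof eventually_elim
    case (elim x)
    then show ?case using P(2) VQ by metis
  qed
  ultimately show ?thesis unfolding full_maps_def by simp
qed

lemma orbit_full_setI: "T \<in> full_maps \<Longrightarrow> aut_class M T \<in> orbit_full_set G M \<phi>"
proof -
  assume T: "T \<in> full_maps"
  have "AE x in M. S x \<in> orbit G \<phi> x" if "S \<in> aut_class M T" for S
    using full_mapsD(2)[OF T] aut_classD(2)[OF that] by eventually_elim simp
  then show ?thesis
    unfolding orbit_full_set_def using aut_class_in_Aut[OF full_mapsD(1)[OF T]] by simp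
qed

lemma orbit_full_setD:
  assumes "C \<in> orbit_full_set G M \<phi>" "T \<in> C"
  shows "T \<in> full_maps" "C = aut_class M T"
  using assms Aut_carrierD[of C M T] unfolding orbit_full_set_def full_maps_def by auto

lemma orbit_full_setE:
  assumes "C \<in> orbit_full_set G M \<phi>"
  obtains T where "T \<in> full_maps" "C = aut_class M T"
proof -
  obtain S where S: "S \<in> mp_bijections M" "C = aut_class M S"
    using assms unfolding orbit_full_set_def Aut_def by auto
  then have "S \<in> C" using mem_aut_class by simp
  from orbit_full_setD[OF assms this] show ?thesis by (rule that)
qed

lemma carrier_orbit_full_group: "carrier (orbit_full_group G M \<phi>) = orbit_full_set G M \<phi>"
  unfolding orbit_full_group_def by simp

lemma orbit_full_group_mult:
  assumes "T \<in> full_maps" "S \<in> full_maps"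
  shows "aut_class M T \<otimes>\<^bsub>orbit_full_group G M \<phi>\<^esub> aut_class M S = aut_class M (T \<circ> S)"
  using Aut_mult[OF full_mapsD(1)[OF assms(1)] full_mapsD(1)[OF assms(2)]]
  unfolding orbit_full_group_def by simp

lemma orbit_full_group_one: "\<one>\<^bsub>orbit_full_group G M \<phi>\<^esub> = aut_class M id"
  unfolding orbit_full_group_def Aut_def by simp

text \<open>The essential union \<open>E\<close> of the images of \<open>A\<close> under full maps
  is invariant and not null, hence conull by ergodicity. Thus countably many images of
  \<open>A\<close> cover almost all of \<open>B\<close>, and one of them meets \<open>B\<close> in
  positive measure.\<close>

lemma moves_into:
  assumes A: "A \<in> sets M" "0 < emeasure M A" and B: "B \<in> sets M" "0 < emeasure M B"
  obtains T where "T \<in> full_maps" "0 < emeasure M {x \<in> A. T x \<in> B}"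
proof -
  define \<U> where "\<U> = (\<lambda>T. T ` A) ` full_maps"
  have "\<U> \<subseteq> events"
    unfolding \<U>_def sets_mu using mp_bijectionsD(4)[OF full_mapsD(1) A(1)] by auto
  moreover have "\<U> \<noteq> {}" unfolding \<U>_def using full_maps_id by auto
  ultimately obtain W :: "nat \<Rightarrow> 'a set" where W: "\<And>n. W n \<in> \<U>" "\<And>U. U \<in> \<U> \<Longrightarrow> prob (U - (\<Union>n. W n)) = 0"
    using essential_union[of \<U>] by metis
  have "\<exists>T\<in>full_maps. W n = T ` A" for n using W(1)[of n] unfolding \<U>_def by auto
  then obtain S where S: "\<And>n. S n \<in> full_maps" "\<And>n. W n = S n ` A" by metis
  define E where "E = (\<Union>n. W n)"
  have Wm: "W n \<in> sets M" for n
    unfolding S(2) by (rule mp_bijectionsD(4)[OF full_mapsD(1)[OF S(1)] A(1)])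
  then have E: "E \<in> sets M" unfolding E_def by auto
  have null: "T ` A - E \<in> null_sets M" if "T \<in> full_maps" for T
  proof -
    have "T ` A \<in> \<U>" unfolding \<U>_def using that by simp
    then have "prob (T ` A - E) = 0" unfolding E_def by (rule W(2))
    moreover have "T ` A - E \<in> events"
      using mp_bijectionsD(4)[OF full_mapsD(1)[OF that] A(1)] E unfolding sets_mu by auto
    ultimately have "T ` A - E \<in> null_sets \<mu>" by (simp add: null_sets_def emeasure_eq_measure)
    then show ?thesis unfolding null_sets_mu .
  qed
  \<comment> \<open>Images of the sets in the union under \<open>T\<close> are themselves images of
    \<open>A\<close> under full maps, hence almost contained in \<open>E\<close>.\<close>
  have null': "T ` E - E \<in> null_sets M" if "T \<in> full_maps" for T
  proof -
    have "T ` E - E = (\<Union>n. (T \<circ> S n) ` A - E)" unfolding E_def S(2) by auto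
    moreover have "(T \<circ> S n) ` A - E \<in> null_sets M" for n
      by (rule null[OF full_maps_comp[OF that S(1)]])
    ultimately show ?thesis by (metis null_sets_UN)
  qed
  \<comment> \<open>The other half of the symmetric difference is the image under \<open>T\<close>
    of what the inverse of \<open>T\<close> moves out of \<open>E\<close>, so the one-sided
    inclusion for the inverse settles it.\<close>
  have inv: "emeasure M (sym_diff (T ` E) E) = 0" if T: "T \<in> full_maps" for T
  proof -
    let ?R = "inv_into (space M) T"
    note mT = full_mapsD(1)[OF T]
    have Es: "E \<subseteq> space M" using sets.sets_into_space[OF E] .
    have "T ` (?R ` E - E) = E - T ` E"
    proof
      show "T ` (?R ` E - E) \<subseteq> E - T ` E"
      proof
        fix y assume "y \<in> T ` (?R ` E - E)"
        then obtain e where e: "e \<in> E" "?R e \<notin> E" "y = T (?R e)" by auto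
        then have y: "y = e" using mp_bijections_inv_into_cancel(2)[OF mT] Es by auto
        have "y \<notin> T ` E"
          using e(2) y Es mp_bijections_inv_into_cancel(1)[OF mT] by auto
        then show "y \<in> E - T ` E" using e(1) y by simp
      qed
      show "E - T ` E \<subseteq> T ` (?R ` E - E)"
      proof
        fix y assume y: "y \<in> E - T ` E"
        then have "T (?R y) = y" using mp_bijections_inv_into_cancel(2)[OF mT] Es by auto
        then have "?R y \<notin> E" using y by (metis DiffD2 imageI)
        then show "y \<in> T ` (?R ` E - E)"
          using y \<open>T (?R y) = y\<close> by (intro image_eqI[of _ _ "?R y"]) auto
      qed
    qed
    moreover have "?R ` E - E \<in> null_sets M" by (rule null'[OF full_maps_inv_into[OF T]])
    ultimately have "E - T ` E \<in> null_sets M"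
      using mp_bijectionsD(4,6)[OF mT] by (metis null_setsD1 null_setsD2 null_setsI)
    with null'[OF T] have "(T ` E - E) \<union> (E - T ` E) \<in> null_sets M" by (rule null_sets.Un)
    then show ?thesis by (rule null_setsD1)
  qed
  have "\<forall>C\<in>carrier (orbit_full_group G M \<phi>). \<forall>T\<in>C. emeasure M (sym_diff (T ` E) E) = 0"
    unfolding carrier_orbit_full_group using inv orbit_full_setD(1) by simp
  then have alt: "E \<in> null_sets M \<or> space M - E \<in> null_sets M"
    using erg E unfolding ergodic_def by simp
  have "W 0 \<subseteq> E" unfolding E_def by auto
  have "emeasure M (W 0) = emeasure M A"
    unfolding S(2) by (rule mp_bijectionsD(6)[OF full_mapsD(1)[OF S(1)] A(1)])
  then have "0 < emeasure M E"
    using A(2) emeasure_mono[OF \<open>W 0 \<subseteq> E\<close> E] by simp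
  then have co: "space M - E \<in> null_sets M" using alt by auto
  have "\<exists>n. 0 < emeasure M {x \<in> A. S n x \<in> B}"
  proof (rule ccontr)
    assume "\<not> ?thesis"
    then have z: "emeasure M {x \<in> A. S n x \<in> B} = 0" for n by (simp add: zero_less_iff_neq_zero)
    have "W n \<inter> B \<in> null_sets M" for n
    proof -
      have eq: "S n ` {x \<in> A. S n x \<in> B} = W n \<inter> B" unfolding S(2) by auto
      have "{x \<in> A. S n x \<in> B} = A \<inter> (S n -` B \<inter> space M)"
        using sets.sets_into_space[OF A(1)] by auto
      then have m: "{x \<in> A. S n x \<in> B} \<in> sets M"
        using A(1) mp_bijectionsD(5)[OF full_mapsD(1)[OF S(1)] B(1)] by simp
      show ?thesis
        using mp_bijectionsD(4,6)[OF full_mapsD(1)[OF S(1)[of n]] m] z unfolding eq by auto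
    qed
    then have "(\<Union>n. W n \<inter> B) \<in> null_sets M" by (rule null_sets_UN)
    with co have "(space M - E) \<union> (\<Union>n. W n \<inter> B) \<in> null_sets M" by (rule null_sets.Un)
    moreover have "B \<subseteq> (space M - E) \<union> (\<Union>n. W n \<inter> B)"
      unfolding E_def using sets.sets_into_space[OF B(1)] by auto
    ultimately have "B \<in> null_sets M" using B(1) null_sets_subset by metis
    then show False using B(2) by auto
  qed
  then show ?thesis using S(1) that by auto
qed

text \<open>A partial isomorphism from \<open>A\<close> to \<open>B\<close>, recorded as pairs of a
  piece and a full map that carries it. Positive measure of the pieces keeps such families
  countable.\<close>

definition exchange_family :: "'a set \<Rightarrow> 'a set \<Rightarrow> ('a set \<times> ('a \<Rightarrow> 'a)) set \<Rightarrow> bool" where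
  "exchange_family A B \<C> \<longleftrightarrow>
     (\<forall>p\<in>\<C>. fst p \<in> sets M \<and> fst p \<subseteq> A \<and> 0 < emeasure M (fst p) \<and> snd p \<in> full_maps \<and> snd p ` fst p \<subseteq> B) \<and>
     (\<forall>p\<in>\<C>. \<forall>q\<in>\<C>. p \<noteq> q \<longrightarrow> fst p \<inter> fst q = {} \<and> snd p ` fst p \<inter> snd q ` fst q = {})"

lemma exchange_familyD:
  assumes "exchange_family A B \<C>" "p \<in> \<C>"
  shows "fst p \<in> sets M" "fst p \<subseteq> A" "0 < emeasure M (fst p)" "snd p \<in> full_maps" "snd p ` fst p \<subseteq> B"
    and "q \<in> \<C> \<Longrightarrow> x \<in> fst p \<Longrightarrow> x \<in> fst q \<Longrightarrow> p = q"
    and "q \<in> \<C> \<Longrightarrow> x \<in> snd p ` fst p \<Longrightarrow> x \<in> snd q ` fst q \<Longrightarrow> p = q"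
  using assms(1)[unfolded exchange_family_def] assms(2) by (simp_all add: disjoint_iff) metis+

lemma exchange_family_maximal:
  obtains \<C> where "exchange_family A B \<C>"
    "\<And>\<D>. exchange_family A B \<D> \<Longrightarrow> \<C> \<subseteq> \<D> \<Longrightarrow> \<D> = \<C>"
proof -
  have "\<exists>\<C>\<in>Collect (exchange_family A B). \<forall>\<D>\<in>Collect (exchange_family A B). \<C> \<subseteq> \<D> \<longrightarrow> \<D> = \<C>"
  proof (rule subset_Zorn')
    fix \<K> assume K: "subset.chain (Collect (exchange_family A B)) \<K>"
    have fam: "exchange_family A B \<C>" if "\<C> \<in> \<K>" for \<C>
      using K that unfolding subset_chain_def by auto
    have common: "\<exists>\<C>\<in>\<K>. p \<in> \<C> \<and> q \<in> \<C>" if pq: "p \<in> \<Union>\<K>" "q \<in> \<Union>\<K>" for p q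
    proof -
      obtain \<C> where C: "\<C> \<in> \<K>" "p \<in> \<C>" using pq(1) by auto
      obtain \<D> where D: "\<D> \<in> \<K>" "q \<in> \<D>" using pq(2) by auto
      have "\<C> \<subseteq> \<D> \<or> \<D> \<subseteq> \<C>" using K C(1) D(1) unfolding subset_chain_def by simp
      then show ?thesis using C D by (metis subsetD)
    qed
    have "exchange_family A B (\<Union>\<K>)"
      unfolding exchange_family_def
    proof (intro conjI ballI impI)
      fix p assume "p \<in> \<Union>\<K>"
      then obtain \<C> where C: "p \<in> \<C>" "\<C> \<in> \<K>" by blast
      note D = exchange_familyD[OF fam[OF C(2)] C(1)]
      show "fst p \<in> sets M" "fst p \<subseteq> A" "0 < emeasure M (fst p)" "snd p \<in> full_maps" "snd p ` fst p \<subseteq> B"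
        by (fact D)+
    next
      fix p q assume pq: "p \<in> \<Union>\<K>" "q \<in> \<Union>\<K>" "p \<noteq> q"
      from common[OF pq(1,2)] obtain \<C> where C: "\<C> \<in> \<K>" "p \<in> \<C>" "q \<in> \<C>" by blast
      note D = exchange_familyD(6,7)[OF fam[OF C(1)] C(2,3)]
      show "fst p \<inter> fst q = {}" using D(1) pq(3) unfolding disjoint_iff by metis
      show "snd p ` fst p \<inter> snd q ` fst q = {}" using D(2) pq(3) unfolding disjoint_iff by metis
    qed
    then show "\<Union>\<K> \<in> Collect (exchange_family A B)" by simp
  qed
  then obtain \<C> where "exchange_family A B \<C>" "\<forall>\<D>\<in>Collect (exchange_family A B). \<C> \<subseteq> \<D> \<longrightarrow> \<D> = \<C>"
    by auto
  then show ?thesis using that by simp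
qed

text \<open>Finite sums of the measures of the disjoint pieces are bounded by the finite measure of
  \<open>A\<close>, so the measures are summable and only countably many are nonzero, that is, all
  pieces there are.\<close>

lemma exchange_family_countable:
  assumes A: "A \<in> sets M" "emeasure M A < \<infinity>" and C: "exchange_family A B \<C>"
  shows "countable \<C>"
proof -
  have "(\<lambda>p. measure M (fst p)) summable_on \<C>"
  proof (rule nonneg_bdd_above_summable_on)
    have "(\<Sum>p\<in>F. measure M (fst p)) \<le> measure M A" if F: "F \<subseteq> \<C>" "finite F" for F
    proof -
      have fin: "emeasure M (fst p) \<noteq> \<infinity>" if "p \<in> F" for p
        using emeasure_mono[OF exchange_familyD(2)[OF C] A(1), of p] A(2) that F(1)
        by (metis infinity_ennreal_def neq_top_trans subsetD less_top)
      have "measure M (\<Union>p\<in>F. fst p) = (\<Sum>p\<in>F. measure M (fst p))"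
      proof (rule measure_finite_Union[OF F(2)])
        show "fst ` F \<subseteq> sets M" using exchange_familyD(1)[OF C] F(1) by auto
        show "disjoint_family_on fst F"
          unfolding disjoint_family_on_def disjoint_iff using exchange_familyD(6)[OF C] F(1) by (metis subsetD)
      qed (rule fin)
      moreover have "measure M (\<Union>p\<in>F. fst p) \<le> measure M A"
      proof (rule measure_mono_fmeasurable)
        show "(\<Union>p\<in>F. fst p) \<subseteq> A" using exchange_familyD(2)[OF C] F(1) by blast
        show "(\<Union>p\<in>F. fst p) \<in> sets M"
          using exchange_familyD(1)[OF C] F by (intro sets.finite_UN) auto
        show "A \<in> fmeasurable M" using A by (intro fmeasurableI) auto
      qed
      ultimately show ?thesis by simp
    qed
    then show "bdd_above (sum (\<lambda>p. measure M (fst p)) ` {F. F \<subseteq> \<C> \<and> finite F})"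
      by (intro bdd_aboveI[of _ "measure M A"]) auto
  qed simp
  then have "countable {p \<in> \<C>. measure M (fst p) \<noteq> 0}" by (rule summable_countable_real)
  moreover have "measure M (fst p) \<noteq> 0" if "p \<in> \<C>" for p
  proof -
    have "emeasure M (fst p) \<noteq> \<infinity>"
      using emeasure_mono[OF exchange_familyD(2)[OF C that] A(1)] A(2)
      by (metis infinity_ennreal_def neq_top_trans less_top)
    then show ?thesis
      using exchange_familyD(3)[OF C that] by (metis emeasure_eq_ennreal_measure ennreal_0 infinity_ennreal_def less_irrefl)
  qed
  then have "{p \<in> \<C>. measure M (fst p) \<noteq> 0} = \<C>" by auto
  ultimately show ?thesis by simp
qed

text \<open>Exhaustion by a maximal exchange family. The uncovered parts of \<open>A\<close> and
  \<open>B\<close> have equal measure; were it positive, \<open>moves_into\<close> would supply one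
  more piece. Running each map forth on its piece and back on the image yields an
  involution.\<close>

lemma exchange:
  assumes A: "A \<in> sets M" and B: "B \<in> sets M" and disj: "A \<inter> B = {}"
    and eq: "emeasure M A = emeasure M B" and fin: "emeasure M A < \<infinity>"
  obtains J A' B' where "J \<in> full_maps" "A' \<in> sets M" "A' \<subseteq> A" "A - A' \<in> null_sets M"
    "B' \<in> sets M" "B' \<subseteq> B" "B - B' \<in> null_sets M" "J ` A' = B'"
    "\<And>x. x \<in> space M \<Longrightarrow> J (J x) = x" "\<And>x. x \<notin> A' \<Longrightarrow> x \<notin> B' \<Longrightarrow> J x = x"
proof -
  obtain \<C> where C: "exchange_family A B \<C>"
    and maxC: "\<And>\<D>. exchange_family A B \<D> \<Longrightarrow> \<C> \<subseteq> \<D> \<Longrightarrow> \<D> = \<C>"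
    using exchange_family_maximal by metis
  have As: "A \<subseteq> space M" and Bs: "B \<subseteq> space M" using A B sets.sets_into_space by auto
  \<comment> \<open>The pair of the empty set and the identity keeps the enumeration defined when
    the family is empty.\<close>
  define e where "e = from_nat_into (insert ({}, id) \<C>)"
  have re: "range e = insert ({}, id) \<C>"
    unfolding e_def using exchange_family_countable[OF A fin C] by (intro range_from_nat_into) auto
  define P where "P i = fst (e i)" for i
  define T where "T i = snd (e i)" for i
  have ei: "e i = ({}, id) \<or> e i \<in> \<C>" for i using re by (metis insertE rangeI)
  have P: "P i \<in> sets M" "P i \<subseteq> A" and T: "T i \<in> full_maps" and TP: "T i ` P i \<subseteq> B" for i
    using ei[of i] exchange_familyD(1,2,4,5)[OF C, of "e i"] full_maps_id
    unfolding P_def T_def by auto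
  \<comment> \<open>The enumeration may list a pair repeatedly, so pieces with different indices can
    coincide; the maps on a common point still agree, which makes \<open>J\<close> independent of
    the index.\<close>
  have P_eq: "T i = T j" if "x \<in> P i" "x \<in> P j" for i j x
    using ei[of i] ei[of j] exchange_familyD(6)[OF C, of "e i" "e j" x] that
    unfolding P_def T_def by auto
  have TP_eq: "T i = T j" if "x \<in> T i ` P i" "x \<in> T j ` P j" for i j x
    using ei[of i] ei[of j] exchange_familyD(7)[OF C, of "e i" "e j" x] that
    unfolding P_def T_def by auto
  have mT: "T i \<in> mp_bijections M" for i using full_mapsD(1)[OF T] .
  have Ps: "x \<in> space M" if "x \<in> P i" for x i using that P(2) As by auto
  define A' where "A' = (\<Union>i. P i)"
  define B' where "B' = (\<Union>i. T i ` P i)"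
  have A': "A' \<in> sets M" "A' \<subseteq> A" unfolding A'_def using P by auto
  have TPm: "T i ` P i \<in> sets M" for i by (rule mp_bijectionsD(4)[OF mT P(1)])
  have B': "B' \<in> sets M" "B' \<subseteq> B" unfolding B'_def using TPm TP by auto
  have A'B': "x \<notin> B'" if "x \<in> A'" for x using that A'(2) B'(2) disj by auto
  define J where "J x = (if x \<in> A' then T (LEAST i. x \<in> P i) x
    else if x \<in> B' then inv_into (space M) (T (LEAST i. x \<in> T i ` P i)) x else x)" for x
  have J1: "J x = T i x" if "x \<in> P i" for x i
  proof -
    have "x \<in> P (LEAST i. x \<in> P i)" using that by (rule LeastI)
    then have "T (LEAST i. x \<in> P i) = T i" using P_eq that by metis
    then show ?thesis using that unfolding J_def A'_def by auto
  qed
  have J2: "J y = inv_into (space M) (T i) y" if "y \<in> T i ` P i" for y i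
  proof -
    have "y \<in> B'" unfolding B'_def using that by auto
    then have "y \<notin> A'" using A'B' by auto
    have "y \<in> T (LEAST i. y \<in> T i ` P i) ` P (LEAST i. y \<in> T i ` P i)"
      using that by (rule LeastI)
    then have "T (LEAST i. y \<in> T i ` P i) = T i" using TP_eq that by metis
    then show ?thesis using \<open>y \<in> B'\<close> \<open>y \<notin> A'\<close> unfolding J_def by simp
  qed
  have J2': "J (T i x) = x" if "x \<in> P i" for x i
    using J2[of "T i x" i] that mp_bijections_inv_into_cancel(1)[OF mT Ps[OF that]] by auto
  have J3: "J x = x" if "x \<notin> A'" "x \<notin> B'" for x using that unfolding J_def by simp
  have invol: "J (J x) = x" for x
  proof -
    consider i where "x \<in> P i" | i y where "y \<in> P i" "x = T i y" | "x \<notin> A'" "x \<notin> B'"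
      unfolding A'_def B'_def by blast
    then show ?thesis
    proof cases
      case 1 then show ?thesis using J1 J2' by simp
    next
      case 2 then show ?thesis using J1 J2' by simp
    next
      case 3 then show ?thesis using J3 by simp
    qed
  qed
  have JA: "J ` A' = B'"
    unfolding A'_def B'_def image_UN using J1 by (intro SUP_cong refl image_cong) auto
  have Jsp: "J x \<in> space M" if "x \<in> space M" for x
  proof -
    consider i where "x \<in> P i" | i y where "y \<in> P i" "x = T i y" | "x \<notin> A'" "x \<notin> B'"
      unfolding A'_def B'_def by blast
    then show ?thesis
    proof cases
      case 1 then show ?thesis using J1 mp_bijectionsD(8)[OF mT that] by simp
    next
      case 2 then show ?thesis using J2' Ps by simp
    next
      case 3 then show ?thesis using J3 that by simp
    qed
  qed
  have bij: "bij_betw J (space M) (space M)"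
    by (rule bij_betw_byWitness[where f' = J]) (use invol Jsp in auto)
  \<comment> \<open>\<open>None\<close> indexes the region that is fixed,
    \<open>Some (i, True)\<close> a piece, and \<open>Some (i, False)\<close> its image, on which
    \<open>J\<close> runs backwards.\<close>
  define Q where "Q k = (case k of None \<Rightarrow> id | Some (i, b) \<Rightarrow> if b then T i else inv_into (space M) (T i))" for k
  define R where "R k = (case k of None \<Rightarrow> space M - (A' \<union> B') | Some (i, b) \<Rightarrow> if b then P i else T i ` P i)" for k
  have J: "J \<in> full_maps"
  proof (rule full_maps_piecewise[where P = R and Q = Q])
    show "bij_betw J (space M) (space M)" by (rule bij)
    show "Q k \<in> full_maps" for k
      unfolding Q_def using T full_maps_id full_maps_inv_into by (auto split: option.split)
    show "R k \<in> sets M" for k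
      unfolding R_def using P(1) TPm A'(1) B'(1) by (auto split: option.split)
    show "\<exists>k. x \<in> R k" if "x \<in> space M" for x
    proof -
      consider i where "x \<in> P i" | i where "x \<in> T i ` P i" | "x \<notin> A'" "x \<notin> B'"
        unfolding A'_def B'_def by blast
      then show ?thesis
      proof cases
        case 1 then show ?thesis by (intro exI[of _ "Some (i, True)"]) (simp add: R_def)
      next
        case 2 then show ?thesis by (intro exI[of _ "Some (i, False)"]) (simp add: R_def)
      next
        case 3 then show ?thesis using that by (intro exI[of _ None]) (simp add: R_def)
      qed
    qed
    show "J x = Q k x" if xk: "x \<in> R k" for k x
    proof (cases k)
      case None then show ?thesis using xk J3 unfolding R_def Q_def by simp
    next
      case (Some ib)
      obtain i b where "ib = (i, b)" by (cases ib)
      then show ?thesis using Some xk J1 J2 unfolding R_def Q_def by (cases b) simp_all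
    qed
  qed
  have eq': "emeasure M A' = emeasure M B'"
    using mp_bijectionsD(6)[OF full_mapsD(1)[OF J] A'(1)] unfolding JA by simp
  have finA': "emeasure M A' < \<infinity>" using emeasure_mono[OF A'(2) A] fin by (rule le_less_trans)
  have dA: "emeasure M (A - A') = emeasure M A - emeasure M A'"
    using A A' finA' by (intro emeasure_Diff) auto
  have dB: "emeasure M (B - B') = emeasure M B - emeasure M B'"
    using B B' finA' eq' by (intro emeasure_Diff) auto
  \<comment> \<open>Here finiteness matters: subtracting the common finite measure of
    \<open>A'\<close> and \<open>B'\<close> gives leftovers of equal measure.\<close>
  have dAB: "emeasure M (A - A') = emeasure M (B - B')" unfolding dA dB eq eq' ..
  have zero: "emeasure M (A - A') = 0"
  proof (rule ccontr)
    assume "emeasure M (A - A') \<noteq> 0"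
    then have "0 < emeasure M (A - A')" "0 < emeasure M (B - B')"
      using dAB by (simp_all add: zero_less_iff_neq_zero)
    then obtain S where S: "S \<in> full_maps" "0 < emeasure M {x \<in> A - A'. S x \<in> B - B'}"
      using moves_into[of "A - A'" "B - B'"] A A' B B' by auto
    define D where "D = {x \<in> A - A'. S x \<in> B - B'}"
    have "D = (A - A') \<inter> (S -` (B - B') \<inter> space M)" unfolding D_def using As by auto
    then have Dm: "D \<in> sets M"
      using A A' B B' mp_bijectionsD(5)[OF full_mapsD(1)[OF S(1)]] by auto
    have new: "x \<in> fst p \<Longrightarrow> x \<notin> D" "y \<in> snd p ` fst p \<Longrightarrow> y \<notin> S ` D" if p: "p \<in> \<C>" for p x y
    proof -
      obtain i where i: "e i = p" using p re by (metis imageE insertI2)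
      show "x \<in> fst p \<Longrightarrow> x \<notin> D" using i unfolding D_def A'_def P_def by auto
      have "S ` D \<inter> B' = {}" unfolding D_def by auto
      moreover have "snd p ` fst p \<subseteq> B'"
        using UN_upper[of i UNIV "\<lambda>i. T i ` P i"] i unfolding B'_def P_def T_def by simp
      ultimately show "y \<in> snd p ` fst p \<Longrightarrow> y \<notin> S ` D" unfolding disjoint_iff by (metis subsetD)
    qed
    \<comment> \<open>The part of the leftover of \<open>A\<close> that \<open>S\<close> moves into
      the leftover of \<open>B\<close> extends the family, against maximality.\<close>
    have "exchange_family A B (insert (D, S) \<C>)"
      unfolding exchange_family_def
    proof (intro conjI ballI impI)
      fix p assume "p \<in> insert (D, S) \<C>"
      then consider "p = (D, S)" | "p \<in> \<C>" by auto
      then have "fst p \<in> sets M \<and> fst p \<subseteq> A \<and> 0 < emeasure M (fst p) \<and> snd p \<in> full_maps \<and> snd p ` fst p \<subseteq> B"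
      proof cases
        case 1
        have "D \<subseteq> A" "S ` D \<subseteq> B" unfolding D_def by auto
        then show ?thesis using 1 Dm S unfolding D_def[symmetric] by simp
      next
        case 2
        then show ?thesis using exchange_familyD(1-5)[OF C 2] by simp
      qed
      then show "fst p \<in> sets M" "fst p \<subseteq> A" "0 < emeasure M (fst p)" "snd p \<in> full_maps" "snd p ` fst p \<subseteq> B"
        by simp_all
    next
      fix p q assume pq: "p \<in> insert (D, S) \<C>" "q \<in> insert (D, S) \<C>" "p \<noteq> q"
      then consider "p = (D, S)" "q \<in> \<C>" | "p \<in> \<C>" "q = (D, S)" | "p \<in> \<C>" "q \<in> \<C>" by auto
      then have "fst p \<inter> fst q = {} \<and> snd p ` fst p \<inter> snd q ` fst q = {}"
      proof cases
        case 1 then show ?thesis using new[OF 1(2)] unfolding disjoint_iff by simp metis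
      next
        case 2 then show ?thesis using new[OF 2(1)] unfolding disjoint_iff by simp
      next
        case 3 then show ?thesis
          using exchange_familyD(6,7)[OF C 3] pq(3) unfolding disjoint_iff by metis
      qed
      then show "fst p \<inter> fst q = {}" "snd p ` fst p \<inter> snd q ` fst q = {}" by simp_all
    qed
    then have "insert (D, S) \<C> = \<C>" by (rule maxC) auto
    then have "(D, S) \<in> \<C>" by auto
    moreover have "D \<noteq> {}" using S(2) unfolding D_def[symmetric] by auto
    ultimately show False using new(1)[of "(D, S)"] by auto
  qed
  show ?thesis
  proof (rule that[OF J A' _ B' _ JA invol J3])
    show "A - A' \<in> null_sets M" "B - B' \<in> null_sets M"
      using zero dAB A A'(1) B B'(1) by (auto simp: null_sets_def)
  qed
qed

end

section \<open>Supports\<close>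

text \<open>A point is moved exactly if one of the countably many separating sets contains its image
  but not the point.\<close>

lemma fixed_points_measurable:
  assumes "standard_borel M" "T \<in> measurable M M"
  shows "{x \<in> space M. T x = x} \<in> sets M"
proof -
  obtain A where A: "separating_sets M A" by (rule standard_borel_separating_sets[OF assms(1)])
  have Am: "A i \<in> sets M" for i using A unfolding separating_sets_def by simp
  have "x \<in> {x \<in> space M. T x = x} \<longleftrightarrow> x \<in> space M - (\<Union>i. (T -` A i \<inter> space M) - A i)" for x
  proof (cases "x \<in> space M \<and> T x \<noteq> x")
    case True
    then obtain i where "T x \<in> A i" "x \<notin> A i"
      using A measurable_space[OF assms(2), of x] unfolding separating_sets_def by metis
    then show ?thesis using True by auto
  next
    case False
    then show ?thesis by auto
  qed
  then have "{x \<in> space M. T x = x} = space M - (\<Union>i. (T -` A i \<inter> space M) - A i)" by blast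
  also have "\<dots> \<in> sets M"
    using Am measurable_sets[OF assms(2)] by auto
  finally show ?thesis .
qed

text \<open>Continuity from above along the tail unions, which lie in the finite measure set
  \<open>A\<close> and decrease to a null set.\<close>

lemma emeasure_tendsto_0_if_AE:
  assumes A: "A \<in> sets M" "emeasure M A < \<infinity>"
    and E: "\<And>n. E n \<in> sets M" "\<And>n. E n \<subseteq> A" and ev: "AE x in M. \<forall>\<^sub>F n in sequentially. x \<notin> E n"
  shows "(\<lambda>n. emeasure M (E n)) \<longlonglongrightarrow> 0"
proof -
  define D where "D n = (\<Union>m\<in>{n..}. E m)" for n
  have D: "D n \<in> sets M" for n unfolding D_def using E(1) by auto
  have DA: "D n \<subseteq> A" for n unfolding D_def using E(2) by (intro UN_least)
  have "(\<lambda>n. emeasure M (D n)) \<longlonglongrightarrow> emeasure M (\<Inter>n. D n)"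
  proof (rule Lim_emeasure_decseq)
    show "decseq D" unfolding decseq_def D_def by (intro allI impI UN_mono) auto
    show "emeasure M (D n) \<noteq> \<infinity>" for n
      using le_less_trans[OF emeasure_mono[OF DA A(1)] A(2), of n] by simp
  qed (use D in auto)
  moreover have "emeasure M (\<Inter>n. D n) = 0"
  proof -
    have "AE x in M. x \<notin> (\<Inter>n. D n)"
      using ev
    proof eventually_elim
      case (elim x)
      then obtain N where "\<And>n. n \<ge> N \<Longrightarrow> x \<notin> E n" unfolding eventually_sequentially by auto
      then have "x \<notin> D N" unfolding D_def by auto
      then show ?case by auto
    qed
    moreover have "(\<Inter>n. D n) \<in> sets M" using D by auto
    ultimately have "(\<Inter>n. D n) \<in> null_sets M" by (simp add: AE_iff_null_sets)
    then show ?thesis by auto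
  qed
  ultimately have lim: "(\<lambda>n. emeasure M (D n)) \<longlonglongrightarrow> 0" by simp
  have "E n \<subseteq> D n" for n unfolding D_def by (intro UN_upper) auto
  then have "emeasure M (E n) \<le> emeasure M (D n)" for n using D by (intro emeasure_mono)
  then show ?thesis
    by (intro tendsto_sandwich[OF _ _ tendsto_const lim]) auto
qed

context ergodic_full_group
begin

lemma standard_borel_M: "standard_borel M"
  using std unfolding standard_sigma_finite_space_def by simp

lemma atomless_M: "atomless M"
  using std unfolding standard_sigma_finite_space_def by simp

lemma infinite_M: "emeasure M (space M) = \<infinity>"
  using std unfolding standard_sigma_finite_space_def by simp

lemma exists_subset_of_measure:
  assumes D: "D \<in> sets M" and a: "0 \<le> a" "ennreal a < emeasure M D"
  obtains B where "B \<in> sets M" "B \<subseteq> D" "emeasure M B = ennreal a"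
proof -
  obtain v :: "'a \<Rightarrow> real" where v: "v \<in> borel_measurable M" "inj_on v (space M)" "\<And>x. 0 \<le> v x"
    "\<And>r. emeasure M {x \<in> space M. v x \<le> r} < \<infinity>"
    using injective_coordinate[OF std] by metis
  obtain r where r: "emeasure M {x \<in> D. v x \<le> r} = ennreal a"
    by (rule exists_cut[OF atomless_M v D a])
  have "{x \<in> D. v x \<le> r} = D \<inter> {x \<in> space M. v x \<le> r}"
    using sets.sets_into_space[OF D] by auto
  then have "{x \<in> D. v x \<le> r} \<in> sets M" using D v(1) by simp
  then show ?thesis by (rule that[OF _ _ r]) auto
qed

text \<open>Cut \<open>C\<close> into two halves of equal measure and exchange them: a map that
  swaps disjoint sets has no fixed points in them.\<close>

lemma exists_full_map_with_support:
  assumes C: "C \<in> sets M" "emeasure M C < \<infinity>"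
  obtains J where "J \<in> full_maps" "AE x in M. J x \<noteq> x \<longleftrightarrow> x \<in> C"
proof (cases "emeasure M C = 0")
  case True
  then have "C \<in> null_sets M" using C by auto
  then have "AE x in M. id x \<noteq> x \<longleftrightarrow> x \<in> C" by (rule AE_I') auto
  then show ?thesis by (rule that[OF full_maps_id])
next
  case False
  define c where "c = measure M C"
  have c: "emeasure M C = ennreal c" unfolding c_def using C(2) by (simp add: emeasure_eq_ennreal_measure)
  have c0: "0 < c" using False c by (metis ennreal_0 linorder_not_less ennreal_neg)
  then have "ennreal (c / 2) < emeasure M C" unfolding c by (simp add: ennreal_less_iff)
  then obtain A where A: "A \<in> sets M" "A \<subseteq> C" "emeasure M A = ennreal (c / 2)"
    using exists_subset_of_measure[OF C(1), of "c / 2"] c0 by (metis half_gt_zero less_imp_le)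
  have eq: "emeasure M A = emeasure M (C - A)"
    using A C c c0 by (subst emeasure_Diff) (simp_all add: ennreal_minus)
  obtain J A' B' where J: "J \<in> full_maps" "A' \<in> sets M" "A' \<subseteq> A" "A - A' \<in> null_sets M"
    "B' \<in> sets M" "B' \<subseteq> C - A" "C - A - B' \<in> null_sets M" "J ` A' = B'"
    "\<And>x. x \<in> space M \<Longrightarrow> J (J x) = x" "\<And>x. x \<notin> A' \<Longrightarrow> x \<notin> B' \<Longrightarrow> J x = x"
  proof (rule exchange[OF A(1) _ _ eq])
    show "C - A \<in> sets M" using C A by auto
    show "emeasure M A < \<infinity>" unfolding A(3) by simp
  qed auto
  have "(A - A') \<union> (C - A - B') \<in> null_sets M" using J(4,7) by (rule null_sets.Un)
  then have "AE x in M. x \<notin> (A - A') \<union> (C - A - B')" by (rule AE_not_in)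
  with AE_space have "AE x in M. J x \<noteq> x \<longleftrightarrow> x \<in> C"
  proof eventually_elim
    case (elim x)
    show ?case
    proof
      assume "J x \<noteq> x"
      then have "x \<in> A' \<or> x \<in> B'" using J(10) by metis
      then show "x \<in> C" using J(3,6) A(2) by auto
    next
      assume "x \<in> C"
      then consider "x \<in> A'" | "x \<in> B'" using elim(2) by auto
      then show "J x \<noteq> x"
      proof cases
        case 1
        then have "J x \<in> B'" using J(8) by auto
        then show ?thesis using 1 J(3,6) by auto
      next
        case 2
        then obtain y where y: "y \<in> A'" "x = J y" using J(8) by auto
        have "y \<in> space M" using y(1) J(2) sets.sets_into_space by auto
        then have "J x = y" using y(2) J(9) by simp
        then show ?thesis using y(1) 2 J(3,6) by auto
      qed
    qed
  qed
  with J(1) show ?thesis by (rule that)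
qed

section \<open>Lifts\<close>

lemma orbital_map_class:
  assumes f: "f \<in> measurable M (borel_of \<tau>)"
  shows "orbital_map M \<phi> (L0_class M \<tau> f) = aut_class M (\<lambda>x. \<phi> (f x) x)"
proof -
  have "aut_class M (\<lambda>x. \<phi> (h x) x) = aut_class M (\<lambda>x. \<phi> (f x) x)" if "h \<in> L0_class M \<tau> f" for h
  proof (rule aut_class_eqI)
    have "AE x in M. h x = f x" using that unfolding L0_class_def by simp
    then show "AE x in M. \<phi> (h x) x = \<phi> (f x) x" by eventually_elim simp
  qed
  moreover have "L0_class M \<tau> f \<noteq> {}" using mem_L0_class[OF f] by auto
  ultimately show ?thesis unfolding orbital_map_def by simp
qed

lemma orbital_liftsI:
  assumes f: "f \<in> measurable M (borel_of \<tau>)" and T: "T \<in> mp_bijections M" "AE x in M. T x = \<phi> (f x) x"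
  shows "L0_class M \<tau> f \<in> orbital_lifts M \<tau> \<phi>" "orbital_map M \<phi> (L0_class M \<tau> f) = aut_class M T"
    and "T \<in> full_maps"
proof -
  show eq: "orbital_map M \<phi> (L0_class M \<tau> f) = aut_class M T"
    unfolding orbital_map_class[OF f] by (rule aut_class_eqI[OF T(2), symmetric])
  show "L0_class M \<tau> f \<in> orbital_lifts M \<tau> \<phi>"
    unfolding orbital_lifts_def using L0_class_in_L0[OF f] aut_class_in_Aut[OF T(1)] by (simp add: eq)
  have "AE x in M. T x \<in> orbit G \<phi> x"
    using T(2) AE_space
  proof eventually_elim
    case (elim x)
    have "f x \<in> carrier G" using measurable_space[OF f elim(2)] by (simp add: topspace_tau)
    then show ?case unfolding elim(1) orbit_def by auto
  qed
  then show "T \<in> full_maps" unfolding full_maps_def using T(1) by simp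
qed

text \<open>Ties together three views of one lift: a Borel map \<open>f\<close> into the group, its
  class \<open>L\<close>, and a pointwise bijection \<open>T\<close> that agrees with the action of
  \<open>f\<close> almost everywhere.\<close>

definition represents :: "('a \<Rightarrow> 'g) \<Rightarrow> ('a \<Rightarrow> 'a) \<Rightarrow> ('a \<Rightarrow> 'g) set \<Rightarrow> bool" where
  "represents f T L \<longleftrightarrow> f \<in> measurable M (borel_of \<tau>) \<and> L = L0_class M \<tau> f \<and>
     T \<in> full_maps \<and> (AE x in M. T x = \<phi> (f x) x)"

lemma representsD:
  assumes "represents f T L"
  shows "f \<in> measurable M (borel_of \<tau>)" "L = L0_class M \<tau> f" "T \<in> full_maps"
    "AE x in M. T x = \<phi> (f x) x" "orbital_map M \<phi> L = aut_class M T" "L \<in> orbital_lifts M \<tau> \<phi>"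
proof -
  show *: "f \<in> measurable M (borel_of \<tau>)" "L = L0_class M \<tau> f" "T \<in> full_maps"
    "AE x in M. T x = \<phi> (f x) x"
    using assms unfolding represents_def by simp_all
  show "orbital_map M \<phi> L = aut_class M T" "L \<in> orbital_lifts M \<tau> \<phi>"
    unfolding *(2) using orbital_liftsI[OF *(1) full_mapsD(1)[OF *(3)] *(4)] by simp_all
qed

lemma orbital_lifts_represented:
  assumes L: "L \<in> orbital_lifts M \<tau> \<phi>"
  shows "\<exists>f T. represents f T L"
proof -
  have L': "L \<in> L0 M \<tau>" "orbital_map M \<phi> L \<in> carrier (Aut M)"
    using L unfolding orbital_lifts_def by auto
  obtain f where f: "f \<in> measurable M (borel_of \<tau>)" "L = L0_class M \<tau> f"
    by (rule L0_borel_representative[OF L'(1)])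
  obtain T where T: "T \<in> mp_bijections M" "orbital_map M \<phi> L = aut_class M T"
    using L'(2) unfolding Aut_def by auto
  have "T \<in> aut_class M (\<lambda>x. \<phi> (f x) x)"
    using mem_aut_class[OF T(1)] unfolding T(2)[symmetric] f(2) orbital_map_class[OF f(1)] .
  then have ae: "AE x in M. T x = \<phi> (f x) x" by (rule aut_classD(2))
  have "represents f T L"
    unfolding represents_def using f ae orbital_liftsI(3)[OF f(1) T(1) ae] by simp
  then show ?thesis by blast
qed

lemma orbital_map_in_full_set:
  assumes "F \<in> orbital_lifts M \<tau> \<phi>"
  shows "orbital_map M \<phi> F \<in> orbit_full_set G M \<phi>"
proof -
  obtain f T where "represents f T F" using orbital_lifts_represented[OF assms] by auto
  from representsD(3,5)[OF this] show ?thesis by (simp add: orbit_full_setI)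
qed

section \<open>The quotient topology on the full group\<close>

abbreviation "lift_topology \<equiv> subtopology (L0_topology M \<tau> \<mu> d) (orbital_lifts M \<tau> \<phi>)"
abbreviation "full_topology \<equiv> orbital_topology G \<tau> M \<phi> \<mu> d"

lemma metrizable_lift_topology: "metrizable_space lift_topology"
  unfolding L0_topology_eq by (intro metrizable_space_subtopology L0.metrizable_space_mtopology)

lemma topspace_lift_topology: "topspace lift_topology = orbital_lifts M \<tau> \<phi>"
  unfolding L0_topology_eq orbital_lifts_def by auto

lemma openin_full_topology:
  "openin full_topology U \<longleftrightarrow> U \<subseteq> orbit_full_set G M \<phi> \<and>
     openin lift_topology {F \<in> orbital_lifts M \<tau> \<phi>. orbital_map M \<phi> F \<in> U}"
  unfolding orbital_topology_def openin_quotient_topology topspace_lift_topology ..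

lemma topspace_full_topology: "topspace full_topology = orbit_full_set G M \<phi>"
proof -
  have "{F \<in> orbital_lifts M \<tau> \<phi>. orbital_map M \<phi> F \<in> orbit_full_set G M \<phi>} = topspace lift_topology"
    unfolding topspace_lift_topology using orbital_map_in_full_set by auto
  then have "openin full_topology (orbit_full_set G M \<phi>)"
    unfolding openin_full_topology by (metis openin_topspace order_refl)
  moreover have "topspace full_topology \<subseteq> orbit_full_set G M \<phi>"
    using openin_topspace[of full_topology] unfolding openin_full_topology by simp
  ultimately show ?thesis by (metis openin_subset subset_antisym)
qed

lemma orbital_map_continuous: "continuous_map lift_topology full_topology (orbital_map M \<phi>)"
  unfolding continuous_map_def topspace_lift_topology topspace_full_topology
  using orbital_map_in_full_set openin_full_topology by auto

section \<open>Semicontinuity of supports\<close>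

lemma fixed_points_sets: "T \<in> full_maps \<Longrightarrow> A \<in> sets M \<Longrightarrow> {x \<in> A. T x = x} \<in> sets M"
proof -
  assume T: "T \<in> full_maps" and A: "A \<in> sets M"
  have "{x \<in> A. T x = x} = A \<inter> {x \<in> space M. T x = x}" using sets.sets_into_space[OF A] by auto
  then show "{x \<in> A. T x = x} \<in> sets M"
    using fixed_points_measurable[OF standard_borel_M mp_bijections_measurable[OF full_mapsD(1)[OF T]]] A by simp
qed

lemma closedin_stabilizers: "x \<in> space M \<Longrightarrow> closedin \<tau> {g \<in> carrier G. \<phi> g x = x}"
proof -
  assume x: "x \<in> space M"
  obtain A where A: "separating_sets M A" by (rule standard_borel_separating_sets[OF standard_borel_M])
  show ?thesis
  proof (rule closedin_stabilizer[OF polish_G act.group_action_axioms _ A x])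
    fix B y assume B: "B \<in> sets M" "y \<in> space M"
    have "(\<lambda>g. \<phi> g y) \<in> measurable (borel_of \<tau>) M"
      using B(2) by (intro act_measurable) auto
    from measurable_sets[OF this B(1)] show "{h \<in> carrier G. \<phi> h y \<in> B} \<in> sets (borel_of \<tau>)"
      by (simp add: topspace_tau vimage_def Int_def conj_commute)
  qed
qed

text \<open>Bounding the fixed part inside \<open>A\<close> from above is, for \<open>A\<close> of
  finite measure, a lower bound on the part of the support inside \<open>A\<close>; the strict
  inequality is what can be open.\<close>

definition small_fix :: "'a set \<Rightarrow> ennreal \<Rightarrow> ('a \<Rightarrow> 'a) set set" where
  "small_fix A e = aut_class M ` {T \<in> full_maps. emeasure M {x \<in> A. T x = x} < e}"

lemma aut_class_small_fix:
  assumes A: "A \<in> sets M" and T: "T \<in> full_maps"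
  shows "aut_class M T \<in> small_fix A e \<longleftrightarrow> emeasure M {x \<in> A. T x = x} < e"
proof
  assume "aut_class M T \<in> small_fix A e"
  then obtain S where S: "S \<in> full_maps" "emeasure M {x \<in> A. S x = x} < e" "aut_class M T = aut_class M S"
    unfolding small_fix_def by auto
  have "AE x in M. T x = S x" by (rule aut_class_eqD[OF S(3) full_mapsD(1)[OF T]])
  then have "AE x in M. x \<in> {x \<in> A. T x = x} \<longleftrightarrow> x \<in> {x \<in> A. S x = x}" by eventually_elim simp
  then have "emeasure M {x \<in> A. T x = x} = emeasure M {x \<in> A. S x = x}"
    by (rule emeasure_eq_AE) (use A T S(1) fixed_points_sets in auto)
  then show "emeasure M {x \<in> A. T x = x} < e" using S(2) by simp
next
  assume "emeasure M {x \<in> A. T x = x} < e"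
  then show "aut_class M T \<in> small_fix A e" unfolding small_fix_def using T by auto
qed

text \<open>By Miller's theorem, the support of \<open>x \<mapsto> f(x) \<cdot> x\<close> depends lower semicontinuously on \<open>f\<close>.\<close>

lemma openin_small_fix:
  assumes A: "A \<in> sets M" "emeasure M A < \<infinity>"
  shows "openin full_topology (small_fix A e)"
  unfolding openin_full_topology
proof
  show "small_fix A e \<subseteq> orbit_full_set G M \<phi>"
    unfolding small_fix_def using orbit_full_setI by auto
  show "openin lift_topology {F \<in> orbital_lifts M \<tau> \<phi>. orbital_map M \<phi> F \<in> small_fix A e}"
  proof (rule openin_by_sequences[OF metrizable_lift_topology])
    fix \<sigma> l
    assume \<sigma>: "\<And>n. \<sigma> n \<in> topspace lift_topology" and lim: "limitin lift_topology \<sigma> l sequentially"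
      and l: "l \<in> {F \<in> orbital_lifts M \<tau> \<phi>. orbital_map M \<phi> F \<in> small_fix A e}"
    have "\<forall>n. \<exists>f T. represents f T (\<sigma> n)"
      using \<sigma> unfolding topspace_lift_topology by (intro allI orbital_lifts_represented)
    then obtain f T where rep: "\<And>n. represents (f n) (T n) (\<sigma> n)" by metis
    note f = representsD(1,2)[OF rep] and T = representsD(3-5)[OF rep]
    obtain f0 T0 where rep0: "represents f0 T0 l"
      using orbital_lifts_represented[of l] l by auto
    note f0 = representsD(1,2)[OF rep0] and T0 = representsD(3-5)[OF rep0]
    have lim': "limitin (L0_topology M \<tau> \<mu> d) (\<lambda>n. L0_class M \<tau> (f n)) (L0_class M \<tau> f0) sequentially"
      using lim unfolding limitin_subtopology f(2) f0(2) by simp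
    obtain r where "strict_mono r"
      and r: "AE x in M. limitin \<tau> (\<lambda>n. f (r n) x) (f0 x) sequentially"
      by (rule L0_limit_AE_subsequence[OF f(1) f0(1) lim'])
    \<comment> \<open>The new fixed points, fixed by the approximating map but moved by the limit.
      Only these can spoil the bound, and almost every point is in \<open>E n\<close> for only
      finitely many \<open>n\<close>.\<close>
    define E where "E n = {x \<in> A. T (r n) x = x} - {x \<in> A. T0 x = x}" for n
    have Em: "E n \<in> sets M" for n
      unfolding E_def using fixed_points_sets[OF T(1) A(1)] fixed_points_sets[OF T0(1) A(1)] by auto
    have "AE x in M. \<forall>n. T n x = \<phi> (f n x) x" unfolding AE_all_countable using T(2) by simp
    with r T0(2) AE_space have ev: "AE x in M. \<forall>\<^sub>F n in sequentially. x \<notin> E n"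
    proof eventually_elim
      case (elim x)
      show ?case
      proof (cases "T0 x = x")
        case True then show ?thesis unfolding E_def by simp
      next
        case False
        \<comment> \<open>Moving \<open>x\<close> is an open condition on group elements because the
          stabilizer of \<open>x\<close> is closed; it holds at \<open>f0 x\<close> and so
          eventually at \<open>f (r n) x\<close>.\<close>
        let ?U = "carrier G - {g \<in> carrier G. \<phi> g x = x}"
        have "openin \<tau> ?U"
          using closedin_stabilizers[OF elim(3)] unfolding closedin_def topspace_tau by simp
        moreover have "f0 x \<in> ?U"
          using False elim(2) measurable_space[OF f0(1) elim(3)] by (simp add: topspace_tau)
        ultimately have "\<forall>\<^sub>F n in sequentially. f (r n) x \<in> ?U" by (rule limitinD[OF elim(1)])
        then show ?thesis by eventually_elim (use elim(4) in \<open>simp add: E_def\<close>)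
      qed
    qed
    have EA: "E n \<subseteq> A" for n unfolding E_def by auto
    have "(\<lambda>n. emeasure M (E n)) \<longlonglongrightarrow> 0"
      by (rule emeasure_tendsto_0_if_AE[OF A Em EA ev])
    then have "(\<lambda>n. emeasure M {x \<in> A. T0 x = x} + emeasure M (E n)) \<longlonglongrightarrow> emeasure M {x \<in> A. T0 x = x} + 0"
      by (intro tendsto_add tendsto_const)
    moreover have "emeasure M {x \<in> A. T0 x = x} + 0 < e"
      using l by (simp add: T0(3) aut_class_small_fix[OF A(1) T0(1)])
    ultimately have "\<forall>\<^sub>F n in sequentially. emeasure M {x \<in> A. T0 x = x} + emeasure M (E n) < e"
      by (rule order_tendstoD(2))
    then obtain n where n: "emeasure M {x \<in> A. T0 x = x} + emeasure M (E n) < e"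
      by (auto simp: eventually_sequentially)
    have "emeasure M {x \<in> A. T (r n) x = x} \<le> emeasure M ({x \<in> A. T0 x = x} \<union> E n)"
      by (rule emeasure_mono[OF _ sets.Un[OF fixed_points_sets[OF T0(1) A(1)] Em]]) (auto simp: E_def)
    also have "\<dots> \<le> emeasure M {x \<in> A. T0 x = x} + emeasure M (E n)"
      using fixed_points_sets[OF T0(1) A(1)] Em by (rule emeasure_subadditive)
    finally have "orbital_map M \<phi> (\<sigma> (r n)) \<in> small_fix A e"
      unfolding T(3) aut_class_small_fix[OF A(1) T(1)] using n by (rule le_less_trans)
    then show "\<exists>n. \<sigma> n \<in> {F \<in> orbital_lifts M \<tau> \<phi>. orbital_map M \<phi> F \<in> small_fix A e}"
      using \<sigma> unfolding topspace_lift_topology by auto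
  qed (simp only: topspace_lift_topology, blast)
qed

end

section \<open>Consequences of the Polish group topology\<close>

locale polish_orbit_full_group = ergodic_full_group M \<mu> \<tau> d G \<phi>
  for M \<mu> :: "'a measure" and \<tau> :: "'g topology" and d :: "'g \<Rightarrow> 'g \<Rightarrow> real"
    and G :: "'g monoid" and \<phi> :: "'g \<Rightarrow> 'a \<Rightarrow> 'a" +
  assumes polish_full: "polish_group (orbit_full_group G M \<phi>) full_topology"
begin

abbreviation "F \<equiv> orbit_full_group G M \<phi>"

lemma full_topological_group: "topological_group_on F full_topology"
  using polish_full unfolding polish_group_def by simp

sublocale full: group F
  using full_topological_group unfolding topological_group_on_def by simp

lemma aut_class_carrier: "T \<in> full_maps \<Longrightarrow> aut_class M T \<in> carrier F"
  unfolding carrier_orbit_full_group by (rule orbit_full_setI)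

lemma full_inv:
  assumes T: "T \<in> full_maps"
  shows "inv\<^bsub>F\<^esub> (aut_class M T) = aut_class M (inv_into (space M) T)"
proof (rule full.inv_equality)
  have "AE x in M. (inv_into (space M) T \<circ> T) x = id x"
    using mp_bijections_inv_into_cancel(1)[OF full_mapsD(1)[OF T]] by (intro AE_I2) simp
  then show "aut_class M (inv_into (space M) T) \<otimes>\<^bsub>F\<^esub> aut_class M T = \<one>\<^bsub>F\<^esub>"
    unfolding orbit_full_group_mult[OF full_maps_inv_into[OF T] T] orbit_full_group_one
    by (rule aut_class_eqI)
qed (rule aut_class_carrier[OF T] aut_class_carrier[OF full_maps_inv_into[OF T]])+

definition conj_by :: "('a \<Rightarrow> 'a) \<Rightarrow> ('a \<Rightarrow> 'a) \<Rightarrow> 'a \<Rightarrow> 'a" where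
  "conj_by T J = inv_into (space M) T \<circ> (J \<circ> T)"

lemma conj_by_full_maps: "T \<in> full_maps \<Longrightarrow> J \<in> full_maps \<Longrightarrow> conj_by T J \<in> full_maps"
  unfolding conj_by_def by (intro full_maps_comp full_maps_inv_into)

lemma conj_by_fixes:
  assumes T: "T \<in> full_maps" and J: "J \<in> full_maps" and x: "x \<in> space M"
  shows "conj_by T J x = x \<longleftrightarrow> J (T x) = T x"
proof -
  note mT = full_mapsD(1)[OF T] and mJ = full_mapsD(1)[OF J]
  have sp: "T x \<in> space M" "J (T x) \<in> space M"
    using mp_bijectionsD(8)[OF mT x] mp_bijectionsD(8)[OF mJ] by auto
  show ?thesis
  proof
    assume "conj_by T J x = x"
    then have "T (inv_into (space M) T (J (T x))) = T x" unfolding conj_by_def by simp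
    then show "J (T x) = T x" using mp_bijections_inv_into_cancel(2)[OF mT sp(2)] by simp
  next
    assume "J (T x) = T x"
    then show "conj_by T J x = x"
      unfolding conj_by_def using mp_bijections_inv_into_cancel(1)[OF mT x] by simp
  qed
qed

lemma aut_class_conj_by:
  assumes T: "T \<in> full_maps" and J: "J \<in> full_maps"
  shows "inv\<^bsub>F\<^esub> (aut_class M T) \<otimes>\<^bsub>F\<^esub> (aut_class M J \<otimes>\<^bsub>F\<^esub> aut_class M T) = aut_class M (conj_by T J)"
  unfolding full_inv[OF T] orbit_full_group_mult[OF J T] conj_by_def
    orbit_full_group_mult[OF full_maps_inv_into[OF T] full_maps_comp[OF J T]] ..

lemma conj_by_continuous:
  assumes J: "J \<in> full_maps"
  shows "continuous_map full_topology full_topology (\<lambda>C. inv\<^bsub>F\<^esub> C \<otimes>\<^bsub>F\<^esub> (aut_class M J \<otimes>\<^bsub>F\<^esub> C))"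
proof -
  have m: "continuous_map (prod_topology full_topology full_topology) full_topology (\<lambda>(g, h). g \<otimes>\<^bsub>F\<^esub> h)"
    and i: "continuous_map full_topology full_topology (\<lambda>g. inv\<^bsub>F\<^esub> g)"
    using full_topological_group unfolding topological_group_on_def by auto
  have J': "aut_class M J \<in> topspace full_topology"
    unfolding topspace_full_topology by (rule orbit_full_setI[OF J])
  have 1: "continuous_map full_topology full_topology (\<lambda>C. aut_class M J \<otimes>\<^bsub>F\<^esub> C)"
    using continuous_map_compose[OF _ m, of full_topology "\<lambda>C. (aut_class M J, C)"] J'
    by (simp add: o_def continuous_map_paired)
  show ?thesis
    using continuous_map_compose[OF _ m, of full_topology "\<lambda>C. (inv\<^bsub>F\<^esub> C, aut_class M J \<otimes>\<^bsub>F\<^esub> C)"] 1 i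
    by (simp add: o_def continuous_map_paired)
qed

text \<open>\<open>T \<mapsto> T\<^sup>-\<^sup>1 J T\<close> is continuous and the support of \<open>T\<^sup>-\<^sup>1 J T\<close> is \<open>T\<^sup>-\<^sup>1 C\<close> if \<open>J\<close> has support \<open>C\<close>, so the
  semicontinuity of supports shows that orbital convergence implies weak convergence. This fails
  in general for orbit full groups that are not topological groups.\<close>

lemma weak_convergence:
  assumes f: "\<And>n. f n \<in> measurable M (borel_of \<tau>)" "f0 \<in> measurable M (borel_of \<tau>)"
    and T: "\<And>n. T n \<in> full_maps" "\<And>n. AE x in M. T n x = \<phi> (f n x) x"
    and T0: "T0 \<in> full_maps" "AE x in M. T0 x = \<phi> (f0 x) x"
    and lim: "limitin (L0_topology M \<tau> \<mu> d) (\<lambda>n. L0_class M \<tau> (f n)) (L0_class M \<tau> f0) sequentially"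
    and C: "C \<in> sets M" "emeasure M C < \<infinity>"
  shows "(\<lambda>n. emeasure M {x \<in> space M. T0 x \<in> C \<and> T n x \<notin> C}) \<longlonglongrightarrow> 0"
proof (rule order_tendstoI)
  fix e :: ennreal assume e: "0 < e"
  obtain J where J: "J \<in> full_maps" "AE x in M. J x \<noteq> x \<longleftrightarrow> x \<in> C"
    by (rule exists_full_map_with_support[OF C])
  define A where "A = T0 -` C \<inter> space M"
  note mT = full_mapsD(1)[OF T(1)] and mT0 = full_mapsD(1)[OF T0(1)]
  have A: "A \<in> sets M" "emeasure M A < \<infinity>"
    unfolding A_def using mp_bijectionsD(5,7)[OF mT0 C(1)] C(2) by auto
  define \<theta> where "\<theta> K = inv\<^bsub>F\<^esub> K \<otimes>\<^bsub>F\<^esub> (aut_class M J \<otimes>\<^bsub>F\<^esub> K)" for K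
  have \<theta>: "\<theta> (aut_class M S) = aut_class M (conj_by S J)" if "S \<in> full_maps" for S
    unfolding \<theta>_def by (rule aut_class_conj_by[OF that J(1)])
  \<comment> \<open>The neighbourhood of the limit obtained by pulling the open set of small fixed
    parts back along conjugation.\<close>
  define W where "W = {K \<in> topspace full_topology. \<theta> K \<in> small_fix A e}"
  have W: "openin full_topology W"
    unfolding W_def \<theta>_def by (rule openin_continuous_map_preimage[OF conj_by_continuous[OF J(1)] openin_small_fix[OF A]])
  \<comment> \<open>A point of \<open>A\<close>, which \<open>T0\<close> sends into
    \<open>C\<close>, is fixed by the conjugate exactly if \<open>S\<close> sends it outside the
    support \<open>C\<close> of \<open>J\<close>. For \<open>S = T0\<close> there is no such point,
    so the limit lies in \<open>W\<close> for every \<open>e\<close>.\<close>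
  have fixed: "AE x in M. x \<in> {x \<in> A. conj_by S J x = x} \<longleftrightarrow> x \<in> {x \<in> space M. T0 x \<in> C \<and> S x \<notin> C}"
    if S: "S \<in> full_maps" for S
    using AE_mp_bijection[OF full_mapsD(1)[OF S] J(2)] AE_space
  proof eventually_elim
    case (elim x)
    then show ?case using conj_by_fixes[OF S J(1) elim(2)] unfolding A_def by auto
  qed
  have meas: "{x \<in> space M. T0 x \<in> C \<and> S x \<notin> C} \<in> sets M" if "S \<in> full_maps" for S
  proof -
    have "{x \<in> space M. T0 x \<in> C \<and> S x \<notin> C} = A - (S -` C \<inter> space M)" unfolding A_def by auto
    then show ?thesis using A(1) mp_bijectionsD(5)[OF full_mapsD(1)[OF that] C(1)] by simp
  qed
  have small: "\<theta> (aut_class M S) \<in> small_fix A e \<longleftrightarrow> emeasure M {x \<in> space M. T0 x \<in> C \<and> S x \<notin> C} < e"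
    if S: "S \<in> full_maps" for S
  proof -
    have "emeasure M {x \<in> A. conj_by S J x = x} = emeasure M {x \<in> space M. T0 x \<in> C \<and> S x \<notin> C}"
      by (rule emeasure_eq_AE[OF fixed[OF S] fixed_points_sets[OF conj_by_full_maps[OF S J(1)] A(1)] meas[OF S]])
    then show ?thesis
      unfolding \<theta>[OF S] aut_class_small_fix[OF A(1) conj_by_full_maps[OF S J(1)]] by simp
  qed
  have "aut_class M T0 \<in> W"
    unfolding W_def topspace_full_topology using small[OF T0(1)] orbit_full_setI[OF T0(1)] e by simp
  moreover have "limitin lift_topology (\<lambda>n. L0_class M \<tau> (f n)) (L0_class M \<tau> f0) sequentially"
    unfolding limitin_subtopology
    using lim orbital_liftsI(1)[OF f(1) mT T(2)] orbital_liftsI(1)[OF f(2) mT0 T0(2)] by simp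
  then have "limitin full_topology (orbital_map M \<phi> \<circ> (\<lambda>n. L0_class M \<tau> (f n))) (orbital_map M \<phi> (L0_class M \<tau> f0)) sequentially"
    by (rule continuous_map_limit[OF orbital_map_continuous])
  then have "limitin full_topology (\<lambda>n. aut_class M (T n)) (aut_class M T0) sequentially"
    by (simp add: o_def orbital_liftsI(2)[OF f(1) mT T(2)] orbital_liftsI(2)[OF f(2) mT0 T0(2)])
  ultimately have "\<forall>\<^sub>F n in sequentially. aut_class M (T n) \<in> W"
    using limitinD[OF _ W] by metis
  then show "\<forall>\<^sub>F n in sequentially. emeasure M {x \<in> space M. T0 x \<in> C \<and> T n x \<notin> C} < e"
    by eventually_elim (simp add: W_def small[OF T(1)])
qed simp

text \<open>Every positive real number is the measure of the support of some full map, and almost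
  everywhere equal maps have supports of equal measure.\<close>

lemma orbit_full_set_uncountable: "uncountable (orbit_full_set G M \<phi>)"
proof
  assume cnt: "countable (orbit_full_set G M \<phi>)"
  have "\<exists>J. J \<in> full_maps \<and>
      emeasure M (space M - {x \<in> space M. J x = x}) = ennreal r" if "0 < r" for r
  proof -
    obtain C where C: "C \<in> sets M" "emeasure M C = ennreal r"
      using exists_subset_of_measure[of "space M" r] \<open>0 < r\<close> infinite_M
      by (metis ennreal_less_top infinity_ennreal_def less_imp_le sets.top)
    obtain J where J: "J \<in> full_maps" "AE x in M. J x \<noteq> x \<longleftrightarrow> x \<in> C"
      using exists_full_map_with_support[OF C(1)] C(2) by auto
    have fs: "{x \<in> space M. J x = x} \<in> sets M" by (rule fixed_points_sets[OF J(1)]) simp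
    have "AE x in M. x \<in> space M - {x \<in> space M. J x = x} \<longleftrightarrow> x \<in> C"
      using J(2) AE_space by eventually_elim auto
    then have eq: "emeasure M (space M - {x \<in> space M. J x = x}) = emeasure M C"
      by (rule emeasure_eq_AE) (use fs C(1) in auto)
    then show ?thesis using J(1) C(2) by auto
  qed
  then obtain J where J: "\<And>r. 0 < r \<Longrightarrow> J r \<in> full_maps"
    "\<And>r. 0 < r \<Longrightarrow> emeasure M (space M - {x \<in> space M. J r x = x}) = ennreal r" by metis
  have "inj_on (\<lambda>r. aut_class M (J r)) {0<..<1}"
  proof (rule inj_onI)
    fix r s :: real assume rs: "r \<in> {0<..<1}" "s \<in> {0<..<1}" "aut_class M (J r) = aut_class M (J s)"
    then have pos: "0 < r" "0 < s" by auto
    have "AE x in M. J r x = J s x" by (rule aut_class_eqD[OF rs(3) full_mapsD(1)[OF J(1)[OF pos(1)]]])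
    then have "AE x in M. x \<in> space M - {x \<in> space M. J r x = x} \<longleftrightarrow> x \<in> space M - {x \<in> space M. J s x = x}"
      by eventually_elim auto
    then have "ennreal r = ennreal s"
      unfolding J(2)[OF pos(1), symmetric] J(2)[OF pos(2), symmetric]
      by (rule emeasure_eq_AE) (use fixed_points_sets[OF J(1)] pos in auto)
    then show "r = s" using pos by simp
  qed
  moreover have "countable ((\<lambda>r. aut_class M (J r)) ` {0<..<1})"
    by (rule countable_subset[OF _ cnt]) (use J(1) orbit_full_setI in auto)
  ultimately have "countable {0::real<..<1}" by (rule countable_image_inj_on[rotated])
  then show False using uncountable_open_interval[of 0 "1::real"] by simp
qed

text \<open>Without measurable selection: an element outside the image of \<open>\<Phi>\<close> would be isolated, so the group
  would be discrete, hence countable by separability.\<close>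

lemma orbital_map_surj: "orbital_map M \<phi> ` orbital_lifts M \<tau> \<phi> = orbit_full_set G M \<phi>"
proof (rule ccontr)
  assume "orbital_map M \<phi> ` orbital_lifts M \<tau> \<phi> \<noteq> orbit_full_set G M \<phi>"
  moreover have "orbital_map M \<phi> ` orbital_lifts M \<tau> \<phi> \<subseteq> orbit_full_set G M \<phi>"
    using orbital_map_in_full_set by auto
  ultimately obtain C0 where C0: "C0 \<in> orbit_full_set G M \<phi>" "C0 \<notin> orbital_map M \<phi> ` orbital_lifts M \<tau> \<phi>"
    by auto
  \<comment> \<open>In the quotient topology openness is decided by preimages alone, and a class
    outside the image has an empty preimage.\<close>
  then have eq: "{L \<in> orbital_lifts M \<tau> \<phi>. orbital_map M \<phi> L \<in> {C0}} = {}" by auto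
  have op0: "openin full_topology {C0}"
    unfolding openin_full_topology eq using C0(1) by simp
  have op: "openin full_topology {C}" if C: "C \<in> orbit_full_set G M \<phi>" for C
  proof -
    have cc: "C \<in> carrier F" "C0 \<in> carrier F" using C C0(1) unfolding carrier_orbit_full_group by auto
    define g where "g = inv\<^bsub>F\<^esub> C0 \<otimes>\<^bsub>F\<^esub> C"
    have g: "g \<in> carrier F" unfolding g_def using cc by simp
    \<comment> \<open>Right translation by \<open>g\<close> is a homeomorphism, so it carries the
      isolated point \<open>C0\<close> to \<open>C\<close>.\<close>
    have "C0 \<otimes>\<^bsub>F\<^esub> g = C" unfolding g_def using cc by (simp add: full.m_assoc[symmetric])
    then have "(\<lambda>h. h \<otimes>\<^bsub>F\<^esub> g) ` {C0} = {C}" by simp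
    moreover have "openin full_topology ((\<lambda>h. h \<otimes>\<^bsub>F\<^esub> g) ` {C0})"
      using homeomorphic_map_openness[OF topological_group_right_translation[OF full_topological_group g], of "{C0}"]
        op0 C0(1) topspace_full_topology by simp
    ultimately show ?thesis by simp
  qed
  obtain D where D: "countable D" "D \<subseteq> topspace full_topology" "full_topology closure_of D = topspace full_topology"
    using polish_full unfolding polish_group_def polish_topology_def separable_space_def by auto
  have "orbit_full_set G M \<phi> \<subseteq> D"
  proof
    fix C assume C: "C \<in> orbit_full_set G M \<phi>"
    then have "C \<in> full_topology closure_of D" using D(3) topspace_full_topology by simp
    then show "C \<in> D" using op[OF C] unfolding in_closure_of by auto
  qed
  then have "countable (orbit_full_set G M \<phi>)" using D(1) by (rule countable_subset)
  then show False using orbit_full_set_uncountable by simp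
qed

lemma quotient_map_orbital_map: "quotient_map lift_topology full_topology (orbital_map M \<phi>)"
  unfolding orbital_topology_def
  by (rule quotient_map_quotient_topology) (simp only: topspace_lift_topology orbital_map_surj)

end

section \<open>A one-sided shift in the full pseudogroup\<close>

context ergodic_full_group
begin

text \<open>Cut the space at levels \<open>r n\<close> of the injective coordinate whose sublevel
  sets have measure \<open>n\<close>; the slices between consecutive cuts have measure 1.\<close>

lemma unit_partition:
  obtains Z where "\<And>n::nat. Z n \<in> sets M" "\<And>n. emeasure M (Z n) = 1"
    "\<And>m n. m \<noteq> n \<Longrightarrow> Z m \<inter> Z n = {}" "space M - (\<Union>n. Z n) \<in> null_sets M"
proof -
  obtain v :: "'a \<Rightarrow> real" where v: "v \<in> borel_measurable M" "inj_on v (space M)" "\<And>x. 0 \<le> v x"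
    "\<And>r. emeasure M {x \<in> space M. v x \<le> r} < \<infinity>"
    using injective_coordinate[OF std] by metis
  have "\<exists>r. emeasure M {x \<in> space M. v x \<le> r} = ennreal (real n)" for n
    by (rule exists_cut[OF atomless_M v, of "space M" "real n"]) (auto simp: infinite_M)
  then obtain r where r: "\<And>n. emeasure M {x \<in> space M. v x \<le> r n} = ennreal (real n)" by metis
  have L: "{x \<in> space M. v x \<le> s} \<in> sets M" for s using v(1) by measurable
  have mono: "emeasure M {x \<in> space M. v x \<le> s} \<le> emeasure M {x \<in> space M. v x \<le> t}" if "s \<le> t" for s t
    by (rule emeasure_mono[OF _ L]) (use that in auto)
  have less: "r m < r n" if "m < n" for m n
  proof (rule ccontr)
    assume "\<not> r m < r n"
    then have "ennreal (real n) \<le> ennreal (real m)" using mono[of "r n" "r m"] r by simp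
    then show False using that by simp
  qed
  have unbounded: "\<exists>n. t \<le> r n" for t
  proof (rule ccontr)
    assume a: "\<not> ?thesis"
    have "ennreal (real n) \<le> emeasure M {x \<in> space M. v x \<le> t}" for n
      using a mono[of "r n" t] r[of n] by (simp add: not_le less_imp_le)
    moreover have "emeasure M {x \<in> space M. v x \<le> t} = ennreal (measure M {x \<in> space M. v x \<le> t})"
      using v(4)[of t] by (simp add: emeasure_eq_ennreal_measure)
    ultimately have "real n \<le> measure M {x \<in> space M. v x \<le> t}" for n by simp
    then show False using reals_Archimedean2 by (metis not_le)
  qed
  define Z where "Z n = {x \<in> space M. v x \<le> r (Suc n)} - {x \<in> space M. v x \<le> r n}" for n
  have Z: "Z n \<in> sets M" for n unfolding Z_def using L by auto
  have Z1: "emeasure M (Z n) = 1" for n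
  proof -
    have "emeasure M (Z n) = emeasure M {x \<in> space M. v x \<le> r (Suc n)} - emeasure M {x \<in> space M. v x \<le> r n}"
      unfolding Z_def
    proof (rule emeasure_Diff[OF _ L L])
      show "emeasure M {x \<in> space M. v x \<le> r n} \<noteq> \<infinity>" unfolding r by simp
      show "{x \<in> space M. v x \<le> r n} \<subseteq> {x \<in> space M. v x \<le> r (Suc n)}"
        using less[of n "Suc n"] by auto
    qed
    also have "\<dots> = ennreal (real (Suc n) - real n)" unfolding r by (rule ennreal_minus) simp
    finally show ?thesis by simp
  qed
  have disj: "Z m \<inter> Z n = {}" if "m \<noteq> n" for m n
  proof -
    have *: "Z m \<inter> Z n = {}" if "m < n" for m n
    proof -
      have "r (Suc m) \<le> r n" using less[of "Suc m" n] that by (cases "Suc m = n") auto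
      then show ?thesis unfolding Z_def by auto
    qed
    show ?thesis using *[of m n] *[of n m] that by (cases "m < n") auto
  qed
  \<comment> \<open>The cuts are unbounded because bounded ones would keep all sublevel measures
    below a finite value. So what the slices miss lies below the first cut, whose sublevel set has
    measure 0.\<close>
  have "space M - (\<Union>n. Z n) \<subseteq> {x \<in> space M. v x \<le> r 0}"
  proof
    fix x assume x: "x \<in> space M - (\<Union>n. Z n)"
    define n where "n = (LEAST n. v x \<le> r n)"
    have n: "v x \<le> r n" unfolding n_def using unbounded[of "v x"] by (rule LeastI_ex)
    show "x \<in> {x \<in> space M. v x \<le> r 0}"
    proof (cases n)
      case 0 then show ?thesis using n x by simp
    next
      case (Suc k)
      then have "\<not> v x \<le> r k" using not_less_Least[of k "\<lambda>n. v x \<le> r n"] unfolding n_def by simp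
      then have "x \<in> Z k" using n Suc x unfolding Z_def by simp
      then show ?thesis using x by auto
    qed
  qed
  moreover have "{x \<in> space M. v x \<le> r 0} \<in> null_sets M" using r[of 0] L by auto
  moreover have "space M - (\<Union>n. Z n) \<in> sets M" using Z by auto
  ultimately have "space M - (\<Union>n. Z n) \<in> null_sets M" using null_sets_subset by metis
  with Z Z1 disj show ?thesis by (rule that)
qed

text \<open>\<open>J n\<close> is an involution so that it also leads back from \<open>Y n\<close>
  to \<open>Y 0\<close>; equality of the images, not only modulo null sets, lets the shifts be
  computed pointwise on the union of the \<open>Y n\<close>.\<close>

definition shift_system :: "(nat \<Rightarrow> 'a set) \<Rightarrow> (nat \<Rightarrow> 'a \<Rightarrow> 'a) \<Rightarrow> bool" where
  "shift_system Y J \<longleftrightarrow> (\<forall>n. Y n \<in> sets M) \<and> (\<forall>m n. m \<noteq> n \<longrightarrow> Y m \<inter> Y n = {}) \<and>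
     space M - (\<Union>n. Y n) \<in> null_sets M \<and>
     (\<forall>n. J n \<in> full_maps \<and> J n ` Y 0 = Y n \<and> (\<forall>x\<in>space M. J n (J n x) = x))"

text \<open>Each exchange of \<open>Z 0\<close> with another slice works only up to null sets that
  depend on the slice. Intersecting the good parts of \<open>Z 0\<close> over all slices leaves a
  conull part \<open>D\<close>, and its images serve as the \<open>Y n\<close>.\<close>

lemma shift_system_exists: "\<exists>Y J. shift_system Y J"
proof -
  obtain Z where Z: "\<And>n::nat. Z n \<in> sets M" "\<And>n. emeasure M (Z n) = 1"
    "\<And>m n. m \<noteq> n \<Longrightarrow> Z m \<inter> Z n = {}" "space M - (\<Union>n. Z n) \<in> null_sets M"
    using unit_partition by metis
  define swaps where "swaps n p \<longleftrightarrow> fst p \<in> full_maps \<and> snd p \<in> sets M \<and> snd p \<subseteq> Z 0 \<and> Z 0 - snd p \<in> null_sets M \<and>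
      fst p ` snd p \<subseteq> Z (Suc n) \<and> Z (Suc n) - fst p ` snd p \<in> null_sets M \<and>
      (\<forall>x\<in>space M. fst p (fst p x) = x)" for n and p :: "('a \<Rightarrow> 'a) \<times> 'a set"
  have "\<exists>p. swaps n p" for n
  proof (rule exchange[OF Z(1)[of 0] Z(1)[of "Suc n"]])
    show "Z 0 \<inter> Z (Suc n) = {}" using Z(3)[of 0 "Suc n"] by simp
    fix J A' B' assume "J \<in> full_maps" "A' \<in> sets M" "A' \<subseteq> Z 0" "Z 0 - A' \<in> null_sets M"
      "B' \<in> sets M" "B' \<subseteq> Z (Suc n)" "Z (Suc n) - B' \<in> null_sets M" "J ` A' = B'"
      "\<And>x. x \<in> space M \<Longrightarrow> J (J x) = x"
    then have "swaps n (J, A')" unfolding swaps_def by simp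
    then show ?thesis by blast
  qed (simp_all add: Z(2))
  then obtain p where p: "\<And>n. swaps n (p n)" by metis
  \<comment> \<open>The index shift: \<open>p k\<close> exchanges \<open>Z 0\<close> with
    \<open>Z (Suc k)\<close>, and level 0 gets the identity.\<close>
  define J where "J n = (case n of 0 \<Rightarrow> id | Suc k \<Rightarrow> fst (p k))" for n
  define A where "A k = snd (p k)" for k
  have J0: "J 0 = id" and JS: "J (Suc k) = fst (p k)" for k unfolding J_def by simp_all
  have A: "A k \<in> sets M" "A k \<subseteq> Z 0" "Z 0 - A k \<in> null_sets M"
    and JA: "J (Suc k) ` A k \<subseteq> Z (Suc k)" "Z (Suc k) - J (Suc k) ` A k \<in> null_sets M" for k
    using p[of k] unfolding swaps_def JS A_def by simp_all
  have J: "J n \<in> full_maps" "\<forall>x\<in>space M. J n (J n x) = x" for n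
    unfolding J_def using p full_maps_id unfolding swaps_def by (cases n, simp_all)+
  define D where "D = Z 0 \<inter> (\<Inter>k. A k)"
  have D: "D \<in> sets M" unfolding D_def using Z(1) A(1) by auto
  have ZD: "Z 0 - D \<in> null_sets M"
  proof -
    have "Z 0 - D = (\<Union>k. Z 0 - A k)" unfolding D_def by auto
    moreover have "(\<Union>k. Z 0 - A k) \<in> null_sets M" by (rule null_sets_UN[OF A(3)])
    ultimately show ?thesis by (simp only:)
  qed
  define Y where "Y n = J n ` D" for n
  have Y: "Y n \<in> sets M" for n
    unfolding Y_def by (rule mp_bijectionsD(4)[OF full_mapsD(1)[OF J(1)] D])
  have YZ: "Y n \<subseteq> Z n" for n
  proof (cases n)
    case 0 then show ?thesis unfolding Y_def by (simp add: J0 D_def)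
  next
    case (Suc k)
    have "D \<subseteq> A k" unfolding D_def by auto
    then show ?thesis unfolding Y_def Suc using JA(1)[of k] by (meson image_mono order_trans)
  qed
  have ZY: "Z n - Y n \<in> null_sets M" for n
  proof (cases n)
    case 0 then show ?thesis unfolding Y_def using ZD by (simp add: J0)
  next
    case (Suc k)
    note mJ = full_mapsD(1)[OF J(1)[of "Suc k"]]
    have "A k - D \<subseteq> Z 0 - D" using A(2)[of k] by auto
    then have "A k - D \<in> null_sets M" using ZD A(1) D null_sets_subset by (metis sets.Diff)
    then have "J (Suc k) ` (A k - D) \<in> null_sets M"
      using mp_bijectionsD(4,6)[OF mJ] by (auto simp: null_sets_def)
    with JA(2) have "(Z (Suc k) - J (Suc k) ` A k) \<union> J (Suc k) ` (A k - D) \<in> null_sets M"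
      by (rule null_sets.Un)
    moreover have "Z (Suc k) - Y (Suc k) \<subseteq> (Z (Suc k) - J (Suc k) ` A k) \<union> J (Suc k) ` (A k - D)"
      unfolding Y_def by auto
    moreover have "Z (Suc k) - Y (Suc k) \<in> sets M" using Z(1) Y by auto
    ultimately show ?thesis unfolding Suc using null_sets_subset by metis
  qed
  have "space M - (\<Union>n. Y n) \<subseteq> (space M - (\<Union>n. Z n)) \<union> (\<Union>n. Z n - Y n)" by auto
  moreover have "(space M - (\<Union>n. Z n)) \<union> (\<Union>n. Z n - Y n) \<in> null_sets M"
    by (rule null_sets.Un[OF Z(4) null_sets_UN[OF ZY]])
  moreover have "space M - (\<Union>n. Y n) \<in> sets M" using Y by auto
  ultimately have "space M - (\<Union>n. Y n) \<in> null_sets M" using null_sets_subset by metis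
  moreover have "Y m \<inter> Y n = {}" if "m \<noteq> n" for m n
    using YZ[of m] YZ[of n] Z(3)[OF that] by auto
  moreover have "Y 0 = D" unfolding Y_def J0 by simp
  then have "J n ` Y 0 = Y n" for n unfolding Y_def by simp
  ultimately have "shift_system Y J"
    unfolding shift_system_def using Y J by simp
  then show ?thesis by blast
qed

end

section \<open>The contraction\<close>

text \<open>The \<open>j n\<close> are Borel lifts of the \<open>J n\<close>. From them lifts of all
  shifts are composed explicitly, which is how the conjugates obtain concrete lifts.\<close>

locale contraction = polish_orbit_full_group M \<mu> \<tau> d G \<phi>
  for M \<mu> :: "'a measure" and \<tau> :: "'g topology" and d :: "'g \<Rightarrow> 'g \<Rightarrow> real"
    and G :: "'g monoid" and \<phi> :: "'g \<Rightarrow> 'a \<Rightarrow> 'a" +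
  fixes Y :: "nat \<Rightarrow> 'a set" and J :: "nat \<Rightarrow> 'a \<Rightarrow> 'a" and j :: "nat \<Rightarrow> 'a \<Rightarrow> 'g" and w :: "'a \<Rightarrow> real"
  assumes system: "shift_system Y J"
    and j_measurable: "\<And>n. j n \<in> measurable M (borel_of \<tau>)"
    and j_lift: "\<And>n. AE x in M. J n x = \<phi> (j n x) x"
    and w_measurable [measurable]: "w \<in> borel_measurable M"
    and w_bounds: "\<And>x. 0 < w x" "\<And>x. w x < 1"
    and w_level: "\<And>c. {x \<in> space M. w x = c} \<in> null_sets M"
begin

definition X0 :: "'a set" where "X0 = (\<Union>n. Y n)"
text \<open>Points of \<open>X0\<close> are addressed by a level and a base point in
  \<open>Y 0\<close>: \<open>sh m\<close> changes the level to \<open>m\<close> and keeps the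
  base.\<close>

definition lev :: "'a \<Rightarrow> nat" where "lev x = (LEAST n. x \<in> Y n)"
definition base :: "'a \<Rightarrow> 'a" where "base x = J (lev x) x"
definition sh :: "nat \<Rightarrow> 'a \<Rightarrow> 'a" where "sh m x = J m (base x)"
text \<open>The shift depends on the base only, so all levels over one base move by the same amount.
  At t = 0 the ceiling is 0 because \<open>w\<close> lies strictly between 0 and 1. At t = 1
  division by zero would give shift 0 again, which is why \<open>contract\<close> and
  \<open>contract_lift\<close> test \<open>t < 1\<close>.\<close>

definition \<kappa> :: "real \<Rightarrow> 'a \<Rightarrow> nat" where "\<kappa> t x = nat \<lceil>t / (1 - t) - w (base x)\<rceil>"
definition V :: "real \<Rightarrow> 'a \<Rightarrow> 'a" where "V t x = (if x \<in> X0 then sh (lev x + \<kappa> t x) x else x)"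
text \<open>The inverse of \<open>V t\<close> on the part of its image inside \<open>X0\<close>.
  Truncated subtraction gives a meaningless level 0 where the shift exceeds the level, so uses of
  \<open>R\<close> carry the condition \<open>\<kappa> t x \<le> lev x\<close>.\<close>

definition R :: "real \<Rightarrow> 'a \<Rightarrow> 'a" where "R t x = sh (lev x - \<kappa> t x) x"
text \<open>A group element that almost everywhere carries \<open>x\<close> to
  \<open>sh m x\<close>: first down to the base, then up to level \<open>m\<close>. Accordingly
  \<open>\<Gamma>\<close> lifts \<open>V t\<close> and \<open>\<Delta>\<close> lifts
  \<open>R t\<close>.\<close>

definition \<gamma> :: "nat \<Rightarrow> 'a \<Rightarrow> 'g" where "\<gamma> m x = j m (base x) \<otimes>\<^bsub>G\<^esub> j (lev x) x"
definition \<Gamma> :: "real \<Rightarrow> 'a \<Rightarrow> 'g" where "\<Gamma> t x = \<gamma> (lev x + \<kappa> t x) x"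
definition \<Delta> :: "real \<Rightarrow> 'a \<Rightarrow> 'g" where "\<Delta> t x = \<gamma> (lev x - \<kappa> t x) x"

definition contract :: "real \<Rightarrow> ('a \<Rightarrow> 'a) \<Rightarrow> 'a \<Rightarrow> 'a" where
  "contract t T = (if t < 1 then transfer M (V t) T else id)"

text \<open>The three factors lift, from right to left, the way back along the shift, the map
  itself, and the shift at its new position. Off the image of the shift the conjugate is the
  identity, hence the unit.\<close>

definition contract_lift :: "real \<Rightarrow> ('a \<Rightarrow> 'g) \<Rightarrow> 'a \<Rightarrow> 'g" where
  "contract_lift t f x =
     (if t < 1 \<and> x \<in> X0 \<and> \<kappa> t x \<le> lev x
      then \<Gamma> t (\<phi> (f (R t x)) (R t x)) \<otimes>\<^bsub>G\<^esub> (f (R t x) \<otimes>\<^bsub>G\<^esub> \<Delta> t x) else \<one>\<^bsub>G\<^esub>)"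

section \<open>Levels, bases and shifts\<close>

lemma Y_sets [measurable]: "Y n \<in> sets M"
  and Y_disjoint: "m \<noteq> n \<Longrightarrow> Y m \<inter> Y n = {}"
  and J_full: "J n \<in> full_maps"
  and J_Y0: "J n ` Y 0 = Y n"
  and J_invol: "x \<in> space M \<Longrightarrow> J n (J n x) = x"
  using system unfolding shift_system_def by simp_all

lemma J_mp: "J n \<in> mp_bijections M"
  by (rule full_mapsD(1)[OF J_full])

lemma J_measurable [measurable]: "J n \<in> measurable M M"
  by (rule mp_bijections_measurable[OF J_mp])

lemma Y_space: "x \<in> Y n \<Longrightarrow> x \<in> space M"
  using sets.sets_into_space[OF Y_sets] by auto

lemma X0_sets [measurable]: "X0 \<in> sets M"
  unfolding X0_def by measurable

lemma AE_X0: "AE x in M. x \<in> X0"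
proof -
  have "space M - X0 \<in> null_sets M" using system unfolding shift_system_def X0_def by simp
  then have "AE x in M. x \<notin> space M - X0" by (rule AE_not_in)
  with AE_space show ?thesis by eventually_elim simp
qed

lemma lev_eq: "x \<in> Y n \<Longrightarrow> lev x = n"
proof -
  assume x: "x \<in> Y n"
  then have "x \<in> Y (lev x)" unfolding lev_def by (rule LeastI)
  then show "lev x = n" using Y_disjoint[of "lev x" n] x by auto
qed

lemma X0_lev: "x \<in> X0 \<Longrightarrow> x \<in> Y (lev x)"
  unfolding X0_def using lev_eq by auto

lemma base_Y0: "x \<in> X0 \<Longrightarrow> base x \<in> Y 0"
  and J_base: "x \<in> X0 \<Longrightarrow> J (lev x) (base x) = x"
proof -
  assume x: "x \<in> X0"
  then obtain y where y: "y \<in> Y 0" "x = J (lev x) y" using X0_lev[OF x] J_Y0[of "lev x"] by auto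
  then have "base x = y" unfolding base_def using J_invol[OF Y_space[OF y(1)], of "lev x"] by simp
  then show "base x \<in> Y 0" "J (lev x) (base x) = x" using y by simp_all
qed

lemma sh_Y: "x \<in> X0 \<Longrightarrow> sh m x \<in> Y m"
  unfolding sh_def using base_Y0 J_Y0 by auto

lemma sh_X0: "x \<in> X0 \<Longrightarrow> sh m x \<in> X0"
  using sh_Y unfolding X0_def by auto

lemma lev_sh: "x \<in> X0 \<Longrightarrow> lev (sh m x) = m"
  by (rule lev_eq[OF sh_Y])

lemma base_sh: "x \<in> X0 \<Longrightarrow> base (sh m x) = base x"
  unfolding base_def[of "sh m x"] lev_sh unfolding sh_def
  using J_invol[OF Y_space[OF base_Y0]] by simp

lemma \<kappa>_sh: "x \<in> X0 \<Longrightarrow> \<kappa> t (sh m x) = \<kappa> t x"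
  unfolding \<kappa>_def by (simp add: base_sh)

lemma sh_sh: "x \<in> X0 \<Longrightarrow> sh k (sh m x) = sh k x"
  by (simp add: sh_def[of k] base_sh)

lemma sh_lev: "x \<in> X0 \<Longrightarrow> sh (lev x) x = x"
  unfolding sh_def by (rule J_base)

lemma lev_measurable [measurable]: "lev \<in> measurable M (count_space UNIV)"
  unfolding lev_def by measurable

lemma base_measurable [measurable]: "base \<in> measurable M M"
  unfolding base_def by (rule measurable_compose_countable[OF J_measurable lev_measurable])

lemma sh_measurable:
  assumes "m \<in> measurable M (count_space UNIV)"
  shows "(\<lambda>x. sh (m x) x) \<in> measurable M M"
  unfolding sh_def by (rule measurable_compose_countable[OF _ assms]) measurable

lemma \<kappa>_measurable [measurable]: "\<kappa> t \<in> measurable M (count_space UNIV)"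
  unfolding \<kappa>_def by measurable

lemma R_measurable: "R t \<in> measurable M M"
  unfolding R_def by (rule sh_measurable) measurable

lemma \<gamma>_measurable:
  assumes "m \<in> measurable M (count_space UNIV)"
  shows "(\<lambda>x. \<gamma> (m x) x) \<in> measurable M (borel_of \<tau>)"
proof (rule measurable_compose_countable[OF _ assms])
  fix i
  show "\<gamma> i \<in> measurable M (borel_of \<tau>)"
    unfolding \<gamma>_def
    by (intro mult_measurable measurable_compose[OF base_measurable j_measurable]
        measurable_compose_countable[OF j_measurable lev_measurable])
qed

lemma \<Gamma>_measurable: "\<Gamma> t \<in> measurable M (borel_of \<tau>)"
  unfolding \<Gamma>_def by (rule \<gamma>_measurable) measurable

lemma \<Delta>_measurable: "\<Delta> t \<in> measurable M (borel_of \<tau>)"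
  unfolding \<Delta>_def by (rule \<gamma>_measurable) measurable

lemma contract_lift_measurable:
  assumes f: "f \<in> measurable M (borel_of \<tau>)"
  shows "contract_lift t f \<in> measurable M (borel_of \<tau>)"
  unfolding contract_lift_def
proof (rule measurable_If)
  have fR: "(\<lambda>x. f (R t x)) \<in> measurable M (borel_of \<tau>)"
    by (rule measurable_compose[OF R_measurable f])
  show "(\<lambda>x. \<Gamma> t (\<phi> (f (R t x)) (R t x)) \<otimes>\<^bsub>G\<^esub> (f (R t x) \<otimes>\<^bsub>G\<^esub> \<Delta> t x)) \<in> measurable M (borel_of \<tau>)"
    by (intro mult_measurable fR \<Delta>_measurable measurable_compose[OF act_measurable[OF fR R_measurable] \<Gamma>_measurable])
  show "(\<lambda>x. \<one>\<^bsub>G\<^esub>) \<in> measurable M (borel_of \<tau>)"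
    by (rule measurable_const) (simp add: topspace_tau)
  have "{x \<in> space M. t < 1 \<and> x \<in> X0 \<and> \<kappa> t x \<le> lev x} =
      (if t < 1 then X0 \<inter> {x \<in> space M. \<kappa> t x \<le> lev x} else {})"
    using sets.sets_into_space[OF X0_sets] by auto
  moreover have "{x \<in> space M. real (\<kappa> t x) \<le> real (lev x)} \<in> sets M" by measurable
  ultimately show "{x \<in> space M. t < 1 \<and> x \<in> X0 \<and> \<kappa> t x \<le> lev x} \<in> sets M" by simp
qed

text \<open>Together with \<open>\<kappa>_le_lev_V\<close> this shows that the image of
  \<open>V t\<close> within \<open>X0\<close> is cut out by
  \<open>\<kappa> t x \<le> lev x\<close>.\<close>

lemma V_R:
  assumes "x \<in> X0" "\<kappa> t x \<le> lev x"
  shows "V t (R t x) = x"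
  using assms unfolding V_def R_def by (simp add: sh_X0 lev_sh \<kappa>_sh sh_sh sh_lev)

lemma V_X0: "x \<in> X0 \<Longrightarrow> V t x \<in> X0"
  unfolding V_def by (simp add: sh_X0)

lemma \<kappa>_le_lev_V:
  assumes "x \<in> X0"
  shows "\<kappa> t (V t x) \<le> lev (V t x)"
  using assms unfolding V_def by (simp add: lev_sh \<kappa>_sh)

lemma R_V: "x \<in> X0 \<Longrightarrow> R t (V t x) = x"
  unfolding V_def R_def by (simp add: lev_sh \<kappa>_sh sh_sh sh_lev)

text \<open>On \<open>X0\<close> the map \<open>R t\<close> inverts the shift, off \<open>X0\<close>
  the shift is the identity, and the two parts are not mixed.\<close>

lemma V_inj: "inj_on (V t) (space M)"
proof (rule inj_onI)
  fix x y assume xy: "x \<in> space M" "y \<in> space M" "V t x = V t y"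
  show "x = y"
  proof (cases "x \<in> X0")
    case True
    then have "V t y \<in> X0" using V_X0[of x t] xy(3) by simp
    then have "y \<in> X0" unfolding V_def by (simp split: if_splits)
    from R_V[OF True, of t] R_V[OF this, of t] xy(3) show ?thesis by metis
  next
    case False
    then have "V t y \<notin> X0" using xy(3) unfolding V_def[of t x] by simp
    then have "y \<notin> X0" using V_X0 by auto
    then show ?thesis using False xy(3) unfolding V_def by simp
  qed
qed

text \<open>On the set where the level is n and the shift is k, \<open>V t\<close> agrees with the
  automorphism J (n + k) after J n; there are countably many such pieces.\<close>

lemma V_mp_injection: "mp_injection M (V t)"
proof (rule mp_injection_piecewise_countable[OF V_inj])
  define P where "P k = (case k of None \<Rightarrow> space M - X0 | Some (n, k) \<Rightarrow> Y n \<inter> {x \<in> space M. \<kappa> t x = k})" for k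
  define Q where "Q k = (case k of None \<Rightarrow> id | Some (n, k) \<Rightarrow> J (n + k) \<circ> J n)" for k
  show "Q k \<in> mp_bijections M" for k
    unfolding Q_def by (auto split: option.split intro: mp_bijections_id mp_bijections_comp J_mp)
  show "P k \<in> sets M" for k
    unfolding P_def by (cases k) (auto intro!: sets.Int)
  show "\<exists>k. x \<in> P k" if x: "x \<in> space M" for x
  proof (cases "x \<in> X0")
    case True
    then show ?thesis using X0_lev x by (intro exI[of _ "Some (lev x, \<kappa> t x)"]) (simp add: P_def)
  next
    case False
    then show ?thesis using x by (intro exI[of _ None]) (simp add: P_def)
  qed
  show "V t x = Q k x" if x: "x \<in> P k" for k x
  proof (cases k)
    case None then show ?thesis using x unfolding P_def Q_def V_def by simp
  next
    case (Some nk)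
    obtain n m where "nk = (n, m)" by (cases nk)
    then have "x \<in> Y n" "\<kappa> t x = m" using x Some unfolding P_def by simp_all
    then show ?thesis
      using Some \<open>nk = (n, m)\<close> lev_eq[of x n] unfolding Q_def V_def sh_def base_def X0_def by auto
  qed
qed

lemma contract_mp:
  assumes "T \<in> mp_bijections M"
  shows "contract t T \<in> mp_bijections M"
  unfolding contract_def
  by (simp add: transfer_mp_bijections[OF V_mp_injection assms] mp_bijections_id)

lemma contract_moved:
  assumes "t < 1" "x \<in> X0" "\<kappa> t x \<le> lev x"
  shows "contract t T x = V t (T (R t x))"
proof -
  have "R t x \<in> space M"
    using sh_Y[OF assms(2)] Y_space unfolding R_def by auto
  from transfer_image[OF V_inj this, of t T] show ?thesis
    using assms(1) V_R[OF assms(2,3)] unfolding contract_def by simp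
qed

lemma contract_fixed:
  assumes "x \<in> X0" "\<not> (t < 1 \<and> \<kappa> t x \<le> lev x)"
  shows "contract t T x = x"
proof (cases "t < 1")
  case True
  have "x \<notin> V t ` space M"
  proof
    assume "x \<in> V t ` space M"
    then obtain y where y: "x = V t y" by auto
    then have "y \<in> X0" using assms(1) unfolding V_def by (simp split: if_splits)
    then show False using \<kappa>_le_lev_V[of y t] y assms(2) True by simp
  qed
  then show ?thesis unfolding contract_def transfer_def by simp
qed (simp add: contract_def)

text \<open>\<open>sh m\<close> collapses all levels and is no automorphism, but at every point it
  agrees with some J m after J n, and these countably many maps respect null sets.\<close>

lemma AE_sh:
  assumes "AE x in M. P x"
  shows "AE x in M. \<forall>m. P (sh m x)"
proof -
  have "AE x in M. P (J m (J n x))" for m n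
    by (rule AE_mp_bijection[OF J_mp AE_mp_bijection[OF J_mp assms]])
  then have "AE x in M. \<forall>m n. P (J m (J n x))" by (simp add: AE_all_countable)
  then show ?thesis by eventually_elim (simp add: sh_def base_def)
qed

lemma AE_sh_eq: "AE x in M. \<forall>m. sh m x = \<phi> (\<gamma> m x) x"
proof -
  have 1: "AE x in M. \<forall>n. J n x = \<phi> (j n x) x" using j_lift by (simp add: AE_all_countable)
  have "AE x in M. J m (J n x) = \<phi> (j m (J n x)) (J n x)" for m n
    by (rule AE_mp_bijection[OF J_mp j_lift])
  then have "AE x in M. \<forall>m n. J m (J n x) = \<phi> (j m (J n x)) (J n x)" by (simp add: AE_all_countable)
  with 1 AE_space show ?thesis
  proof eventually_elim
    case (elim x)
    have c: "j m y \<in> carrier G" if "y \<in> space M" for m y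
      using measurable_space[OF j_measurable that] by (simp add: topspace_tau)
    have b: "base x \<in> space M" using elim(2) measurable_space[OF base_measurable] by simp
    have "sh m x = \<phi> (\<gamma> m x) x" for m
    proof -
      have "\<phi> (\<gamma> m x) x = \<phi> (j m (base x)) (\<phi> (j (lev x) x) x)"
        unfolding \<gamma>_def by (rule act.composition_rule[OF elim(2) c[OF b] c[OF elim(2)]])
      also have "\<phi> (j (lev x) x) x = base x" unfolding base_def using elim(1) by simp
      also have "\<phi> (j m (base x)) (base x) = sh m x" unfolding sh_def base_def using elim(3) by simp
      finally show ?thesis by simp
    qed
    then show ?case by simp
  qed
qed

lemma contract_lift_AE:
  assumes f: "f \<in> measurable M (borel_of \<tau>)" and T: "T \<in> mp_bijections M" "AE x in M. T x = \<phi> (f x) x"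
  shows "AE x in M. contract t T x = \<phi> (contract_lift t f x) x"
proof -
  \<comment> \<open>The lift of the outer shift is evaluated at \<open>T z\<close> for z =
    \<open>R t x\<close>. The identities valid almost everywhere are therefore pulled back along
    \<open>T\<close>, and afterwards along all \<open>sh m\<close>, of which \<open>R t\<close> is a
    pointwise selection.\<close>
  have "AE z in M. T z \<in> X0 \<and> (\<forall>m. sh m (T z) = \<phi> (\<gamma> m (T z)) (T z))"
    by (rule AE_mp_bijection[OF T(1)]) (use AE_X0 AE_sh_eq in eventually_elim, simp)
  with T(2) have "AE z in M. T z = \<phi> (f z) z \<and> T z \<in> X0 \<and> (\<forall>m. sh m (T z) = \<phi> (\<gamma> m (T z)) (T z))"
    by eventually_elim simp
  from AE_sh[OF this] AE_sh_eq AE_X0 AE_space show ?thesis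
  proof eventually_elim
    case (elim x)
    define z where "z = R t x"
    have z: "z \<in> space M" unfolding z_def by (rule measurable_space[OF R_measurable elim(4)])
    have zz: "T z = \<phi> (f z) z \<and> T z \<in> X0 \<and> (\<forall>m. sh m (T z) = \<phi> (\<gamma> m (T z)) (T z))"
      unfolding z_def R_def by (rule spec[OF elim(1)])
    note Tz = conjunct1[OF zz] conjunct1[OF conjunct2[OF zz]] and shT = conjunct2[OF conjunct2[OF zz]]
    have VT: "V t (T z) = \<phi> (\<Gamma> t (T z)) (T z)"
      unfolding V_def \<Gamma>_def using Tz(2) spec[OF shT, of "lev (T z) + \<kappa> t (T z)"] by simp
    have zx: "z = \<phi> (\<Delta> t x) x" unfolding z_def R_def \<Delta>_def by (rule spec[OF elim(2)])
    have c: "f z \<in> carrier G" "\<Gamma> t (T z) \<in> carrier G" "\<Delta> t x \<in> carrier G"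
      using measurable_space[OF f z] measurable_space[OF \<Gamma>_measurable mp_bijectionsD(8)[OF T(1) z]]
        measurable_space[OF \<Delta>_measurable elim(4)] by (simp_all add: topspace_tau)
    show ?case
    proof (cases "t < 1 \<and> \<kappa> t x \<le> lev x")
      case True
      have "contract t T x = V t (T z)"
        unfolding z_def using True by (intro contract_moved elim(3)) simp_all
      also have "\<dots> = \<phi> (\<Gamma> t (T z)) (\<phi> (f z) (\<phi> (\<Delta> t x) x))"
        unfolding VT unfolding Tz(1) unfolding zx[symmetric] ..
      also have "\<dots> = \<phi> (\<Gamma> t (T z) \<otimes>\<^bsub>G\<^esub> (f z \<otimes>\<^bsub>G\<^esub> \<Delta> t x)) x"
        using c elim(4) by (simp add: act.composition_rule)
      also have "\<Gamma> t (T z) \<otimes>\<^bsub>G\<^esub> (f z \<otimes>\<^bsub>G\<^esub> \<Delta> t x) = contract_lift t f x"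
        unfolding contract_lift_def z_def[symmetric] Tz(1)[symmetric] using True elim(3) by simp
      finally show ?thesis .
    next
      case False
      have "contract_lift t f x = \<one>\<^bsub>G\<^esub>" using False unfolding contract_lift_def by auto
      moreover have "\<phi> \<one>\<^bsub>G\<^esub> x = x"
        using act.id_eq_one elim(4) by (metis restrict_apply')
      ultimately show ?thesis using contract_fixed[OF elim(3) False] by simp
    qed
  qed
qed

lemma contract_represents:
  assumes "represents f T L"
  shows "represents (contract_lift t f) (contract t T) (L0_class M \<tau> (contract_lift t f))"
proof -
  note r = representsD[OF assms]
  have m: "contract_lift t f \<in> measurable M (borel_of \<tau>)" by (rule contract_lift_measurable[OF r(1)])
  have ae: "AE x in M. contract t T x = \<phi> (contract_lift t f x) x"
    by (rule contract_lift_AE[OF r(1) full_mapsD(1)[OF r(3)] r(4)])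
  show ?thesis
    unfolding represents_def
    using m ae orbital_liftsI(3)[OF m contract_mp[OF full_mapsD(1)[OF r(3)]] ae] by simp
qed

text \<open>Makes the contraction well defined on classes: at \<open>x\<close> it evaluates the map
  only at \<open>R t x\<close>, one of the countably many points \<open>sh m x\<close>.\<close>

lemma contract_cong:
  assumes "S \<in> mp_bijections M" "AE x in M. S x = T x"
  shows "AE x in M. contract t S x = contract t T x"
proof -
  have "AE x in M. \<forall>m. S (sh m x) = T (sh m x)" by (rule AE_sh[OF assms(2)])
  with AE_X0 show ?thesis
  proof eventually_elim
    case (elim x)
    show ?case
    proof (cases "t < 1 \<and> \<kappa> t x \<le> lev x")
      case True
      then show ?thesis using elim by (simp add: contract_moved R_def)
    next
      case False
      then show ?thesis using contract_fixed[OF elim(1) False] by simp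
    qed
  qed
qed

lemma contract_0: "AE x in M. contract 0 T x = T x"
  using AE_X0
proof eventually_elim
  case (elim x)
  have k: "\<kappa> 0 y = 0" for y using w_bounds(1)[of "base y"] unfolding \<kappa>_def by simp
  have "V 0 y = y" for y unfolding V_def using k sh_lev by simp
  moreover have "R 0 x = x" unfolding R_def using k sh_lev[OF elim] by simp
  ultimately show ?case using contract_moved[of 0 x T] elim k by simp
qed

end

section \<open>Almost everywhere convergence along subsequences\<close>

context polish_orbit_full_group
begin

text \<open>Turns weak convergence into a pointwise statement: along one subsequence almost every
  orbit point enters each prescribed Borel set that contains its limit. Freedom in the choice of the
  sets is what later replaces continuity of Borel functions.\<close>

lemma weak_AE_subsequence:
  assumes rep: "\<And>n. represents (f n) (T n) (L n)" and rep0: "represents f0 T0 L1"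
    and lim: "limitin lift_topology L L1 sequentially" and A: "\<And>i::nat. A i \<in> sets M"
  obtains r where "strict_mono r" "AE x in M. limitin \<tau> (\<lambda>n. f (r n) x) (f0 x) sequentially"
    "AE x in M. \<forall>i. T0 x \<in> A i \<longrightarrow> (\<forall>\<^sub>F n in sequentially. T (r n) x \<in> A i)"
proof -
  note f = representsD(1,2)[OF rep] and T = representsD(3,4)[OF rep]
  note f0 = representsD(1,2)[OF rep0] and T0 = representsD(3,4)[OF rep0]
  have lim': "limitin (L0_topology M \<tau> \<mu> d) (\<lambda>n. L0_class M \<tau> (f n)) (L0_class M \<tau> f0) sequentially"
    using lim unfolding limitin_subtopology f(2)[symmetric] f0(2)[symmetric] by simp
  obtain r1 where r1: "strict_mono r1" "AE x in M. limitin \<tau> (\<lambda>n. f (r1 n) x) (f0 x) sequentially"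
    by (rule L0_limit_AE_subsequence[OF f(1) f0(1) lim'])
  obtain D :: "nat \<Rightarrow> 'a set" where D: "range D \<subseteq> sets M" "(\<Union>i. D i) = space M" "\<And>i. emeasure M (D i) \<noteq> \<infinity>"
    using sf.sigma_finite by metis
  \<comment> \<open>Weak convergence speaks of sets of finite measure, so each \<open>A i\<close> is
    cut by the countably many sets of a sigma-finite cover; pairs of indices are coded by one
    number.\<close>
  define C where "C p = A (fst (prod_decode p)) \<inter> D (snd (prod_decode p))" for p
  have C: "C p \<in> sets M" for p unfolding C_def using A D(1) by auto
  have Cfin: "emeasure M (C p) < \<infinity>" for p
  proof -
    have "emeasure M (C p) \<le> emeasure M (D (snd (prod_decode p)))"
      unfolding C_def using D(1) by (intro emeasure_mono) auto
    then show ?thesis using D(3)[of "snd (prod_decode p)"] by (simp add: le_less_trans less_top)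
  qed
  define Bad where "Bad p n = {x \<in> space M. T0 x \<in> C p \<and> T (r1 n) x \<notin> C p}" for p n
  have Bm: "Bad p n \<in> sets M" for p n
  proof -
    have "Bad p n = (T0 -` C p \<inter> space M) - (T (r1 n) -` C p \<inter> space M)" unfolding Bad_def by auto
    then show ?thesis
      using mp_bijectionsD(5)[OF full_mapsD(1)[OF T(1)] C] mp_bijectionsD(5)[OF full_mapsD(1)[OF T0(1)] C] by simp
  qed
  have Bl: "(\<lambda>n. emeasure M (Bad p n)) \<longlonglongrightarrow> 0" for p
    using LIMSEQ_subseq_LIMSEQ[OF weak_convergence[OF f(1) f0(1) T T0 lim' C Cfin, of p] r1(1)]
    unfolding Bad_def by (simp add: o_def)
  obtain r2 where r2: "strict_mono r2" "AE x in M. \<forall>p. \<forall>\<^sub>F n in sequentially. x \<notin> Bad p (r2 n)"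
    by (rule AE_eventually_subsequence[of Bad M, OF Bm Bl])
  show ?thesis
  proof (rule that[of "r1 \<circ> r2"])
    show "strict_mono (r1 \<circ> r2)" by (rule strict_mono_o[OF r1(1) r2(1)])
    show "AE x in M. limitin \<tau> (\<lambda>n. f ((r1 \<circ> r2) n) x) (f0 x) sequentially"
      using r1(2)
    proof eventually_elim
      case (elim x)
      from limitin_subsequence[OF r2(1) elim] show ?case by (simp add: o_def)
    qed
    show "AE x in M. \<forall>i. T0 x \<in> A i \<longrightarrow> (\<forall>\<^sub>F n in sequentially. T ((r1 \<circ> r2) n) x \<in> A i)"
      using r2(2) AE_space
    proof eventually_elim
      case (elim x)
      have "\<forall>\<^sub>F n in sequentially. T ((r1 \<circ> r2) n) x \<in> A i" if i: "T0 x \<in> A i" for i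
      proof -
        have "T0 x \<in> space M" by (rule mp_bijectionsD(8)[OF full_mapsD(1)[OF T0(1)] elim(2)])
        then obtain k where k: "T0 x \<in> D k" using D(2) by auto
        have "\<forall>\<^sub>F n in sequentially. x \<notin> Bad (prod_encode (i, k)) (r2 n)" using elim(1) by simp
        then show ?thesis
          by eventually_elim (use i k elim(2) in \<open>simp add: Bad_def C_def\<close>)
      qed
      then show ?case by simp
    qed
  qed
qed

lemma limitin_mult:
  assumes "limitin \<tau> a a0 sequentially" "limitin \<tau> b b0 sequentially"
  shows "limitin \<tau> (\<lambda>n. a n \<otimes>\<^bsub>G\<^esub> b n) (a0 \<otimes>\<^bsub>G\<^esub> b0) sequentially"
proof -
  have "limitin (prod_topology \<tau> \<tau>) (\<lambda>n. (a n, b n)) (a0, b0) sequentially"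
    using assms by (simp add: limitin_pairwise o_def)
  from continuous_map_limit[OF mult_continuous this] show ?thesis by (simp add: o_def)
qed

end

text \<open>The ceiling is locally constant off the integers.\<close>

lemma eventually_ceiling_eq:
  fixes c :: real
  assumes lim: "(s \<longlongrightarrow> c) F" and c: "c \<notin> \<int>"
  shows "\<forall>\<^sub>F n in F. \<lceil>s n\<rceil> = \<lceil>c\<rceil>"
proof -
  have "c \<noteq> of_int \<lceil>c\<rceil>" using c by (metis Ints_of_int)
  then have "of_int \<lceil>c\<rceil> - 1 < c" "c < of_int \<lceil>c\<rceil>"
    using ceiling_correct[of c] by linarith+
  then have "\<forall>\<^sub>F n in F. of_int \<lceil>c\<rceil> - 1 < s n" "\<forall>\<^sub>F n in F. s n < of_int \<lceil>c\<rceil>"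
    using order_tendstoD[OF lim] by auto
  then show ?thesis by eventually_elim (simp add: ceiling_unique)
qed

context contraction
begin

text \<open>The base of \<open>x\<close> is one of the points \<open>J n x\<close>, so the
  exceptional set is covered by preimages of countably many levels of \<open>w\<close>, all
  null.\<close>

lemma AE_generic: "AE x in M. s - w (base x) \<notin> \<int>"
proof -
  have "AE x in M. w x \<noteq> c" for c
  proof -
    have "AE x in M. x \<notin> {x \<in> space M. w x = c}" by (rule AE_not_in[OF w_level])
    with AE_space show ?thesis by eventually_elim simp
  qed
  then have "AE x in M. w (J n x) \<noteq> s - of_int k" for n k
    by (rule AE_mp_bijection[OF J_mp])
  then have "AE x in M. \<forall>n. \<forall>k::int. w (J n x) \<noteq> s - of_int k" by (simp add: AE_all_countable)
  then show ?thesis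
  proof eventually_elim
    case (elim x)
    show ?case
    proof
      assume "s - w (base x) \<in> \<int>"
      then obtain k :: int where "s - w (base x) = of_int k" by (rule Ints_cases)
      then have "w (J (lev x) x) = s - of_int k" unfolding base_def by simp
      then show False using elim by simp
    qed
  qed
qed

lemma eventually_\<kappa>_eq:
  assumes t: "t \<longlonglongrightarrow> t0" "t0 < 1" and x: "t0 / (1 - t0) - w (base x) \<notin> \<int>"
  shows "\<forall>\<^sub>F n in sequentially. \<kappa> (t n) x = \<kappa> t0 x"
proof -
  have "(\<lambda>n. t n / (1 - t n) - w (base x)) \<longlonglongrightarrow> t0 / (1 - t0) - w (base x)"
    using t by (intro tendsto_intros) auto
  from eventually_ceiling_eq[OF this x] show ?thesis
    by eventually_elim (simp add: \<kappa>_def)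
qed

text \<open>The threshold is the \<open>t\<close> at which t / (1 - t) equals the level plus 1;
  beyond it the shift exceeds the level even after subtraction of \<open>w\<close>, which is less
  than 1.\<close>

lemma lev_less_\<kappa>:
  assumes "(real (lev x) + 1) / (real (lev x) + 2) < t" "t < 1"
  shows "lev x < \<kappa> t x"
proof -
  have "real (lev x) + 1 < t * (real (lev x) + 2)"
    using assms(1) by (simp add: field_simps)
  then have "real (lev x) + 1 < t / (1 - t)"
    using assms(2) by (simp add: field_simps)
  then have "real (lev x) < t / (1 - t) - w (base x)" using w_bounds(2)[of "base x"] by simp
  then show ?thesis unfolding \<kappa>_def by linarith
qed

text \<open>For \<open>t\<close> near 1 the point \<open>x\<close> has left the image of the shift,
  so the lift is eventually the unit, whatever the maps \<open>f n\<close> do.\<close>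

lemma contract_lift_converges_1:
  assumes t: "\<And>n. t n \<in> {0..1}" "t \<longlonglongrightarrow> 1"
  shows "limitin \<tau> (\<lambda>n. contract_lift (t n) (f n) x) (contract_lift 1 f0 x) sequentially"
proof (rule limitin_eventually)
  show "contract_lift 1 f0 x \<in> topspace \<tau>" unfolding contract_lift_def by (simp add: topspace_tau)
  have "\<forall>\<^sub>F n in sequentially. (real (lev x) + 1) / (real (lev x) + 2) < t n"
    by (rule order_tendstoD(1)[OF t(2)]) simp
  then show "\<forall>\<^sub>F n in sequentially. contract_lift (t n) (f n) x = contract_lift 1 f0 x"
  proof eventually_elim
    case (elim n)
    then have "\<not> (t n < 1 \<and> \<kappa> (t n) x \<le> lev x)" using lev_less_\<kappa>[OF elim] by auto
    then show ?case unfolding contract_lift_def by auto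
  qed
qed

text \<open>Two quantities at the moving point \<open>T n z\<close> lack continuity: the value of
  \<open>\<Gamma>\<close>, which is only Borel, and the shift at time \<open>t n\<close>, whose
  eventual equality with the shift at \<open>t0\<close> is known only at fixed points. Both become
  membership in Borel sets that contain \<open>T0 z\<close>, to which
  \<open>weak_AE_subsequence\<close> applies.\<close>

lemma contract_lift_converges:
  assumes t: "\<And>n. t n \<in> {0..1}" "t \<longlonglongrightarrow> t0" "t0 < 1"
    and rep: "\<And>n. represents (f n) (T n) (L n)" and rep0: "represents f0 T0 L1"
    and lim: "limitin lift_topology L L1 sequentially"
  obtains r where "AE x in M. limitin \<tau> (\<lambda>n. contract_lift (t (r n)) (f (r n)) x) (contract_lift t0 f0 x) sequentially"
proof -
  obtain B where B: "base_sequence \<tau> B"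
    using second_countable by (rule second_countable_base_sequence)
  define K where "K n = {y \<in> space M. real (\<kappa> (t n) y) \<noteq> real (\<kappa> t0 y)}" for n
  have "(\<lambda>y. real (\<kappa> u y)) \<in> borel_measurable M" for u
    by (rule measurable_compose[OF \<kappa>_measurable]) simp
  then have K: "K n \<in> sets M" for n unfolding K_def by (intro borel_measurable_neq)
  \<comment> \<open>One sequence codes both kinds of conditions: even indices for preimages of basic
    open sets under \<open>\<Gamma> t0\<close>, odd ones for the points where the shift agrees with
    that at \<open>t0\<close> from time i div 2 on.\<close>
  define A where "A i = (if even i then \<Gamma> t0 -` B (i div 2) \<inter> space M
    else space M - (\<Union>n\<in>{i div 2..}. K n))" for i :: nat
  have Am: "A i \<in> sets M" for i
  proof (cases "even i")
    case True
    show ?thesis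
      unfolding A_def if_P[OF True]
      by (rule measurable_sets[OF \<Gamma>_measurable borel_of_open[OF base_sequenceD(1)[OF B]]])
  next
    case False
    have "space M - (\<Union>n\<in>{i div 2..}. K n) \<in> sets M" using K by auto
    then show ?thesis unfolding A_def if_not_P[OF False] .
  qed
  obtain r where r: "strict_mono r" "AE x in M. limitin \<tau> (\<lambda>n. f (r n) x) (f0 x) sequentially"
    "AE x in M. \<forall>i. T0 x \<in> A i \<longrightarrow> (\<forall>\<^sub>F n in sequentially. T (r n) x \<in> A i)"
    by (rule weak_AE_subsequence[where f = f and T = T and L = L and A = A, OF rep rep0 lim Am])
  note T = representsD(3,4)[OF rep] and T0 = representsD(3,4)[OF rep0]
  define s where "s = t0 / (1 - t0)"
  \<comment> \<open>All that is required at the source point z = \<open>R t0 x\<close>;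
    \<open>AE_sh\<close> provides it there for almost every \<open>x\<close>.\<close>
  define P where "P z \<longleftrightarrow> z \<in> space M \<and> limitin \<tau> (\<lambda>n. f (r n) z) (f0 z) sequentially \<and>
    (\<forall>i. T0 z \<in> A i \<longrightarrow> (\<forall>\<^sub>F n in sequentially. T (r n) z \<in> A i)) \<and>
    (\<forall>n. T n z = \<phi> (f n z) z) \<and> T0 z = \<phi> (f0 z) z \<and> s - w (base (T0 z)) \<notin> \<int>" for z
  have "AE z in M. \<forall>n. T n z = \<phi> (f n z) z" using T(2) by (simp add: AE_all_countable)
  moreover have "AE z in M. s - w (base (T0 z)) \<notin> \<int>"
    by (rule AE_mp_bijection[OF full_mapsD(1)[OF T0(1)] AE_generic])
  ultimately have "AE z in M. P z"
    using r(2,3) T0(2) AE_space by eventually_elim (simp add: P_def)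
  from AE_sh[OF this] AE_generic[of s] AE_space
  have "AE x in M. limitin \<tau> (\<lambda>n. contract_lift (t (r n)) (f (r n)) x) (contract_lift t0 f0 x) sequentially"
  proof eventually_elim
    case (elim x)
    have \<kappa>x: "\<forall>\<^sub>F n in sequentially. \<kappa> (t (r n)) x = \<kappa> t0 x"
      using eventually_subseq[OF r(1) eventually_\<kappa>_eq[OF t(2,3) elim(2)[unfolded s_def]]] .
    have "\<forall>\<^sub>F n in sequentially. t n < 1" by (rule order_tendstoD(2)[OF t(2,3)])
    then have t1: "\<forall>\<^sub>F n in sequentially. t (r n) < 1" by (rule eventually_subseq[OF r(1)])
    show ?case
    proof (cases "x \<in> X0 \<and> \<kappa> t0 x \<le> lev x")
      case False
      then have 1: "contract_lift t0 f0 x = \<one>\<^bsub>G\<^esub>" unfolding contract_lift_def by auto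
      show ?thesis
      proof (rule limitin_eventually)
        show "contract_lift t0 f0 x \<in> topspace \<tau>" unfolding 1 by (simp add: topspace_tau)
        show "\<forall>\<^sub>F n in sequentially. contract_lift (t (r n)) (f (r n)) x = contract_lift t0 f0 x"
          using \<kappa>x by eventually_elim (use False in \<open>auto simp: 1 contract_lift_def\<close>)
      qed
    next
      case True
      define z where "z = R t0 x"
      have Pz: "P z" unfolding z_def R_def by (rule spec[OF elim(1)])
      have z: "z \<in> space M" and fz: "limitin \<tau> (\<lambda>n. f (r n) z) (f0 z) sequentially"
        and Az: "\<And>i. T0 z \<in> A i \<Longrightarrow> \<forall>\<^sub>F n in sequentially. T (r n) z \<in> A i"
        and Tz: "\<And>n. T n z = \<phi> (f n z) z" and T0z: "T0 z = \<phi> (f0 z) z"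
        and gen: "s - w (base (T0 z)) \<notin> \<int>"
        using Pz unfolding P_def by blast+
      have T0s: "T0 z \<in> space M" by (rule mp_bijectionsD(8)[OF full_mapsD(1)[OF T0(1)] z])
      have \<Delta>s: "\<Delta> t0 x \<in> topspace \<tau>" using measurable_space[OF \<Delta>_measurable elim(3)] by simp
      have \<Gamma>lim: "limitin \<tau> (\<lambda>n. \<Gamma> t0 (T (r n) z)) (\<Gamma> t0 (T0 z)) sequentially"
        unfolding limitin_def
      proof (intro conjI allI impI)
        show "\<Gamma> t0 (T0 z) \<in> topspace \<tau>" using measurable_space[OF \<Gamma>_measurable T0s] by simp
        fix U assume U: "openin \<tau> U \<and> \<Gamma> t0 (T0 z) \<in> U"
        then obtain i where i: "\<Gamma> t0 (T0 z) \<in> B i" "B i \<subseteq> U" using base_sequenceD(2)[OF B] by metis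
        then have "T0 z \<in> A (2 * i)" unfolding A_def using T0s by simp
        from Az[OF this] show "\<forall>\<^sub>F n in sequentially. \<Gamma> t0 (T (r n) z) \<in> U"
          by eventually_elim (use i(2) in \<open>auto simp: A_def\<close>)
      qed
      have lim': "limitin \<tau> (\<lambda>n. \<Gamma> t0 (T (r n) z) \<otimes>\<^bsub>G\<^esub> (f (r n) z \<otimes>\<^bsub>G\<^esub> \<Delta> t0 x))
          (\<Gamma> t0 (T0 z) \<otimes>\<^bsub>G\<^esub> (f0 z \<otimes>\<^bsub>G\<^esub> \<Delta> t0 x)) sequentially"
        by (intro limitin_mult \<Gamma>lim fz) (simp add: \<Delta>s)
      have eq0: "contract_lift t0 f0 x = \<Gamma> t0 (T0 z) \<otimes>\<^bsub>G\<^esub> (f0 z \<otimes>\<^bsub>G\<^esub> \<Delta> t0 x)"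
        unfolding contract_lift_def z_def[symmetric] T0z using True t(3) by simp
      have "\<forall>\<^sub>F n in sequentially. \<kappa> (t n) (T0 z) = \<kappa> t0 (T0 z)"
        by (rule eventually_\<kappa>_eq[OF t(2,3) gen[unfolded s_def]])
      then obtain m where "\<And>n. m \<le> n \<Longrightarrow> \<kappa> (t n) (T0 z) = \<kappa> t0 (T0 z)"
        unfolding eventually_sequentially by auto
      \<comment> \<open>By genericity of \<open>T0 z\<close> the shifts there have stabilized from
        \<open>m\<close> on. Membership in this Borel set then passes to \<open>T (r n) z\<close>,
        where stabilization could not be obtained pointwise.\<close>
      then have "T0 z \<in> A (Suc (2 * m))" unfolding A_def K_def using T0s by auto
      then have "\<forall>\<^sub>F n in sequentially. T (r n) z \<in> A (Suc (2 * m))" by (rule Az)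
      with eventually_ge_at_top[of m] \<kappa>x t1
      have "\<forall>\<^sub>F n in sequentially. \<Gamma> t0 (T (r n) z) \<otimes>\<^bsub>G\<^esub> (f (r n) z \<otimes>\<^bsub>G\<^esub> \<Delta> t0 x) = contract_lift (t (r n)) (f (r n)) x"
      proof eventually_elim
        case (elim n)
        \<comment> \<open>A strictly increasing index sequence satisfies r n \<ge> n, so the time
          \<open>t (r n)\<close> is covered by the stabilization from \<open>m\<close> on.\<close>
        have "m \<le> r n" using elim(1) seq_suble[OF r(1), of n] by simp
        then have "\<kappa> (t (r n)) (T (r n) z) = \<kappa> t0 (T (r n) z)"
          using elim(4) unfolding A_def K_def by auto
        then have 1: "\<Gamma> (t (r n)) (T (r n) z) = \<Gamma> t0 (T (r n) z)" unfolding \<Gamma>_def by simp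
        have 2: "R (t (r n)) x = z" "\<Delta> (t (r n)) x = \<Delta> t0 x"
          unfolding z_def R_def \<Delta>_def elim(2) by simp_all
        show ?case
          unfolding contract_lift_def 2 Tz[symmetric] 1 using True elim(2,3) by simp
      qed
      then show ?thesis unfolding eq0 by (rule limitin_transform_eventually[OF _ lim'])
    qed
  qed
  then show ?thesis by (rule that)
qed

section \<open>The homotopy on lifts and on classes\<close>

definition lift_rep :: "('a \<Rightarrow> 'g) set \<Rightarrow> ('a \<Rightarrow> 'g) \<times> ('a \<Rightarrow> 'a)" where
  "lift_rep L = (SOME p. represents (fst p) (snd p) L)"

lemma lift_rep:
  assumes "L \<in> orbital_lifts M \<tau> \<phi>"
  shows "represents (fst (lift_rep L)) (snd (lift_rep L)) L"
proof -
  obtain f T where "represents f T L" using orbital_lifts_represented[OF assms] by auto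
  then have "\<exists>p. represents (fst p) (snd p) L" by (intro exI[of _ "(f, T)"]) simp
  then show ?thesis unfolding lift_rep_def by (rule someI_ex)
qed

definition lift_homotopy :: "real \<Rightarrow> ('a \<Rightarrow> 'g) set \<Rightarrow> ('a \<Rightarrow> 'g) set" where
  "lift_homotopy t L = L0_class M \<tau> (contract_lift t (fst (lift_rep L)))"

definition homotopy :: "real \<Rightarrow> ('a \<Rightarrow> 'a) set \<Rightarrow> ('a \<Rightarrow> 'a) set" where
  "homotopy t C = aut_class M (contract t (SOME T. T \<in> C))"

lemma lift_homotopy_represents:
  assumes "L \<in> orbital_lifts M \<tau> \<phi>"
  shows "represents (contract_lift t (fst (lift_rep L))) (contract t (snd (lift_rep L))) (lift_homotopy t L)"
  unfolding lift_homotopy_def by (rule contract_represents[OF lift_rep[OF assms]])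

lemma homotopy_class:
  assumes T: "T \<in> mp_bijections M"
  shows "homotopy t (aut_class M T) = aut_class M (contract t T)"
proof -
  define S where "S = (SOME S. S \<in> aut_class M T)"
  have S: "S \<in> aut_class M T" 
    unfolding S_def by (rule someI[of "\<lambda>S. S \<in> aut_class M T", OF mem_aut_class[OF T]])
  show ?thesis
    unfolding homotopy_def S_def[symmetric]
    by (rule aut_class_eqI[OF contract_cong[OF aut_classD[OF S]]])
qed

lemma homotopy_orbital_map:
  assumes "L \<in> orbital_lifts M \<tau> \<phi>"
  shows "homotopy t (orbital_map M \<phi> L) = orbital_map M \<phi> (lift_homotopy t L)"
  using representsD(3,5)[OF lift_rep[OF assms]] representsD(5)[OF lift_homotopy_represents[OF assms]]
  by (simp add: homotopy_class full_mapsD(1))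

text \<open>Working over the metrizable space of lifts allows a test by subsequences and spares
  lifting convergent sequences of classes. Times below 1 and the end time 1 need separate arguments,
  because the shift amounts have no finite limit at the end.\<close>

lemma lift_homotopy_continuous:
  "continuous_map (prod_topology (top_of_set {0..1}) lift_topology) lift_topology (\<lambda>(t, L). lift_homotopy t L)"
proof (rule continuous_map_by_subsequences)
  have "metrizable_space (top_of_set {0..1::real})"
    by (intro metrizable_space_subtopology metrizable_space_euclidean)
  then show "metrizable_space (prod_topology (top_of_set {0..1::real}) lift_topology)"
    using metrizable_lift_topology metrizable_space_prod_topology by metis
  show "(\<lambda>(t, L). lift_homotopy t L) \<in> topspace (prod_topology (top_of_set {0..1}) lift_topology) \<rightarrow> topspace lift_topology"
  proof
    fix p assume "p \<in> topspace (prod_topology (top_of_set {0..1::real}) lift_topology)"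
    then have "snd p \<in> orbital_lifts M \<tau> \<phi>" unfolding topspace_prod_topology topspace_lift_topology by auto
    then show "(case p of (t, L) \<Rightarrow> lift_homotopy t L) \<in> topspace lift_topology"
      unfolding topspace_lift_topology using representsD(6)[OF lift_homotopy_represents] by (simp add: case_prod_beta)
  qed
  fix \<sigma> :: "nat \<Rightarrow> real \<times> ('a \<Rightarrow> 'g) set" and l
  assume \<sigma>: "\<And>n. \<sigma> n \<in> topspace (prod_topology (top_of_set {0..1}) lift_topology)"
    and lim: "limitin (prod_topology (top_of_set {0..1}) lift_topology) \<sigma> l sequentially"
  define t where "t n = fst (\<sigma> n)" for n
  define L where "L n = snd (\<sigma> n)" for n
  obtain t0 L1 where l: "l = (t0, L1)" by (cases l)
  have \<sigma>': "t n \<in> {0..1}" "L n \<in> orbital_lifts M \<tau> \<phi>" for n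
    using \<sigma>[of n] unfolding topspace_prod_topology topspace_lift_topology t_def L_def by auto
  have lim_t: "limitin (top_of_set {0..1}) t t0 sequentially" and lim_L: "limitin lift_topology L L1 sequentially"
    using lim unfolding limitin_pairwise l t_def L_def by (simp_all add: o_def)
  have t: "t \<longlonglongrightarrow> t0" "t0 \<in> {0..1}"
    using lim_t unfolding limitin_subtopology by simp_all
  have L1: "L1 \<in> orbital_lifts M \<tau> \<phi>"
    using limitin_topspace[OF lim_L] unfolding topspace_lift_topology .
  define f where "f n = fst (lift_rep (L n))" for n
  define f0 where "f0 = fst (lift_rep L1)"
  have rep: "represents (f n) (snd (lift_rep (L n))) (L n)" for n
    unfolding f_def by (rule lift_rep[OF \<sigma>'(2)])
  have rep0: "represents f0 (snd (lift_rep L1)) L1" unfolding f0_def by (rule lift_rep[OF L1])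
  obtain r where r: "AE x in M. limitin \<tau> (\<lambda>n. contract_lift (t (r n)) (f (r n)) x) (contract_lift t0 f0 x) sequentially"
  proof (cases "t0 < 1")
    case True
    show ?thesis by (rule contract_lift_converges[OF \<sigma>'(1) t(1) True rep rep0 lim_L]) (rule that)
  next
    case False
    then have "t0 = 1" using t(2) by simp
    show ?thesis
    proof (rule that[of id], rule AE_I2)
      fix x
      show "limitin \<tau> (\<lambda>n. contract_lift (t (id n)) (f (id n)) x) (contract_lift t0 f0 x) sequentially"
        using contract_lift_converges_1[where t = t and f = f and x = x, OF \<sigma>'(1)] t(1)
        unfolding \<open>t0 = 1\<close> by simp
    qed
  qed
  have "limitin (L0_topology M \<tau> \<mu> d) (\<lambda>n. L0_class M \<tau> (contract_lift (t (r n)) (f (r n))))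
      (L0_class M \<tau> (contract_lift t0 f0)) sequentially"
    by (rule limitin_L0_if_AE[OF contract_lift_measurable[OF representsD(1)[OF rep]]
          contract_lift_measurable[OF representsD(1)[OF rep0]] r])
  then have "limitin (L0_topology M \<tau> \<mu> d) (\<lambda>n. lift_homotopy (t (r n)) (L (r n))) (lift_homotopy t0 L1) sequentially"
    unfolding lift_homotopy_def f_def f0_def .
  then have "limitin lift_topology (\<lambda>n. lift_homotopy (t (r n)) (L (r n))) (lift_homotopy t0 L1) sequentially"
    unfolding limitin_subtopology
    using representsD(6)[OF lift_homotopy_represents[OF \<sigma>'(2)]] representsD(6)[OF lift_homotopy_represents[OF L1]] by simp
  then show "\<exists>r. limitin lift_topology (\<lambda>n. case \<sigma> (r n) of (t, L) \<Rightarrow> lift_homotopy t L)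
      (case l of (t, L) \<Rightarrow> lift_homotopy t L) sequentially"
    unfolding l t_def L_def by (intro exI[of _ r]) (simp add: case_prod_beta)
qed

text \<open>The unit interval is locally compact Hausdorff, so the product of its identity with the
  quotient map \<Phi> is again a quotient map, through which continuity on lifts descends.\<close>

lemma homotopy_continuous:
  "continuous_map (prod_topology (top_of_set {0..1}) full_topology) full_topology (\<lambda>(t, C). homotopy t C)"
proof (rule continuous_compose_quotient_map)
  have "locally_compact_space (top_of_set {0..1::real})"
    by (intro compact_imp_locally_compact_space) (simp add: compact_space_subtopology)
  moreover have "Hausdorff_space (top_of_set {0..1::real})"
    by (intro Hausdorff_space_subtopology Hausdorff_space_euclidean)
  ultimately show "quotient_map (prod_topology (top_of_set {0..1::real}) lift_topology)
      (prod_topology (top_of_set {0..1}) full_topology) (\<lambda>(t, L). (t, orbital_map M \<phi> L))"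
    by (intro quotient_map_prod_right quotient_map_orbital_map) simp_all
  show "continuous_map (prod_topology (top_of_set {0..1}) lift_topology) full_topology
      ((\<lambda>(t, C). homotopy t C) \<circ> (\<lambda>(t, L). (t, orbital_map M \<phi> L)))"
  proof (rule continuous_map_eq[OF continuous_map_compose[OF lift_homotopy_continuous orbital_map_continuous]])
    fix p assume "p \<in> topspace (prod_topology (top_of_set {0..1::real}) lift_topology)"
    then have "snd p \<in> orbital_lifts M \<tau> \<phi>" unfolding topspace_prod_topology topspace_lift_topology by auto
    from homotopy_orbital_map[OF this] 
    show "(orbital_map M \<phi> \<circ> (\<lambda>(t, L). lift_homotopy t L)) p =
        ((\<lambda>(t, C). homotopy t C) \<circ> (\<lambda>(t, L). (t, orbital_map M \<phi> L))) p"
      by (simp add: case_prod_beta)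
  qed
qed

lemma contractible_full_topology: "contractible_space full_topology"
  unfolding contractible_space_def
proof (rule exI[of _ "aut_class M id"], subst homotopic_with)
  show "\<exists>h. continuous_map (prod_topology (top_of_set {0..1::real}) full_topology) full_topology h \<and>
      (\<forall>C\<in>topspace full_topology. h (0, C) = id C) \<and>
      (\<forall>C\<in>topspace full_topology. h (1, C) = aut_class M id) \<and> (\<forall>t\<in>{0..1}. True)"
  proof (intro exI[of _ "\<lambda>(t, C). homotopy t C"] conjI ballI)
    show "continuous_map (prod_topology (top_of_set {0..1}) full_topology) full_topology (\<lambda>(t, C). homotopy t C)"
      by (rule homotopy_continuous)
    fix C assume "C \<in> topspace full_topology"
    then obtain T where T: "T \<in> full_maps" "C = aut_class M T"
      unfolding topspace_full_topology by (rule orbit_full_setE)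
    show "(case (0, C) of (t, C) \<Rightarrow> homotopy t C) = id C"
      using homotopy_class[OF full_mapsD(1)[OF T(1)], of 0] aut_class_eqI[OF contract_0[of T]] T(2) by simp
    show "(case (1, C) of (t, C) \<Rightarrow> homotopy t C) = aut_class M id"
      using homotopy_class[OF full_mapsD(1)[OF T(1)], of 1] T(2) by (simp add: contract_def)
  qed simp_all
qed simp

end

context polish_orbit_full_group
begin

lemma contractible: "contractible_space full_topology"
proof -
  obtain Y J where YJ: "shift_system Y J" using shift_system_exists by auto
  have "\<exists>f. f \<in> measurable M (borel_of \<tau>) \<and> (AE x in M. J n x = \<phi> (f x) x)" for n
  proof -
    have J: "J n \<in> full_maps" using YJ unfolding shift_system_def by simp
    \<comment> \<open>Surjectivity of the quotient map is what provides Borel lifts of the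
      \<open>J n\<close>.\<close>
    have "aut_class M (J n) \<in> orbital_map M \<phi> ` orbital_lifts M \<tau> \<phi>"
      unfolding orbital_map_surj by (rule orbit_full_setI[OF J])
    then obtain L where L: "L \<in> orbital_lifts M \<tau> \<phi>" "aut_class M (J n) = orbital_map M \<phi> L" by auto
    obtain f T where rep: "represents f T L" using orbital_lifts_represented[OF L(1)] by auto
    have "AE x in M. J n x = T x"
      by (rule aut_class_eqD[OF _ full_mapsD(1)[OF J]]) (simp add: L(2) representsD(5)[OF rep])
    with representsD(4)[OF rep] have "AE x in M. J n x = \<phi> (f x) x" by eventually_elim simp
    then show ?thesis using representsD(1)[OF rep] by blast
  qed
  then obtain j where j: "\<And>n. j n \<in> measurable M (borel_of \<tau>)" "\<And>n. AE x in M. J n x = \<phi> (j n x) x" by metis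
  obtain v :: "'a \<Rightarrow> real" where v: "v \<in> borel_measurable M" "inj_on v (space M)" "\<And>x. 0 \<le> v x"
    "\<And>r. emeasure M {x \<in> space M. v x \<le> r} < \<infinity>"
    using injective_coordinate[OF std] by metis
  \<comment> \<open>The 2 keeps the values between 0 and 1/2, and injectivity of \<open>v\<close> is
    inherited, so the level sets are null in the atomless space.\<close>
  define w where "w x = inverse (2 + v x)" for x
  have wm: "w \<in> borel_measurable M" unfolding w_def using v(1) by measurable
  have "0 < w x" "w x < 1" for x
    using v(3)[of x] unfolding w_def by (simp_all add: field_simps)
  moreover have "inj_on w (space M)"
    using v(2) unfolding w_def inj_on_def by simp
  then have "{x \<in> space M. w x = c} \<in> null_sets M" for c
    by (rule atomless_level_null[OF atomless_M wm])
  ultimately interpret contraction M \<mu> \<tau> d G \<phi> Y J j w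
    using YJ j wm by unfold_locales auto
  show ?thesis by (rule contractible_full_topology)
qed

end

theorem proposition7p4:
  fixes M \<mu> :: "'a measure"
    and G :: "'g monoid"
    and \<tau> :: "'g topology"
    and \<phi> :: "'g \<Rightarrow> 'a \<Rightarrow> 'a"
    and d :: "'g \<Rightarrow> 'g \<Rightarrow> real"
  assumes "standard_sigma_finite_space M"
    and "polish_group G \<tau>"
    and "borel_action G \<tau> M \<phi>"
    and "equivalent_prob M \<mu>"
    and "compatible_bounded_metric \<tau> d"
    and "ergodic M (carrier (orbit_full_group G M \<phi>))"
    and "polish_group (orbit_full_group G M \<phi>) (orbital_topology G \<tau> M \<phi> \<mu> d)"
  shows "contractible_space (orbital_topology G \<tau> M \<phi> \<mu> d)"
proof -
  have "polish_topology \<tau>" using assms(2) unfolding polish_group_def by simp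
  with assms interpret polish_orbit_full_group M \<mu> \<tau> d G \<phi>
    by unfold_locales
  show ?thesis by (rule contractible)
qed

end
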